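(* Let $1\le r\le\infty$, $r'=r/(r-1)$, let $\mathcal G=(V,E)$ be a connected simple graph with Beurling dimension $d$ and normal counting measure $\mu$, and let $\alpha>d/r'$. Then there exists a positive constant $C$, independent of matrices $A$ and integers $n\ge1$, such that for every nonzero $A\in\mathcal B_{r,\alpha}(\mathcal G)$ and every integer $n\ge1$, $$\frac{\|A^n\|_{\mathcal B_{r,\alpha}}}{\|A\|_{\mathcal B(\ell^2)}^n}\le C\,n\Big(\frac{n\|A\|_{\mathcal B_{r,\alpha}}}{\|A\|_{\mathcal B(\ell^2)}}\Big)^{(\alpha+d/r)/\min(\alpha-d/r',1)}\times L_n(A),$$ where $L_n(A)=1$ if $\alpha\ne d/r'+1$, and $L_n(A)=\Big(\ln\Big(\frac{n\|A\|_{\mathcal B_{r,\alpha}}}{\|A\|_{\mathcal B(\ell^2)}}+1\Big)\Big)^{(d+1)/r'}$ if $\alpha=d/r'+1$.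
   Context: A simple graph is an unweighted, undirected graph without loops or multiple edges. For a connected simple graph $\mathcal G=(V,E)$, $\rho(\lambda,\lambda')$ is the geodesic distance on $V$ (number of edges in a shortest path), $B(\lambda,R)=\{\lambda'\in V:\rho(\lambda,\lambda')\le R\}$, and $\mu$ is the counting measure on $V$. It has polynomial growth if there are positive constants $D_1(\mathcal G)$ and $d$ with $\mu(B(\lambda,R))\le D_1(\mathcal G)(R+1)^d$ for all $\lambda\in V$, $R\ge0$; the minimal constants $d$ and $D_1(\mathcal G)$ are called the Beurling dimension and density of $\mathcal G$. The counting measure is normal if there are positive constants $D_1(\mathcal G),D_2(\mathcal G)$ with $D_2(\mathcal G)(R+1)^d\le\mu(B(\lambda,R))\le D_1(\mathcal G)(R+1)^d$ for all $\lambda\in V$ and $0\le R\le\mathrm{diam}(\mathcal G)$. For a matrix $A=(a(\lambda,\lambda'))_{\lambda,\lambda'\in V}$ put $h_A(n)=\sup_{\rho(\lambda,\lambda')\ge n}|a(\lambda,\lambda')|$, $n\ge0$. For $1\le r\le\infty$, $\alpha\ge0$, $$\|A\|_{\mathcal B_{r,\alpha}}=\Big(\sum_{n=0}^\infty h_A(n)^r(n+1)^{\alpha r+d-1}\Big)^{1/r}\ (1\le r<\infty),\qquad \|A\|_{\mathcal B_{\infty,\alpha}}=\sup_{n\ge0}h_A(n)(n+1)^\alpha,$$ and $\mathcal B_{r,\alpha}(\mathcal G)$ is the set of all $A$ with $\|A\|_{\mathcal B_{r,\alpha}}<\infty$. $\mathcal B(\ell^2)$ is the algebra of bounded operators on $\ell^2=\ell^2(V)$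 with operator norm. Convention: $1/r'=0$ if $r=1$, $d/r=0$ and $r'=1$ if $r=\infty$. The constant $C$ may depend on $\mathcal G,r,\alpha$. *)

theory Defs
  imports "HOL-Analysis.Analysis"
begin

section \<open>Connected simple graphs\<close>

text \<open>A simple graph is a vertex set together with a symmetric irreflexive adjacency relation;
  the vertex set may be infinite. A walk of length \<open>n\<close> from \<open>u\<close> to \<open>v\<close> is expressed by
  \<open>(u, v) \<in> E ^^ n\<close>.\<close>

definition connected_simple_graph :: "'v set \<Rightarrow> ('v \<times> 'v) set \<Rightarrow> bool" where
  "connected_simple_graph V E \<longleftrightarrow>
     V \<noteq> {} \<and> E \<subseteq> V \<times> V \<and> sym E \<and> irrefl E \<and> (\<forall>u\<in>V. \<forall>v\<in>V. (u, v) \<in> E\<^sup>*)"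

definition gdist :: "('v \<times> 'v) set \<Rightarrow> 'v \<Rightarrow> 'v \<Rightarrow> nat" where
  "gdist E u v = (LEAST n. (u, v) \<in> E ^^ n)"

definition gball :: "'v set \<Rightarrow> ('v \<times> 'v) set \<Rightarrow> 'v \<Rightarrow> real \<Rightarrow> 'v set" where
  "gball V E u R = {v \<in> V. real (gdist E u v) \<le> R}"

definition gdiam :: "'v set \<Rightarrow> ('v \<times> 'v) set \<Rightarrow> ereal" where
  "gdiam V E = (SUP u\<in>V. SUP v\<in>V. ereal (real (gdist E u v)))"

definition growth_exponents :: "'v set \<Rightarrow> ('v \<times> 'v) set \<Rightarrow> real set" where
  "growth_exponents V E = {d. 0 < d \<and> (\<exists>D>0. \<forall>u\<in>V. \<forall>R\<ge>0.
     emeasure (count_space V) (gball V E u R) \<le> ennreal (D * (R + 1) powr d))}"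

definition polynomial_growth :: "'v set \<Rightarrow> ('v \<times> 'v) set \<Rightarrow> bool" where
  "polynomial_growth V E \<longleftrightarrow> growth_exponents V E \<noteq> {}"

text \<open>The minimal growth exponent, read as an infimum. If the counting measure of an infinite graph
  is normal, the infimum is attained; for a finite graph it is 0 and is not attained.\<close>

definition beurling_dim :: "'v set \<Rightarrow> ('v \<times> 'v) set \<Rightarrow> real" where
  "beurling_dim V E = Inf (growth_exponents V E)"

definition normal_counting_measure :: "'v set \<Rightarrow> ('v \<times> 'v) set \<Rightarrow> bool" where
  "normal_counting_measure V E \<longleftrightarrow>
     (\<exists>D1>0. \<exists>D2>0. \<forall>u\<in>V. \<forall>R::real. 0 \<le> R \<and> ereal R \<le> gdiam V E \<longrightarrow>
        ennreal (D2 * (R + 1) powr beurling_dim V E) \<le> emeasure (count_space V) (gball V E u R) \<and>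
        emeasure (count_space V) (gball V E u R) \<le> ennreal (D1 * (R + 1) powr beurling_dim V E))"

section \<open>Matrices over the vertex set\<close>

text \<open>A matrix is a function \<open>A\<close> of two vertices, of which only the values on \<open>V \<times> V\<close> matter.
  Infinite sums are unconditional sums; \<open>infsum\<close> is 0 where such a sum does not converge.\<close>

definition mat_vec :: "'v set \<Rightarrow> ('v \<Rightarrow> 'v \<Rightarrow> complex) \<Rightarrow> ('v \<Rightarrow> complex) \<Rightarrow> 'v \<Rightarrow> complex" where
  "mat_vec V A x u = (\<Sum>\<^sub>\<infinity>v\<in>V. A u v * x v)"

definition mat_mult ::
    "'v set \<Rightarrow> ('v \<Rightarrow> 'v \<Rightarrow> complex) \<Rightarrow> ('v \<Rightarrow> 'v \<Rightarrow> complex) \<Rightarrow> 'v \<Rightarrow> 'v \<Rightarrow> complex" where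
  "mat_mult V A B u v = (\<Sum>\<^sub>\<infinity>w\<in>V. A u w * B w v)"

primrec mat_pow :: "'v set \<Rightarrow> ('v \<Rightarrow> 'v \<Rightarrow> complex) \<Rightarrow> nat \<Rightarrow> 'v \<Rightarrow> 'v \<Rightarrow> complex" where
  "mat_pow V A 0 = (\<lambda>u v. if u = v then 1 else 0)"
| "mat_pow V A (Suc n) = mat_mult V A (mat_pow V A n)"

definition ell2 :: "'v set \<Rightarrow> ('v \<Rightarrow> complex) set" where
  "ell2 V = {x. (\<lambda>v. (cmod (x v))\<^sup>2) summable_on V}"

definition ell2_norm :: "'v set \<Rightarrow> ('v \<Rightarrow> complex) \<Rightarrow> real" where
  "ell2_norm V x = sqrt (\<Sum>\<^sub>\<infinity>v\<in>V. (cmod (x v))\<^sup>2)"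

definition bounded_on_ell2 :: "'v set \<Rightarrow> ('v \<Rightarrow> 'v \<Rightarrow> complex) \<Rightarrow> bool" where
  "bounded_on_ell2 V A \<longleftrightarrow>
     (\<forall>x\<in>ell2 V. (\<forall>u\<in>V. (\<lambda>v. A u v * x v) summable_on V) \<and> mat_vec V A x \<in> ell2 V) \<and>
     (\<exists>K. \<forall>x\<in>ell2 V. ell2_norm V (mat_vec V A x) \<le> K * ell2_norm V x)"

text \<open>Meaningful only for matrices satisfying \<^const>\<open>bounded_on_ell2\<close>.\<close>

definition op_norm :: "'v set \<Rightarrow> ('v \<Rightarrow> 'v \<Rightarrow> complex) \<Rightarrow> real" where
  "op_norm V A = (SUP x\<in>{x \<in> ell2 V. ell2_norm V x \<le> 1}. ell2_norm V (mat_vec V A x))"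

section \<open>The algebras $\mathcal{B}_{r,\alpha}$\<close>

text \<open>The supremum is taken in \<^typ>\<open>ennreal\<close>: it is 0 if no pair of vertices has distance
  at least \<open>n\<close>, and \<open>\<infinity>\<close> if the entries are unbounded.\<close>

definition offdiag_sup ::
    "'v set \<Rightarrow> ('v \<times> 'v) set \<Rightarrow> ('v \<Rightarrow> 'v \<Rightarrow> complex) \<Rightarrow> nat \<Rightarrow> ennreal" where
  "offdiag_sup V E A n =
     (SUP (u, v)\<in>{(u, v). u \<in> V \<and> v \<in> V \<and> n \<le> gdist E u v}. ennreal (cmod (A u v)))"

text \<open>Real powers on $[0,\infty]$, used only for positive exponents.\<close>

definition ennreal_rpow :: "ennreal \<Rightarrow> real \<Rightarrow> ennreal" where
  "ennreal_rpow x p = (if x = \<infinity> then \<infinity> else ennreal (enn2real x powr p))"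

definition B_ennorm :: "'v set \<Rightarrow> ('v \<times> 'v) set \<Rightarrow> ereal \<Rightarrow> real \<Rightarrow>
    ('v \<Rightarrow> 'v \<Rightarrow> complex) \<Rightarrow> ennreal" where
  "B_ennorm V E r \<alpha> A =
     (if r = \<infinity>
      then (SUP n. offdiag_sup V E A n * ennreal ((real n + 1) powr \<alpha>))
      else (let p = real_of_ereal r in
        ennreal_rpow
          (\<Sum>n. ennreal_rpow (offdiag_sup V E A n) p *
               ennreal ((real n + 1) powr (\<alpha> * p + beurling_dim V E - 1)))
          (1 / p)))"

definition B_alg :: "'v set \<Rightarrow> ('v \<times> 'v) set \<Rightarrow> ereal \<Rightarrow> real \<Rightarrow> ('v \<Rightarrow> 'v \<Rightarrow> complex) set" where
  "B_alg V E r \<alpha> = {A. B_ennorm V E r \<alpha> A < \<infinity>}"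

definition B_norm :: "'v set \<Rightarrow> ('v \<times> 'v) set \<Rightarrow> ereal \<Rightarrow> real \<Rightarrow>
    ('v \<Rightarrow> 'v \<Rightarrow> complex) \<Rightarrow> real" where
  "B_norm V E r \<alpha> A = enn2real (B_ennorm V E r \<alpha> A)"

section \<open>Exponents\<close>

text \<open>In \<^typ>\<open>ereal\<close> we have \<open>1 / 0 = \<infinity>\<close>, so the conjugate of 1 is \<open>\<infinity>\<close>.\<close>

definition conj_exponent :: "ereal \<Rightarrow> ereal" where
  "conj_exponent r = (if r = \<infinity> then 1 else r / (r - 1))"

text \<open>Division of a real number by an exponent in $[1,\infty]$, with \<open>t / \<infinity> = 0\<close>.\<close>

definition over :: "real \<Rightarrow> ereal \<Rightarrow> real" where
  "over t p = real_of_ereal (ereal t / p)"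

lemma conj_exponent_one: "conj_exponent 1 = \<infinity>"
  by (simp add: conj_exponent_def divide_ereal_def zero_ereal_def one_ereal_def)

lemma over_infinity: "over t \<infinity> = 0"
  by (simp add: over_def)

lemma over_ereal: "q \<noteq> 0 \<Longrightarrow> over t (ereal q) = t / q"
  by (simp add: over_def)

lemma conj_exponent_ereal: "q \<noteq> 1 \<Longrightarrow> conj_exponent (ereal q) = ereal (q / (q - 1))"
  by (simp add: conj_exponent_def one_ereal_def)

end

theory Submission
  imports Defs
begin

text \<open>Write \<open>\<nu> = op_norm V A\<close>, and let \<open>y k\<close> be the column of \<open>A ^ k\<close> at a vertex \<open>w\<close>. Fix a radius
  \<open>N\<close>, cut \<open>y k\<close> off to the ball of radius \<open>2 N\<close> around \<open>u\<close> by a Lipschitz function, and let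
  \<open>a k u\<close> be the $\ell^2$ norm of the result. Commuting \<open>A\<close> with the cutoff gives
  \<open>a (k + 1) u \<le> \<nu> * a k u + error\<close>, where the error is a convolution of \<open>a k\<close> with a decaying kernel of
  total mass of order \<open>\<nu> / n\<close>, provided that \<open>N\<close> is about \<open>M powr (1 / min (\<alpha> - d / r') 1)\<close> with
  \<open>M = n * B_norm A / \<nu>\<close> (times a power of \<open>ln M\<close> in the critical case). A slowly decaying profile \<open>q\<close>
  adapted to this kernel reproduces itself under the convolution, so \<open>n\<close> steps cost only a bounded
  factor: the entry of \<open>A ^ n\<close> at \<open>(u, w)\<close> is at most a constant times \<open>\<nu> ^ n * q (gdist E u w)\<close>. The
  norm of \<open>q\<close> is of order \<open>N powr (\<alpha> + d / r)\<close>, so not even the factor \<open>n\<close> is lost. On a finite graph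
  all quantities are comparable to constants.\<close>

section \<open>Power sums\<close>

text \<open>The operator norm \<open>\<nu>\<close> controls only ell2 norms, while the B norm
  measures single entries; multiplying out entries would cost the B norm of \<open>A\<close> instead
  of \<open>\<nu>\<close> at every step. Localised ell2 norms lie between the two, and an error of
  order \<open>\<nu> / n\<close> per step is affordable because (1 + c / n)^n stays below exp c. The
  radius answers this budget: a cutoff of slope 1 / N has a commutator with kernel min 1 (j / N) * h
  j at distance j, where h is the off-diagonal supremum of \<open>A\<close>. With s = \<alpha> - d /
  r' its mass is at most of order N^(- min s 1) times the B norm of \<open>A\<close>, with an
  additional power of ln N when s = 1; hence the exponent min s 1 and the exceptional case. A second
  obstacle is that h may drop abruptly, so that pointwise bounds by its convolutions do not close
  under iteration. It is replaced by a majorant that decreases at most at the rate b = \<alpha> + d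
  / r + 1; the extra 1 over the natural decay rate \<alpha> + d / r keeps the norm of the majorant
  comparable to that of h.\<close>

lemma powr_Suc_diff_le:
  fixes x q :: real
  assumes "1 \<le> q" "0 \<le> x"
  shows "(x + 1) powr q - x powr q \<le> q * (x + 1) powr (q - 1)"
proof (cases "x = 0")
  case True
  then show ?thesis using assms by simp
next
  case False
  then have x: "x > 0" using assms by simp
  have "\<exists>z>x. z < x + 1 \<and> (x + 1) powr q - x powr q = (x + 1 - x) * (q * z powr (q - 1))"
    by (rule MVT2) (use x in \<open>auto intro!: derivative_eq_intros simp: powr_diff\<close>)
  then obtain z where z: "x < z" "z < x + 1"
    and eq: "(x + 1) powr q - x powr q = q * z powr (q - 1)" by auto
  have "z powr (q - 1) \<le> (x + 1) powr (q - 1)"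
    by (rule powr_mono2) (use assms x z in auto)
  then show ?thesis unfolding eq using assms by (simp add: mult_left_mono)
qed

lemma powr_Suc_diff_ge:
  fixes x q :: real
  assumes "0 < q" "q \<le> 1" "0 \<le> x"
  shows "q * (x + 1) powr (q - 1) \<le> (x + 1) powr q - x powr q"
proof (cases "x = 0")
  case True
  then show ?thesis using assms by simp
next
  case False
  then have x: "x > 0" using assms by simp
  have "\<exists>z>x. z < x + 1 \<and> (x + 1) powr q - x powr q = (x + 1 - x) * (q * z powr (q - 1))"
    by (rule MVT2) (use x in \<open>auto intro!: derivative_eq_intros simp: powr_diff\<close>)
  then obtain z where z: "x < z" "z < x + 1"
    and eq: "(x + 1) powr q - x powr q = q * z powr (q - 1)" by auto
  have "(x + 1) powr (q - 1) \<le> z powr (q - 1)"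
    by (rule powr_mono2') (use assms x z in auto)
  then show ?thesis unfolding eq using assms by (simp add: mult_left_mono)
qed

lemma powr_neg_diff_ge:
  fixes x t :: real
  assumes "0 < t" "0 < x"
  shows "t * (x + 1) powr (- t - 1) \<le> x powr - t - (x + 1) powr - t"
proof -
  have "\<exists>z>x. z < x + 1 \<and> (x + 1) powr - t - x powr - t = (x + 1 - x) * (- t * z powr (- t - 1))"
    by (rule MVT2) (use assms in \<open>auto intro!: derivative_eq_intros simp: powr_diff\<close>)
  then obtain z where z: "x < z" "z < x + 1"
    and eq: "(x + 1) powr - t - x powr - t = - t * z powr (- t - 1)" by auto
  have "(x + 1) powr (- t - 1) \<le> z powr (- t - 1)"
    by (rule powr_mono2') (use assms z in auto)
  then have "t * (x + 1) powr (- t - 1) \<le> t * z powr (- t - 1)"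
    using assms by (simp add: mult_left_mono)
  then show ?thesis using eq by linarith
qed

text \<open>Telescoping against the power \<open>- t\<close>. The mean value bound controls the term
  at \<open>y + 1\<close>, not at \<open>y\<close>; \<open>y + 1 \<le> 2 * y\<close> for
  \<open>y \<ge> 1\<close> repairs the shift at the cost of \<open>2 powr (t + 1)\<close>.\<close>

lemma sum_powr_tail:
  fixes x t :: real
  assumes "0 < t" "1 \<le> x"
  shows "(\<Sum>j<m. (x + real j) powr (- t - 1)) \<le> 2 powr (t + 1) / t * x powr - t"
proof -
  have step: "(x + real j) powr (- t - 1)
      \<le> 2 powr (t + 1) / t * ((x + real j) powr - t - (x + real (Suc j)) powr - t)" for j
  proof -
    let ?y = "x + real j"
    have "(2 * ?y) powr (- t - 1) = 2 powr (- t - 1) * ?y powr (- t - 1)"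
      by (rule powr_mult)
    moreover have "2 powr (t + 1) * 2 powr (- t - 1) = (1::real)"
      by (simp flip: powr_add)
    ultimately have "?y powr (- t - 1) = 2 powr (t + 1) * (2 * ?y) powr (- t - 1)"
      by (simp only: mult.assoc[symmetric])
    also have "(2 * ?y) powr (- t - 1) \<le> (?y + 1) powr (- t - 1)"
      by (rule powr_mono2') (use assms in auto)
    also have "(?y + 1) powr (- t - 1) \<le> (?y powr - t - (?y + 1) powr - t) / t"
      using powr_neg_diff_ge[of t ?y] assms by (simp add: field_simps)
    finally have "?y powr (- t - 1)
        \<le> 2 powr (t + 1) * ((?y powr - t - (?y + 1) powr - t) / t)"
      by (simp add: mult_left_mono)
    then show ?thesis by (simp add: add.assoc add.commute[of 1])
  qed
  have "(\<Sum>j<m. (x + real j) powr (- t - 1))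
      \<le> (\<Sum>j<m. 2 powr (t + 1) / t * ((x + real j) powr - t - (x + real (Suc j)) powr - t))"
    by (rule sum_mono) (rule step)
  also have "\<dots> = 2 powr (t + 1) / t * (x powr - t - (x + real m) powr - t)"
    unfolding sum_distrib_left[symmetric]
    using sum_lessThan_telescope'[of "\<lambda>j. (x + real j) powr - t" m] by simp
  also have "\<dots> \<le> 2 powr (t + 1) / t * x powr - t"
    by (rule mult_left_mono) (use assms in auto)
  finally show ?thesis .
qed

lemma sum_powr_tail_from:
  assumes "0 < t"
  shows "(\<Sum>j\<in>{l..<m}. (real j + 1) powr (- t - 1)) \<le> 2 powr (t + 1) / t * (real l + 1) powr - t"
proof -
  have "(\<Sum>j\<in>{l..<m}. (real j + 1) powr (- t - 1))
      = (\<Sum>j<m - l. ((real l + 1) + real j) powr (- t - 1))"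
    by (rule sum.reindex_bij_witness[of _ "\<lambda>j. j + l" "\<lambda>j. j - l"])
       (auto simp: of_nat_diff algebra_simps)
  then show ?thesis using sum_powr_tail[OF assms, of "real l + 1" "m - l"] by simp
qed

lemma sum_powr_ge:
  assumes "0 \<le> t"
  shows "(real j + 1) powr (t + 1) \<le> (t + 1) * (\<Sum>i\<le>j. (real i + 1) powr t)"
proof (induction j)
  case 0
  then show ?case using assms by simp
next
  case (Suc j)
  then show ?case
    using powr_Suc_diff_le[of "t + 1" "real j + 1"] assms by (simp add: algebra_simps)
qed

lemma sum_powr_le:
  assumes "0 < t" "t < 1"
  shows "(\<Sum>i\<le>j. (real i + 1) powr - t) \<le> (real j + 1) powr (1 - t) / (1 - t)"
proof -
  have "(1 - t) * (\<Sum>i\<le>j. (real i + 1) powr - t) \<le> (real j + 1) powr (1 - t)"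
  proof (induction j)
    case 0
    then show ?case using assms by simp
  next
    case (Suc j)
    then show ?case
      using powr_Suc_diff_ge[of "1 - t" "real j + 1"] assms by (simp add: algebra_simps)
  qed
  then show ?thesis using assms by (simp add: field_simps)
qed

lemma sum_inverse_le_ln: "(\<Sum>i\<le>j. 1 / (real i + 1)) \<le> 1 + ln (real j + 1)"
proof (induction j)
  case 0
  then show ?case by simp
next
  case (Suc j)
  have "ln (1 + (-1 / (real j + 2))) \<le> -1 / (real j + 2)"
    by (rule ln_add_one_self_le_self2) (simp add: field_simps)
  moreover have "1 + (-1 / (real j + 2)) = (real j + 1) / (real j + 2)"
    by (simp add: field_simps)
  ultimately have "ln (real j + 1) - ln (real j + 2) \<le> -1 / (real j + 2)"
    by (simp add: ln_div)
  then show ?case using Suc by (simp add: algebra_simps)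
qed

section \<open>Sequences in weighted spaces\<close>

text \<open>The radial form of the B norm, with \<open>G\<close> as a bound for it. Finite exponents
  are phrased through partial sums, so that neither summability nor \<open>ennreal\<close> has to be
  carried through the estimates.\<close>

definition seq_bd :: "ereal \<Rightarrow> real \<Rightarrow> real \<Rightarrow> (nat \<Rightarrow> real) \<Rightarrow> real \<Rightarrow> bool" where
  "seq_bd r \<alpha> d g G \<longleftrightarrow>
     (if r = \<infinity> then \<forall>j. g j * (real j + 1) powr \<alpha> \<le> G
      else (let p = real_of_ereal r in
        \<forall>m. (\<Sum>j<m. g j powr p * (real j + 1) powr (\<alpha> * p + d - 1)) \<le> G powr p))"

lemma seq_bd_infty: "seq_bd \<infinity> \<alpha> d g G \<longleftrightarrow> (\<forall>j. g j * (real j + 1) powr \<alpha> \<le> G)"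
  by (simp add: seq_bd_def)

lemma seq_bd_ereal:
  "seq_bd (ereal p) \<alpha> d g G \<longleftrightarrow>
     (\<forall>m. (\<Sum>j<m. g j powr p * (real j + 1) powr (\<alpha> * p + d - 1)) \<le> G powr p)"
  by (simp add: seq_bd_def)

lemma exponent_cases:
  assumes "(1::ereal) \<le> r"
  obtains "r = \<infinity>" | p where "r = ereal p" "1 \<le> p"
  using assms by (cases r) (auto simp: one_ereal_def)

lemma seq_bd_mono:
  assumes r: "1 \<le> r" and bd: "seq_bd r \<alpha> d g G" and le: "\<And>j. f j \<le> g j" and "\<And>j. 0 \<le> f j"
    and G: "G \<le> G'" "0 \<le> G"
  shows "seq_bd r \<alpha> d f G'"
  using r
proof (cases rule: exponent_cases)
  case 1
  have "f j * (real j + 1) powr \<alpha> \<le> G'" for j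
  proof -
    have "f j * (real j + 1) powr \<alpha> \<le> g j * (real j + 1) powr \<alpha>"
      by (rule mult_right_mono[OF le]) simp
    also have "\<dots> \<le> G" using bd 1 by (simp add: seq_bd_infty)
    finally show ?thesis using G(1) by simp
  qed
  then show ?thesis using 1 by (simp add: seq_bd_infty)
next
  case (2 p)
  have "(\<Sum>j<m. f j powr p * (real j + 1) powr (\<alpha> * p + d - 1)) \<le> G' powr p" for m
  proof -
    have "(\<Sum>j<m. f j powr p * (real j + 1) powr (\<alpha> * p + d - 1))
        \<le> (\<Sum>j<m. g j powr p * (real j + 1) powr (\<alpha> * p + d - 1))"
      by (intro sum_mono mult_right_mono powr_mono2) (use assms 2 in auto)
    also have "\<dots> \<le> G powr p" using bd 2 by (simp add: seq_bd_ereal)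
    also have "\<dots> \<le> G' powr p" by (rule powr_mono2) (use G 2 in auto)
    finally show ?thesis .
  qed
  then show ?thesis using 2 by (simp add: seq_bd_ereal)
qed

lemma seq_bd_scale:
  assumes r: "1 \<le> r" and bd: "seq_bd r \<alpha> d g G" and "\<And>j. 0 \<le> g j" "0 \<le> c" "0 \<le> G"
  shows "seq_bd r \<alpha> d (\<lambda>j. c * g j) (c * G)"
  using r
proof (cases rule: exponent_cases)
  case 1
  then show ?thesis using assms by (auto simp: seq_bd_infty mult.assoc mult_left_mono)
next
  case (2 p)
  have "(\<Sum>j<m. (c * g j) powr p * (real j + 1) powr (\<alpha> * p + d - 1)) \<le> (c * G) powr p" for m
  proof -
    have "(\<Sum>j<m. (c * g j) powr p * (real j + 1) powr (\<alpha> * p + d - 1))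
       = c powr p * (\<Sum>j<m. g j powr p * (real j + 1) powr (\<alpha> * p + d - 1))"
      by (simp add: powr_mult sum_distrib_left mult.assoc)
    also have "\<dots> \<le> c powr p * G powr p"
      using bd 2 by (simp add: seq_bd_ereal mult_left_mono)
    finally show ?thesis by (simp add: powr_mult)
  qed
  then show ?thesis using 2 by (simp add: seq_bd_ereal)
qed

lemma powr_add_le:
  fixes x y p :: real
  assumes "0 \<le> x" "0 \<le> y" "0 \<le> p"
  shows "(x + y) powr p \<le> 2 powr p * (x powr p + y powr p)"
proof -
  have "(x + y) powr p \<le> (2 * max x y) powr p"
    by (rule powr_mono2) (use assms in auto)
  also have "\<dots> = 2 powr p * (max x y) powr p"
    by (rule powr_mult)
  also have "(max x y) powr p \<le> x powr p + y powr p"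
    by (simp add: max_def)
  finally show ?thesis by (simp add: mult_left_mono)
qed

text \<open>A crude bound for p-th powers of sums stands in for Minkowski's inequality. It costs one
  factor \<open>2 powr p\<close>; a second one absorbs the two summands \<open>F powr p\<close> and
  \<open>G powr p\<close>, whence the 4.\<close>

lemma seq_bd_add:
  assumes r: "1 \<le> r" and f: "seq_bd r \<alpha> d f F" "\<And>j. 0 \<le> f j" "0 \<le> F"
    and g: "seq_bd r \<alpha> d g G" "\<And>j. 0 \<le> g j" "0 \<le> G"
  shows "seq_bd r \<alpha> d (\<lambda>j. f j + g j) (4 * (F + G))"
  using r
proof (cases rule: exponent_cases)
  case 1
  have "(f j + g j) * (real j + 1) powr \<alpha> \<le> 4 * (F + G)" for j
  proof -
    have "f j * (real j + 1) powr \<alpha> \<le> F" "g j * (real j + 1) powr \<alpha> \<le> G"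
      using f(1) g(1) 1 by (auto simp: seq_bd_infty)
    then show ?thesis using f(3) g(3) by (simp add: distrib_right)
  qed
  then show ?thesis using 1 by (simp add: seq_bd_infty)
next
  case (2 p)
  have "(\<Sum>j<m. (f j + g j) powr p * (real j + 1) powr (\<alpha> * p + d - 1))
      \<le> (4 * (F + G)) powr p" for m
  proof -
    let ?w = "\<lambda>j. (real j + 1) powr (\<alpha> * p + d - 1)"
    have "(\<Sum>j<m. (f j + g j) powr p * ?w j)
        \<le> (\<Sum>j<m. (2 powr p * (f j powr p + g j powr p)) * ?w j)"
      by (intro sum_mono mult_right_mono powr_add_le) (use f g 2 in auto)
    also have "\<dots> = 2 powr p * ((\<Sum>j<m. f j powr p * ?w j) + (\<Sum>j<m. g j powr p * ?w j))"
      by (simp add: sum_distrib_left distrib_left distrib_right sum.distrib mult.assoc)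
    also have "\<dots> \<le> 2 powr p * (F powr p + G powr p)"
      using f(1) g(1) 2 by (intro mult_left_mono add_mono) (auto simp: seq_bd_ereal)
    also have "\<dots> \<le> 2 powr p * (2 * (F + G) powr p)"
    proof -
      have "F powr p \<le> (F + G) powr p" "G powr p \<le> (F + G) powr p"
        using f g 2 by (auto intro!: powr_mono2)
      then show ?thesis by (intro mult_left_mono) auto
    qed
    also have "\<dots> \<le> 2 powr p * (2 powr p * (F + G) powr p)"
      using powr_mono[of 1 p 2] 2 by (intro mult_left_mono mult_right_mono) auto
    also have "\<dots> = (2 * (2 * (F + G))) powr p"
      by (simp only: powr_mult)
    also have "2 * (2 * (F + G)) = 4 * (F + G)" by simp
    finally show ?thesis .
  qed
  then show ?thesis using 2 by (simp add: seq_bd_ereal)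
qed

text \<open>For decreasing \<open>h\<close> the value \<open>h j\<close> can be charged against all
  weights up to \<open>j\<close>, whose sum is of order
  \<open>(j + 1) powr (\<alpha> * p + d)\<close>; the p-th root gives the exponent.\<close>

lemma seq_bd_decay:
  assumes r: "1 \<le> r" and "0 \<le> \<alpha>" "1 \<le> d"
  shows "\<exists>K>0. \<forall>h H. antimono h \<longrightarrow> (\<forall>j. 0 \<le> h j) \<longrightarrow> 0 \<le> H \<longrightarrow> seq_bd r \<alpha> d h H \<longrightarrow>
    (\<forall>j. h j \<le> K * H * (real j + 1) powr - (\<alpha> + over d r))"
  using r
proof (cases rule: exponent_cases)
  case 1
  show ?thesis
    by (rule exI[of _ 1]) (use 1 in \<open>auto simp: seq_bd_infty over_infinity powr_minus field_simps\<close>)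
next
  case (2 p)
  let ?K = "(\<alpha> * p + d) powr (1 / p)"
  have pos: "\<alpha> * p + d \<ge> 1" using assms 2 by (simp add: add_increasing)
  have "h j \<le> ?K * H * (real j + 1) powr - (\<alpha> + over d r)"
    if h: "antimono h" "\<forall>j. 0 \<le> h j" and H: "0 \<le> H" and bd: "seq_bd r \<alpha> d h H" for h H j
  proof -
    have "h j powr p * (real j + 1) powr (\<alpha> * p + d)
        \<le> h j powr p * ((\<alpha> * p + d) * (\<Sum>i\<le>j. (real i + 1) powr (\<alpha> * p + d - 1)))"
      using sum_powr_ge[of "\<alpha> * p + d - 1" j] pos by (intro mult_left_mono) auto
    also have "\<dots> = (\<alpha> * p + d) * (\<Sum>i\<le>j. h j powr p * (real i + 1) powr (\<alpha> * p + d - 1))"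
      by (simp add: sum_distrib_left mult.left_commute)
    also have "\<dots> \<le> (\<alpha> * p + d) * (\<Sum>i\<le>j. h i powr p * (real i + 1) powr (\<alpha> * p + d - 1))"
      using pos h 2 by (intro mult_left_mono sum_mono mult_right_mono powr_mono2) (auto simp: antimono_def)
    also have "\<dots> \<le> (\<alpha> * p + d) * H powr p"
      using bd 2 pos by (intro mult_left_mono)
        (auto simp: seq_bd_ereal lessThan_Suc_atMost[symmetric] simp del: sum.lessThan_Suc)
    finally have *: "h j powr p * (real j + 1) powr (\<alpha> * p + d) \<le> (\<alpha> * p + d) * H powr p" .
    have "(h j powr p * (real j + 1) powr (\<alpha> * p + d)) powr (1 / p)
        \<le> ((\<alpha> * p + d) * H powr p) powr (1 / p)"
      by (rule powr_mono2[OF _ _ *]) (use 2 in auto)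
    then have "h j * (real j + 1) powr ((\<alpha> * p + d) / p) \<le> ?K * H"
      using 2 h H pos by (simp add: powr_mult powr_powr)
    moreover have "(\<alpha> * p + d) / p = \<alpha> + over d r"
      using 2 by (simp add: over_ereal field_simps)
    ultimately have "h j * (real j + 1) powr (\<alpha> + over d r) \<le> ?K * H"
      by (simp only:)
    then have "h j * (real j + 1) powr (\<alpha> + over d r) * (real j + 1) powr - (\<alpha> + over d r)
        \<le> ?K * H * (real j + 1) powr - (\<alpha> + over d r)"
      by (rule mult_right_mono) simp
    then show ?thesis by (simp add: mult.assoc flip: powr_add)
  qed
  then show ?thesis using pos by (intro exI[of _ ?K]) auto
qed

text \<open>Up to distance about \<open>N\<close> the bump is roughly constant and contributes
  \<open>N powr (\<alpha> + over d r)\<close>; the extra 1 in its exponent keeps the remaining range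
  at the same size. Rewriting the bump with \<open>N + j\<close> treats both ranges at once.\<close>

lemma seq_bd_bump:
  assumes r: "1 \<le> r" and "0 \<le> \<alpha>" "1 \<le> d"
  shows "\<exists>K>0. \<forall>N\<ge>1. seq_bd r \<alpha> d
     (\<lambda>j. (1 + real j / real N) powr - (\<alpha> + over d r + 1)) (K * real N powr (\<alpha> + over d r))"
proof -
  have base: "(1 + real j / real N) powr - b = real N powr b * (real N + real j) powr - b"
    if "1 \<le> N" for j N b
  proof -
    have "1 + real j / real N = (real N + real j) / real N" using that by (simp add: field_simps)
    then show ?thesis using that by (simp add: powr_divide powr_minus field_simps)
  qed
  show ?thesis using r
  proof (cases rule: exponent_cases)
    case 1
    have "(1 + real j / real N) powr - (\<alpha> + 1) * (real j + 1) powr \<alpha> \<le> 1 * real N powr \<alpha>"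
      if "1 \<le> N" for N j
    proof -
      have "(1 + real j / real N) powr - (\<alpha> + 1) * (real j + 1) powr \<alpha>
          \<le> real N powr (\<alpha> + 1) * (real N + real j) powr - (\<alpha> + 1) * (real N + real j) powr \<alpha>"
        unfolding base[OF that] using that assms by (intro mult_left_mono powr_mono2) auto
      also have "\<dots> = real N powr (\<alpha> + 1) * (real N + real j) powr - 1"
        by (simp add: mult.assoc flip: powr_add)
      also have "\<dots> \<le> real N powr (\<alpha> + 1) * real N powr - 1"
        using that by (intro mult_left_mono powr_mono2') auto
      also have "\<dots> = real N powr \<alpha>" by (simp only: powr_add[symmetric]) simp
      finally show ?thesis by simp
    qed
    then show ?thesis using 1 by (intro exI[of _ 1]) (auto simp: seq_bd_infty over_infinity)
  next
    case (2 p)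
    define \<gamma> where "\<gamma> = \<alpha> + over d r"
    have gp: "\<gamma> * p = \<alpha> * p + d" using 2 by (simp add: \<gamma>_def over_ereal field_simps)
    let ?K = "(2 powr (p + 1) / p) powr (1 / p)"
    have "(\<Sum>j<m. ((1 + real j / real N) powr - (\<gamma> + 1)) powr p * (real j + 1) powr (\<alpha> * p + d - 1))
        \<le> (?K * real N powr \<gamma>) powr p" if N: "1 \<le> N" for N m
    proof -
      have pos: "\<alpha> * p + d - 1 \<ge> 0" using assms 2 mult_nonneg_nonneg[of \<alpha> p] by linarith
      have "(\<Sum>j<m. ((1 + real j / real N) powr - (\<gamma> + 1)) powr p * (real j + 1) powr (\<alpha> * p + d - 1))
        \<le> (\<Sum>j<m. real N powr (\<gamma> * p + p) * (real N + real j) powr (- p - 1))"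
      proof (rule sum_mono)
        fix j
        have "((1 + real j / real N) powr - (\<gamma> + 1)) powr p * (real j + 1) powr (\<alpha> * p + d - 1)
          \<le> real N powr (\<gamma> * p + p) * (real N + real j) powr (- (\<gamma> * p + p)) * (real N + real j) powr (\<alpha> * p + d - 1)"
          unfolding base[OF N] using N pos
          by (intro mult_mono powr_mono2) (auto simp: powr_mult powr_powr algebra_simps)
        also have "\<dots> = real N powr (\<gamma> * p + p) * (real N + real j) powr (- p - 1)"
        proof -
          have "- (\<gamma> * p + p) + (\<alpha> * p + d - 1) = - p - 1" by (simp add: gp)
          then show ?thesis by (simp only: mult.assoc powr_add[symmetric])
        qed
        finally show "((1 + real j / real N) powr - (\<gamma> + 1)) powr p * (real j + 1) powr (\<alpha> * p + d - 1)
          \<le> real N powr (\<gamma> * p + p) * (real N + real j) powr (- p - 1)" .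
      qed
      also have "\<dots> = real N powr (\<gamma> * p + p) * (\<Sum>j<m. (real N + real j) powr (- p - 1))"
        by (simp add: sum_distrib_left)
      also have "\<dots> \<le> real N powr (\<gamma> * p + p) * (2 powr (p + 1) / p * real N powr - p)"
        using sum_powr_tail[of p "real N" m] 2 N by (intro mult_left_mono) auto
      also have "\<dots> = 2 powr (p + 1) / p * real N powr (\<gamma> * p)"
        by (simp add: powr_add powr_minus field_simps)
      also have "\<dots> = (?K * real N powr \<gamma>) powr p"
        using 2 by (simp add: powr_mult powr_powr)
      finally show ?thesis .
    qed
    then show ?thesis using 2
      by (intro exI[of _ ?K]) (auto simp: seq_bd_ereal \<gamma>_def)
  qed
qed

section \<open>Slowly decreasing majorants\<close>

text \<open>The smallest sequence above \<open>h\<close> that decreases at most at the rate \<open>(j + 1) powr -b\<close>. Passing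
  to it makes sums over \<open>\<rho> u v + \<rho> v w \<ge> \<rho> u w\<close> split at the midpoint.\<close>

definition slow_maj :: "real \<Rightarrow> (nat \<Rightarrow> real) \<Rightarrow> nat \<Rightarrow> real" where
  "slow_maj b h j = (MAX i\<in>{..j}. h i * (real i + 1) powr b) * (real j + 1) powr - b"

lemma slow_maj_bound:
  assumes "\<And>i. i \<le> j \<Longrightarrow> h i * (real i + 1) powr b \<le> c"
  shows "slow_maj b h j \<le> c * (real j + 1) powr - b"
  unfolding slow_maj_def using assms by (intro mult_right_mono) auto

lemma slow_maj_ge: "i \<le> j \<Longrightarrow> h i * (real i + 1) powr b * (real j + 1) powr - b \<le> slow_maj b h j"
  unfolding slow_maj_def by (intro mult_right_mono Max_ge) auto

lemma le_slow_maj: "h j \<le> slow_maj b h j"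
  using slow_maj_ge[of j j h b] by (simp add: mult.assoc flip: powr_add)

lemma slow_maj_mult: "slow_maj b h j * (real j + 1) powr b = (MAX i\<in>{..j}. h i * (real i + 1) powr b)"
  by (simp add: slow_maj_def mult.assoc flip: powr_add)

lemma slow_maj_slow:
  "i \<le> j \<Longrightarrow> slow_maj b h i * (real i + 1) powr b \<le> slow_maj b h j * (real j + 1) powr b"
  unfolding slow_maj_mult by (rule Max_mono) auto

text \<open>The running maximum grows with \<open>j\<close>, but an index \<open>l > i\<close> that
  newly enters it has \<open>h l \<le> h i\<close> and weight at most \<open>(j + 1) powr b\<close>.
  So the maximum grows no faster than the factor \<open>(j + 1) powr - b\<close> shrinks.\<close>

lemma slow_maj_antimono:
  assumes h: "antimono h" "\<And>j. 0 \<le> h j" and b: "0 \<le> b"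
  shows "antimono (slow_maj b h)"
proof (rule antimonoI)
  fix i j :: nat assume ij: "i \<le> j"
  have "h l * (real l + 1) powr b \<le> slow_maj b h i * (real j + 1) powr b" if l: "l \<le> j" for l
  proof (cases "l \<le> i")
    case True
    have "h l * (real l + 1) powr b \<le> slow_maj b h i * (real i + 1) powr b"
      unfolding slow_maj_mult by (rule Max_ge) (use True in auto)
    also have "\<dots> \<le> slow_maj b h i * (real j + 1) powr b"
      using ij b h(2) le_slow_maj[of h i b] by (intro mult_left_mono powr_mono2) (auto intro: order_trans)
    finally show ?thesis .
  next
    case False
    then have "h l \<le> slow_maj b h i"
      using antimonoD[OF h(1), of i l] le_slow_maj[of h i b] by linarith
    then show ?thesis
      using l b h(2) by (intro mult_mono powr_mono2) (auto intro: order_trans)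
  qed
  from slow_maj_bound[of j h b, OF this] have "slow_maj b h j
      \<le> slow_maj b h i * (real j + 1) powr b * (real j + 1) powr - b" by simp
  then show "slow_maj b h j \<le> slow_maj b h i" by (simp add: mult.assoc flip: powr_add)
qed

text \<open>The maximum in \<^const>\<open>slow_maj\<close> costs no factor \<open>j + 1\<close>: for decreasing \<open>h\<close> Abel summation
  bounds it by a sum with the smaller weight \<open>(l + 1) powr (b p - 1)\<close>.\<close>

lemma slow_maj_powr_le:
  assumes h: "antimono h" "\<And>j. 0 \<le> h j" and "1 \<le> p" "1 \<le> b"
  shows "slow_maj b h j powr p
      \<le> (real j + 1) powr - (b * p) * (\<Sum>l\<le>j. h l powr p * (b * p * (real l + 1) powr (b * p - 1)))"
proof -
  let ?S = "\<Sum>l\<le>j. h l powr p * (b * p * (real l + 1) powr (b * p - 1))"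
  have bp: "1 \<le> b * p" using assms mult_mono[of 1 b 1 p] by simp
  have S0: "0 \<le> ?S" using assms by (intro sum_nonneg) auto
  have "h i * (real i + 1) powr b \<le> ?S powr (1 / p)" if i: "i \<le> j" for i
  proof -
    have "(\<Sum>l\<le>i. (real l + 1) powr (b * p) - real l powr (b * p)) = (real i + 1) powr (b * p)"
      by (induction i) (use bp in \<open>simp_all add: add.commute\<close>)
    then have "h i powr p * (real i + 1) powr (b * p)
        = (\<Sum>l\<le>i. h i powr p * ((real l + 1) powr (b * p) - real l powr (b * p)))"
      by (simp flip: sum_distrib_left)
    also have "\<dots> \<le> (\<Sum>l\<le>i. h l powr p * (b * p * (real l + 1) powr (b * p - 1)))"
    proof (rule sum_mono, rule mult_mono)
      fix l assume "l \<in> {..i}"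
      then show "h i powr p \<le> h l powr p"
        using assms antimonoD[OF h(1), of l i] by (intro powr_mono2) auto
      show "(real l + 1) powr (b * p) - real l powr (b * p) \<le> b * p * (real l + 1) powr (b * p - 1)"
        by (rule powr_Suc_diff_le) (use bp in auto)
      show "0 \<le> (real l + 1) powr (b * p) - real l powr (b * p)"
        using bp powr_mono2[of "b * p" "real l" "real l + 1"] by simp
    qed auto
    also have "\<dots> \<le> ?S"
      using i assms by (intro sum_mono2) auto
    finally have *: "h i powr p * (real i + 1) powr (b * p) \<le> ?S" .
    have "(h i powr p * (real i + 1) powr (b * p)) powr (1 / p) \<le> ?S powr (1 / p)"
      by (rule powr_mono2[OF _ _ *]) (use assms in auto)
    then show ?thesis using assms by (simp add: powr_mult powr_powr)
  qed
  then have "slow_maj b h j \<le> ?S powr (1 / p) * (real j + 1) powr - b"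
    by (rule slow_maj_bound)
  then have "slow_maj b h j powr p \<le> (?S powr (1 / p) * (real j + 1) powr - b) powr p"
    using assms le_slow_maj[of h j b] by (intro powr_mono2) (auto intro: order_trans)
  also have "\<dots> = (real j + 1) powr - (b * p) * ?S"
    using assms S0 by (simp add: powr_mult powr_powr)
  finally show ?thesis .
qed

text \<open>A Hardy-type inequality. For finite exponents, \<open>slow_maj_powr_le\<close> and an
  exchange of sums give index \<open>l\<close> the tail of \<open>(j + 1) powr (- p - 1)\<close>
  over \<open>j \<ge> l\<close>, which is of order \<open>(l + 1) powr - p\<close>. The tail
  converges because the rate exceeds \<open>\<alpha> + over d r\<close> by 1, and it restores
  exactly the original weight.\<close>

lemma seq_bd_slow_maj:
  assumes r: "1 \<le> r" and "0 \<le> \<alpha>" "1 \<le> d"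
  shows "\<exists>K>0. \<forall>h H. antimono h \<longrightarrow> (\<forall>j. 0 \<le> h j) \<longrightarrow> 0 \<le> H \<longrightarrow> seq_bd r \<alpha> d h H \<longrightarrow>
    seq_bd r \<alpha> d (slow_maj (\<alpha> + over d r + 1) h) (K * H)"
  using r
proof (cases rule: exponent_cases)
  case 1
  have "slow_maj (\<alpha> + 1) h j * (real j + 1) powr \<alpha> \<le> H"
    if h: "\<forall>j. h j * (real j + 1) powr \<alpha> \<le> H" "0 \<le> H" for h H j
  proof -
    have "h i * (real i + 1) powr (\<alpha> + 1) \<le> H * (real j + 1)" if "i \<le> j" for i
    proof -
      have "h i * (real i + 1) powr \<alpha> * (real i + 1) \<le> H * (real j + 1)"
        using h that by (intro mult_mono) auto
      then show ?thesis by (simp add: powr_add mult.assoc)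
    qed
    then have "slow_maj (\<alpha> + 1) h j \<le> H * (real j + 1) * (real j + 1) powr - (\<alpha> + 1)"
      by (rule slow_maj_bound)
    then have "slow_maj (\<alpha> + 1) h j * (real j + 1) powr \<alpha>
        \<le> H * (real j + 1) * (real j + 1) powr - (\<alpha> + 1) * (real j + 1) powr \<alpha>"
      by (rule mult_right_mono) simp
    also have "\<dots> = H * ((real j + 1) powr 1 * ((real j + 1) powr - (\<alpha> + 1) * (real j + 1) powr \<alpha>))"
      by (simp add: mult.assoc)
    also have "\<dots> = H" by (simp only: powr_add[symmetric]) simp
    finally show ?thesis .
  qed
  then show ?thesis using 1 by (intro exI[of _ 1]) (auto simp: seq_bd_infty over_infinity)
next
  case (2 p)
  define b where "b = \<alpha> + over d r + 1"
  have bp: "b * p = \<alpha> * p + d + p" using 2 by (simp add: b_def over_ereal field_simps)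
  have b1: "1 \<le> b" using assms 2 by (simp add: b_def over_ereal)
  let ?c = "b * p * (2 powr (p + 1) / p)"
  have bp0: "0 < b * p" using b1 2 by simp
  have c0: "0 < ?c" using b1 2 by simp
  have "(\<Sum>j<m. slow_maj b h j powr p * (real j + 1) powr (\<alpha> * p + d - 1)) \<le> (?c powr (1 / p) * H) powr p"
    if h: "antimono h" "\<forall>j. 0 \<le> h j" and H: "0 \<le> H" and bd: "seq_bd r \<alpha> d h H" for h H m
  proof -
    have "(\<Sum>j<m. slow_maj b h j powr p * (real j + 1) powr (\<alpha> * p + d - 1))
        \<le> (\<Sum>j<m. \<Sum>l\<le>j. h l powr p * (b * p) * (real l + 1) powr (b * p - 1) * (real j + 1) powr (- p - 1))"
    proof (rule sum_mono)
      fix j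
      have "slow_maj b h j powr p * (real j + 1) powr (\<alpha> * p + d - 1)
        \<le> (real j + 1) powr - (b * p) * (\<Sum>l\<le>j. h l powr p * (b * p * (real l + 1) powr (b * p - 1)))
            * (real j + 1) powr (\<alpha> * p + d - 1)"
        by (rule mult_right_mono[OF slow_maj_powr_le]) (use h b1 2 in auto)
      also have "\<dots> = ((real j + 1) powr - (b * p) * (real j + 1) powr (\<alpha> * p + d - 1))
            * (\<Sum>l\<le>j. h l powr p * (b * p * (real l + 1) powr (b * p - 1)))"
        by (simp add: algebra_simps)
      also have "(real j + 1) powr - (b * p) * (real j + 1) powr (\<alpha> * p + d - 1)
            = (real j + 1) powr (- p - 1)"
      proof -
        have "- (b * p) + (\<alpha> * p + d - 1) = - p - 1" by (simp add: bp)
        then show ?thesis by (simp only: powr_add[symmetric])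
      qed
      finally show "slow_maj b h j powr p * (real j + 1) powr (\<alpha> * p + d - 1)
        \<le> (\<Sum>l\<le>j. h l powr p * (b * p) * (real l + 1) powr (b * p - 1) * (real j + 1) powr (- p - 1))"
        by (simp add: sum_distrib_left mult_ac)
    qed
    also have "\<dots> = (\<Sum>l<m. \<Sum>j\<in>{l..<m}. h l powr p * (b * p) * (real l + 1) powr (b * p - 1) * (real j + 1) powr (- p - 1))"
      unfolding sum.Sigma[OF finite_lessThan ballI[OF finite_atMost]]
                sum.Sigma[OF finite_lessThan ballI[OF finite_atLeastLessThan]]
      by (rule sum.reindex_bij_witness[of _ "\<lambda>(l, j). (j, l)" "\<lambda>(j, l). (l, j)"]) auto
    also have "\<dots> = (\<Sum>l<m. h l powr p * (b * p) * (real l + 1) powr (b * p - 1) * (\<Sum>j\<in>{l..<m}. (real j + 1) powr (- p - 1)))"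
      by (simp add: sum_distrib_left)
    also have "\<dots> \<le> (\<Sum>l<m. h l powr p * (b * p) * (real l + 1) powr (b * p - 1) * (2 powr (p + 1) / p * (real l + 1) powr - p))"
      using 2 bp0 by (intro sum_mono mult_left_mono sum_powr_tail_from) auto
    also have "\<dots> = ?c * (\<Sum>l<m. h l powr p * ((real l + 1) powr (b * p - 1) * (real l + 1) powr - p))"
      by (simp add: sum_distrib_left mult_ac)
    also have "\<dots> = ?c * (\<Sum>l<m. h l powr p * (real l + 1) powr (\<alpha> * p + d - 1))"
    proof -
      have "b * p - 1 + - p = \<alpha> * p + d - 1" by (simp add: bp)
      then show ?thesis by (simp only: powr_add[symmetric])
    qed
    also have "\<dots> \<le> ?c * H powr p"
      using bd 2 c0 by (intro mult_left_mono) (auto simp: seq_bd_ereal)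
    also have "\<dots> = (?c powr (1 / p) * H) powr p"
    proof -
      have "(?c powr (1 / p)) powr p = ?c"
        unfolding powr_powr using 2 c0 by simp
      then show ?thesis by (simp only: powr_mult)
    qed
    finally show ?thesis .
  qed
  then have "seq_bd r \<alpha> d (slow_maj b h) (?c powr (1 / p) * H)"
    if "antimono h" "\<forall>j. 0 \<le> h j" "0 \<le> H" "seq_bd r \<alpha> d h H" for h H
    using that 2 by (simp add: seq_bd_ereal)
  moreover have "0 < ?c powr (1 / p)" using c0 by simp
  ultimately show ?thesis unfolding b_def by blast
qed

section \<open>Jensen's inequality and the critical exponent\<close>

lemma powr_tangent:
  fixes x y p :: real
  assumes "1 \<le> p" "0 \<le> x" "0 < y"
  shows "y powr p + p * y powr (p - 1) * (x - y) \<le> x powr p"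
proof (cases "x = 0")
  case True
  have "y powr (p - 1) * y = y powr p"
    using assms by (simp add: powr_diff)
  then show ?thesis using True assms by (simp add: mult.assoc)
next
  case False
  have "(x powr p) powr (1 / p) * (y powr p) powr (1 - 1 / p)
      \<le> 1 / p * x powr p + (1 - 1 / p) * y powr p"
    by (rule Youngs_inequality_0) (use assms False in auto)
  then have "x * y powr (p - 1) \<le> 1 / p * x powr p + (1 - 1 / p) * y powr p"
    using assms by (simp add: powr_powr algebra_simps)
  then have "p * (x * y powr (p - 1)) \<le> p * (1 / p * x powr p + (1 - 1 / p) * y powr p)"
    by (rule mult_left_mono) (use assms in auto)
  also have "\<dots> = x powr p + (p - 1) * y powr p"
    using assms by (simp add: field_simps)
  finally have "p * x * y powr (p - 1) \<le> x powr p + (p - 1) * y powr p" by simp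
  moreover have "y powr (p - 1) * y = y powr p"
    using assms by (simp add: powr_diff)
  ultimately show ?thesis by (simp add: algebra_simps)
qed

text \<open>Jensen's inequality with unnormalised weights: sum the tangent bound at the mean
  \<open>y = X / W\<close>, where the linear terms cancel, and clear the denominators.\<close>

lemma powr_weighted_mean_le:
  fixes w x :: "'i \<Rightarrow> real"
  assumes "finite I" and w: "\<And>i. i \<in> I \<Longrightarrow> 0 < w i" and x: "\<And>i. i \<in> I \<Longrightarrow> 0 \<le> x i" and p: "1 \<le> p"
  shows "(\<Sum>i\<in>I. w i * x i) powr p \<le> (\<Sum>i\<in>I. w i) powr (p - 1) * (\<Sum>i\<in>I. w i * x i powr p)"
proof (cases "(\<Sum>i\<in>I. w i * x i) = 0")
  case True
  have "0 \<le> (\<Sum>i\<in>I. w i * x i powr p)"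
    using w by (intro sum_nonneg mult_nonneg_nonneg) (auto intro: less_imp_le)
  then have "0 \<le> (\<Sum>i\<in>I. w i) powr (p - 1) * (\<Sum>i\<in>I. w i * x i powr p)"
    by (intro mult_nonneg_nonneg) auto
  then show ?thesis unfolding True by simp
next
  case False
  define W where "W = (\<Sum>i\<in>I. w i)"
  define X where "X = (\<Sum>i\<in>I. w i * x i)"
  have "I \<noteq> {}" using False by auto
  then have W: "0 < W" unfolding W_def using assms by (intro sum_pos) auto
  have "0 \<le> X" unfolding X_def using w x by (intro sum_nonneg mult_nonneg_nonneg) (auto intro: less_imp_le)
  then have X: "0 < X" using False by (simp add: X_def)
  define y where "y = X / W"
  have y: "0 < y" using W X by (simp add: y_def)
  have "W * y powr p = (\<Sum>i\<in>I. w i * (y powr p + p * y powr (p - 1) * (x i - y)))"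
  proof -
    have "(\<Sum>i\<in>I. w i * (a + c * (x i - y))) = W * a + c * (X - W * y)" for a c
    proof -
      have "(\<Sum>i\<in>I. w i * (a + c * (x i - y))) = (\<Sum>i\<in>I. w i * a + (c * (w i * x i) - c * y * w i))"
        by (rule sum.cong) (auto simp: algebra_simps)
      also have "\<dots> = W * a + (c * X - c * y * W)"
        unfolding W_def X_def by (simp only: sum.distrib sum_subtractf sum_distrib_left sum_distrib_right)
      finally show ?thesis by (simp add: algebra_simps)
    qed
    moreover have "W * y = X" using W by (simp add: y_def)
    ultimately show ?thesis by simp
  qed
  also have "\<dots> \<le> (\<Sum>i\<in>I. w i * x i powr p)"
    using w x y p by (intro sum_mono mult_left_mono powr_tangent) (simp_all add: less_imp_le)
  finally have "W * y powr p \<le> (\<Sum>i\<in>I. w i * x i powr p)" .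
  then have "W powr (p - 1) * (W * y powr p) \<le> W powr (p - 1) * (\<Sum>i\<in>I. w i * x i powr p)"
    by (rule mult_left_mono) simp
  moreover have "W powr (p - 1) * (W * y powr p) = X powr p"
  proof -
    have "W powr (p - 1) * W = W powr p" using W by (simp add: powr_diff)
    then have "W powr (p - 1) * (W * y powr p) = (W * y) powr p"
      by (simp only: powr_mult mult.assoc[symmetric])
    moreover have "W * y = X" using W by (simp add: y_def)
    ultimately show ?thesis by (simp only:)
  qed
  ultimately show ?thesis by (simp only: W_def X_def)
qed

text \<open>The critical case \<open>\<alpha> = d / r' + 1\<close>, where the logarithm comes from.\<close>

lemma seq_bd_critical:
  assumes r: "1 \<le> r" and crit: "\<alpha> = over d (conj_exponent r) + 1"
    and h: "\<And>j. 0 \<le> h j" and H: "0 \<le> H" and bd: "seq_bd r \<alpha> d h H"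
  shows "(\<Sum>j\<le>N. h j * (real j + 1) powr d)
    \<le> H * (\<Sum>j\<le>N. 1 / (real j + 1)) powr over 1 (conj_exponent r)"
  using r
proof (cases rule: exponent_cases)
  case 1
  have al: "\<alpha> = d + 1" "over 1 (conj_exponent r) = 1"
    using crit 1 by (simp_all add: conj_exponent_def over_def one_ereal_def)
  have "h j * (real j + 1) powr d \<le> H * (1 / (real j + 1))" for j
  proof -
    have "h j * (real j + 1) powr (d + 1) \<le> H" using bd 1 al by (simp add: seq_bd_infty)
    then show ?thesis by (simp add: powr_add field_simps)
  qed
  then have "(\<Sum>j\<le>N. h j * (real j + 1) powr d) \<le> (\<Sum>j\<le>N. H * (1 / (real j + 1)))"
    by (intro sum_mono)
  moreover have "0 \<le> (\<Sum>j\<le>N. 1 / (real j + 1))" by (intro sum_nonneg) auto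
  ultimately show ?thesis using al by (simp add: sum_distrib_left)
next
  case (2 p)
  have ov: "over t (conj_exponent r) = t * (1 - 1 / p)" for t
  proof (cases "p = 1")
    case True
    then show ?thesis using 2 by (simp add: conj_exponent_one over_infinity flip: one_ereal_def)
  next
    case False
    then show ?thesis using 2 by (simp add: conj_exponent_ereal over_ereal field_simps)
  qed
  define S where "S = (\<Sum>j\<le>N. 1 / (real j + 1))"
  define T where "T = (\<Sum>j\<le>N. h j * (real j + 1) powr d)"
  have T0: "0 \<le> T" unfolding T_def using h by (intro sum_nonneg) auto
  have T: "T = (\<Sum>j\<le>N. 1 / (real j + 1) * (h j * (real j + 1) powr (d + 1)))"
    unfolding T_def
  proof (rule sum.cong[OF refl])
    fix j
    have "x powr d = 1 / x * (x powr d * x)" if "0 < x" for x :: real using that by simp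
    from this[of "real j + 1"]
    show "h j * (real j + 1) powr d = 1 / (real j + 1) * (h j * (real j + 1) powr (d + 1))"
      unfolding powr_add by simp
  qed
  have eq: "(\<Sum>j\<le>N. 1 / (real j + 1) * (h j * (real j + 1) powr (d + 1)) powr p)
      = (\<Sum>j\<le>N. h j powr p * (real j + 1) powr (\<alpha> * p + d - 1))"
  proof (rule sum.cong[OF refl])
    fix j
    \<comment> \<open>Here criticality enters: \<open>\<alpha> = d * (1 - 1 / p) + 1\<close> makes
      the weight of the norm equal to the harmonic weight \<open>1 / (real j + 1)\<close> times the
      p-th power of \<open>(real j + 1) powr (d + 1)\<close>, so that Jensen's inequality splits off
      a harmonic sum.\<close>
    have e: "\<alpha> * p + d - 1 = (d + 1) * p - 1"
      using 2 unfolding crit ov by (simp add: field_simps)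
    show "1 / (real j + 1) * (h j * (real j + 1) powr (d + 1)) powr p
       = h j powr p * (real j + 1) powr (\<alpha> * p + d - 1)"
      unfolding e powr_mult powr_powr powr_diff by simp
  qed
  have "T powr p \<le> S powr (p - 1) *
      (\<Sum>j\<le>N. 1 / (real j + 1) * (h j * (real j + 1) powr (d + 1)) powr p)"
    unfolding T S_def by (rule powr_weighted_mean_le) (use h 2 in auto)
  also have "\<dots> \<le> S powr (p - 1) * H powr p"
    unfolding eq using bd 2 by (intro mult_left_mono)
      (auto simp: seq_bd_ereal lessThan_Suc_atMost[symmetric] simp del: sum.lessThan_Suc)
  finally have "(T powr p) powr (1 / p) \<le> (S powr (p - 1) * H powr p) powr (1 / p)"
    using 2 by (intro powr_mono2) auto
  then have "T \<le> S powr ((p - 1) / p) * H"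
    using 2 H T0 by (simp add: powr_mult powr_powr)
  moreover have "(p - 1) / p = over 1 (conj_exponent r)"
    unfolding ov using 2 by (simp add: field_simps)
  ultimately show ?thesis by (simp only: T_def S_def mult.commute)
qed

section \<open>The norms through sequences\<close>

lemma ennreal_rpow_ennreal: "0 \<le> x \<Longrightarrow> ennreal_rpow (ennreal x) p = ennreal (x powr p)"
  by (simp add: ennreal_rpow_def)

lemma ennreal_rpow_mono:
  assumes "x \<le> ennreal y" "0 \<le> y" "0 \<le> p"
  shows "ennreal_rpow x p \<le> ennreal (y powr p)"
proof -
  have "x < top" using assms(1) by (auto intro: le_less_trans)
  then obtain z where z: "x = ennreal z" "0 \<le> z" by (cases x) auto
  then show ?thesis using assms by (auto simp: ennreal_rpow_ennreal intro!: ennreal_leI powr_mono2)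
qed

text \<open>All weights are positive, so a single infinite supremum would make the whole norm
  infinite. Membership in the algebra therefore permits the passage from \<open>ennreal\<close> to
  the real sequence \<open>h\<close>.\<close>

lemma B_norm_seq:
  assumes r: "1 \<le> r" and A: "A \<in> B_alg V E r \<alpha>"
  defines "h \<equiv> \<lambda>j. enn2real (offdiag_sup V E A j)"
  shows "antimono h" "\<And>j. 0 \<le> h j" "\<And>u v. u \<in> V \<Longrightarrow> v \<in> V \<Longrightarrow> cmod (A u v) \<le> h (gdist E u v)"
    and "seq_bd r \<alpha> (beurling_dim V E) h (B_norm V E r \<alpha> A)" "0 \<le> B_norm V E r \<alpha> A"
proof -
  define d where "d = beurling_dim V E"
  have fin: "B_ennorm V E r \<alpha> A < top" using A by (simp add: B_alg_def)
  have *: "(\<forall>j. offdiag_sup V E A j < top) \<and> seq_bd r \<alpha> d h (B_norm V E r \<alpha> A)"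
    using r
  proof (cases rule: exponent_cases)
    case 1
    have B: "B_ennorm V E r \<alpha> A = (SUP n. offdiag_sup V E A n * ennreal ((real n + 1) powr \<alpha>))"
      using 1 by (simp add: B_ennorm_def)
    have le: "offdiag_sup V E A j * ennreal ((real j + 1) powr \<alpha>) \<le> B_ennorm V E r \<alpha> A" for j
      unfolding B by (rule SUP_upper) simp
    have off: "offdiag_sup V E A j < top" for j
    proof (rule ccontr)
      assume "\<not> ?thesis"
      then have "offdiag_sup V E A j = top" by (simp add: less_top[symmetric])
      then show False using le[of j] fin by (simp add: ennreal_top_mult)
    qed
    moreover have "h j * (real j + 1) powr \<alpha> \<le> B_norm V E r \<alpha> A" for j
      using enn2real_mono[OF le[of j] fin] by (simp add: h_def B_norm_def enn2real_mult)
    ultimately show ?thesis using 1 by (simp add: seq_bd_infty)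
  next
    case (2 p)
    define t where "t = (\<lambda>n. ennreal_rpow (offdiag_sup V E A n) p * ennreal ((real n + 1) powr (\<alpha> * p + d - 1)))"
    have B: "B_ennorm V E r \<alpha> A = ennreal_rpow (\<Sum>n. t n) (1 / p)"
      using 2 by (simp add: B_ennorm_def t_def d_def)
    have X: "(\<Sum>n. t n) < top" using fin unfolding B by (auto simp: ennreal_rpow_def less_top split: if_splits)
    then obtain x where x: "(\<Sum>n. t n) = ennreal x" "0 \<le> x" by (cases "\<Sum>n. t n") auto
    have partial: "(\<Sum>n<m. t n) \<le> ennreal x" for m
      unfolding x(1)[symmetric] by (rule sum_le_suminf) auto
    have off: "offdiag_sup V E A j < top" for j
    proof (rule ccontr)
      assume "\<not> ?thesis"
      then have "offdiag_sup V E A j = top" by (simp add: less_top[symmetric])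
      then have "t j = top" by (simp add: t_def ennreal_rpow_def ennreal_top_mult)
      moreover have "t j \<le> (\<Sum>n<Suc j. t n)" by simp
      ultimately show False using partial[of "Suc j"] by (simp add: top_unique)
    qed
    have t: "t j = ennreal (h j powr p * (real j + 1) powr (\<alpha> * p + d - 1))" for j
      using off[of j] by (simp add: t_def h_def ennreal_rpow_def ennreal_mult)
    have "B_norm V E r \<alpha> A = x powr (1 / p)"
      using x by (simp add: B_norm_def B ennreal_rpow_ennreal)
    then have Bp: "B_norm V E r \<alpha> A powr p = x" using 2 x by (simp add: powr_powr)
    have "(\<Sum>j<m. h j powr p * (real j + 1) powr (\<alpha> * p + d - 1)) \<le> x" for m
      using partial[of m] x(2) unfolding t by (simp add: sum_ennreal)
    then show ?thesis using 2 off Bp by (simp add: seq_bd_ereal)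
  qed
  have anti: "offdiag_sup V E A j \<le> offdiag_sup V E A i" if "i \<le> j" for i j
    unfolding offdiag_sup_def by (rule SUP_subset_mono) (use that in auto)
  show "antimono h"
    unfolding h_def using * anti by (intro antimonoI enn2real_mono) auto
  show "0 \<le> h j" for j by (simp add: h_def)
  show "cmod (A u v) \<le> h (gdist E u v)" if "u \<in> V" "v \<in> V" for u v
  proof -
    have "ennreal (cmod (A u v)) \<le> offdiag_sup V E A (gdist E u v)"
      unfolding offdiag_sup_def by (rule SUP_upper2[of "(u, v)"]) (use that in auto)
    from enn2real_mono[OF this] show ?thesis using * by (simp add: h_def)
  qed
  show "seq_bd r \<alpha> (beurling_dim V E) h (B_norm V E r \<alpha> A)" using * by (simp add: d_def)
  show "0 \<le> B_norm V E r \<alpha> A" by (simp add: B_norm_def)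
qed

text \<open>The converse passage: a decreasing radial majorant of the entries also dominates their
  suprema over all pairs at distance at least \<open>j\<close>.\<close>

lemma B_norm_le:
  assumes r: "1 \<le> r" and le: "\<And>u v. u \<in> V \<Longrightarrow> v \<in> V \<Longrightarrow> cmod (A u v) \<le> g (gdist E u v)"
    and g: "antimono g" "\<And>j. 0 \<le> g j" and G: "0 \<le> G" and bd: "seq_bd r \<alpha> (beurling_dim V E) g G"
  shows "A \<in> B_alg V E r \<alpha>" "B_norm V E r \<alpha> A \<le> G"
proof -
  have off: "offdiag_sup V E A j \<le> ennreal (g j)" for j
    unfolding offdiag_sup_def
  proof (rule SUP_least, clarify)
    fix u v assume "u \<in> V" "v \<in> V" "j \<le> gdist E u v"
    then show "ennreal (cmod (A u v)) \<le> ennreal (g j)"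
      using le[of u v] antimonoD[OF g(1), of j "gdist E u v"] by (intro ennreal_leI) auto
  qed
  have *: "B_ennorm V E r \<alpha> A \<le> ennreal G"
    using r
  proof (cases rule: exponent_cases)
    case 1
    have "offdiag_sup V E A n * ennreal ((real n + 1) powr \<alpha>) \<le> ennreal G" for n
    proof -
      have "offdiag_sup V E A n * ennreal ((real n + 1) powr \<alpha>)
          \<le> ennreal (g n) * ennreal ((real n + 1) powr \<alpha>)"
        by (intro mult_right_mono off) auto
      also have "\<dots> = ennreal (g n * (real n + 1) powr \<alpha>)" using g by (simp add: ennreal_mult)
      also have "\<dots> \<le> ennreal G" using bd 1 by (intro ennreal_leI) (simp add: seq_bd_infty)
      finally show ?thesis .
    qed
    then show ?thesis using 1 by (auto simp: B_ennorm_def intro!: SUP_least)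
  next
    case (2 p)
    define d where "d = beurling_dim V E"
    define t where "t = (\<lambda>n. ennreal_rpow (offdiag_sup V E A n) p * ennreal ((real n + 1) powr (\<alpha> * p + d - 1)))"
    have B: "B_ennorm V E r \<alpha> A = ennreal_rpow (\<Sum>n. t n) (1 / p)"
      using 2 by (simp add: B_ennorm_def t_def d_def)
    have t: "t n \<le> ennreal (g n powr p * (real n + 1) powr (\<alpha> * p + d - 1))" for n
    proof -
      have "t n \<le> ennreal (g n powr p) * ennreal ((real n + 1) powr (\<alpha> * p + d - 1))"
        unfolding t_def by (intro mult_right_mono ennreal_rpow_mono off) (use g 2 in auto)
      then show ?thesis by (simp add: ennreal_mult)
    qed
    have "(\<Sum>n. t n) \<le> ennreal (G powr p)"
      unfolding suminf_eq_SUP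
    proof (rule SUP_least)
      fix m
      have "(\<Sum>n<m. t n) \<le> (\<Sum>n<m. ennreal (g n powr p * (real n + 1) powr (\<alpha> * p + d - 1)))"
        by (intro sum_mono t)
      also have "\<dots> = ennreal (\<Sum>n<m. g n powr p * (real n + 1) powr (\<alpha> * p + d - 1))"
        by (intro sum_ennreal) auto
      also have "\<dots> \<le> ennreal (G powr p)"
        using bd 2 by (intro ennreal_leI) (simp add: seq_bd_ereal d_def)
      finally show "(\<Sum>n<m. t n) \<le> ennreal (G powr p)" .
    qed
    then have "B_ennorm V E r \<alpha> A \<le> ennreal ((G powr p) powr (1 / p))"
      unfolding B by (intro ennreal_rpow_mono) (use 2 in auto)
    then show ?thesis using G 2 by (simp add: powr_powr)
  qed
  then show "A \<in> B_alg V E r \<alpha>" by (auto simp: B_alg_def intro: le_less_trans)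
  show "B_norm V E r \<alpha> A \<le> G"
    using enn2real_mono[OF *] G by (simp add: B_norm_def)
qed

section \<open>Sums over a space of normal growth\<close>

text \<open>The infinite case: the lower bound is demanded at every radius, which a finite graph
  violates as soon as the radius is large. \<open>1 \<le> d\<close> is proved for infinite graphs in
  \<open>infinite_normal_growth\<close>.\<close>

locale normal_growth =
  fixes V :: "'v set" and \<rho> :: "'v \<Rightarrow> 'v \<Rightarrow> nat" and d D1 D2 :: real
  assumes dist_self: "u \<in> V \<Longrightarrow> \<rho> u u = 0"
    and dist_sym: "u \<in> V \<Longrightarrow> v \<in> V \<Longrightarrow> \<rho> u v = \<rho> v u"
    and dist_tri: "u \<in> V \<Longrightarrow> v \<in> V \<Longrightarrow> w \<in> V \<Longrightarrow> \<rho> u w \<le> \<rho> u v + \<rho> v w"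
    and d1: "1 \<le> d" and D1: "0 < D1" and D2: "0 < D2"
    and fin_ball: "u \<in> V \<Longrightarrow> finite {v \<in> V. \<rho> u v \<le> R}"
    and card_ball_le: "u \<in> V \<Longrightarrow> real (card {v \<in> V. \<rho> u v \<le> R}) \<le> D1 * (real R + 1) powr d"
    and card_ball_ge: "u \<in> V \<Longrightarrow> D2 * (real R + 1) powr d \<le> real (card {v \<in> V. \<rho> u v \<le> R})"
begin

definition B :: "'v \<Rightarrow> nat \<Rightarrow> 'v set" where
  "B u R = {v \<in> V. \<rho> u v \<le> R}"

lemma finite_B [simp]: "u \<in> V \<Longrightarrow> finite (B u R)"
  by (simp add: B_def fin_ball)

lemma B_subset: "B u R \<subseteq> V"
  by (auto simp: B_def)

lemma card_B_le: "u \<in> V \<Longrightarrow> real (card (B u R)) \<le> D1 * (real R + 1) powr d"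
  by (simp add: B_def card_ball_le)

lemma card_B_ge: "u \<in> V \<Longrightarrow> D2 * (real R + 1) powr d \<le> real (card (B u R))"
  by (simp add: B_def card_ball_ge)

lemma finite_subset_B:
  assumes "finite F" "F \<subseteq> V"
  obtains m where "F \<subseteq> B u m"
proof
  show "F \<subseteq> B u (Max (\<rho> u ` F))" using assms by (auto simp: B_def)
qed

text \<open>Abel summation in the radius; the induction carries the boundary term, in which the ball is
  compared with its largest possible size.\<close>

lemma sum_ball_le:
  assumes u: "u \<in> V" and h: "antimono h" "\<And>j. 0 \<le> h j" and p: "0 \<le> p"
  shows "(\<Sum>v\<in>B u m. h (\<rho> u v) * (real (\<rho> u v) + 1) powr p)
    \<le> D1 * (d + p) * (\<Sum>j\<le>m. h j * (real j + 1) powr (d + p - 1))"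
proof -
  define q where "q = d + p"
  have q: "1 \<le> q" using d1 p by (simp add: q_def)
  define c where "c = (\<lambda>m. real (card (B u m)))"
  define X where "X = (\<lambda>m. (real m + 1) powr p * c m - D1 * (real m + 1) powr q)"
  have X: "X m \<le> 0" for m
  proof -
    have "(real m + 1) powr p * c m \<le> (real m + 1) powr p * (D1 * (real m + 1) powr d)"
      unfolding c_def by (intro mult_left_mono card_B_le u) auto
    then show ?thesis by (simp add: X_def q_def powr_add mult_ac)
  qed
  have "(\<Sum>v\<in>B u m. h (\<rho> u v) * (real (\<rho> u v) + 1) powr p)
     \<le> D1 * (\<Sum>j\<le>m. h j * ((real j + 1) powr q - real j powr q)) + h m * X m" for m
  proof (induction m)
    case 0
    have "(\<Sum>v\<in>B u 0. h (\<rho> u v) * (real (\<rho> u v) + 1) powr p) = (\<Sum>v\<in>B u 0. h 0)"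
      by (rule sum.cong) (auto simp: B_def)
    then show ?case by (simp add: X_def c_def algebra_simps)
  next
    case (Suc m)
    let ?f = "\<lambda>v. h (\<rho> u v) * (real (\<rho> u v) + 1) powr p"
    have sub: "B u m \<subseteq> B u (Suc m)" by (auto simp: B_def)
    have "(\<Sum>v\<in>B u (Suc m). ?f v) = (\<Sum>v\<in>B u (Suc m) - B u m. ?f v) + (\<Sum>v\<in>B u m. ?f v)"
      by (rule sum.subset_diff) (use sub u in auto)
    also have "(\<Sum>v\<in>B u (Suc m) - B u m. ?f v) = (\<Sum>v\<in>B u (Suc m) - B u m. h (Suc m) * (real m + 2) powr p)"
    proof (rule sum.cong[OF refl])
      fix v assume "v \<in> B u (Suc m) - B u m"
      then have "\<rho> u v = Suc m" by (auto simp: B_def)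
      then show "?f v = h (Suc m) * (real m + 2) powr p" by (simp add: add.commute)
    qed
    also have "\<dots> = h (Suc m) * (real m + 2) powr p * (c (Suc m) - c m)"
      using sub u by (simp add: c_def card_Diff_subset of_nat_diff card_mono)
    finally have eq: "(\<Sum>v\<in>B u (Suc m). ?f v)
      = h (Suc m) * (real m + 2) powr p * (c (Suc m) - c m) + (\<Sum>v\<in>B u m. ?f v)" .
    \<comment> \<open>\<open>X m\<close> is at most 0, being the deficit of the actual ball against
      its maximal size. Lowering its coefficient from \<open>h m\<close> to \<open>h (Suc m)\<close>
      can therefore only raise the product.\<close>
    have "h m * X m \<le> h (Suc m) * X m"
      using antimonoD[OF h(1), of m "Suc m"] X[of m] by (simp add: mult_right_mono_neg)
    also have "\<dots> \<le> h (Suc m) * ((real m + 2) powr p * c m - D1 * (real m + 1) powr q)"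
    proof (rule mult_left_mono[OF _ h(2)])
      have "(real m + 1) powr p * c m \<le> (real m + 2) powr p * c m"
        using p by (intro mult_right_mono powr_mono2) (auto simp: c_def)
      then show "X m \<le> (real m + 2) powr p * c m - D1 * (real m + 1) powr q"
        by (simp add: X_def)
    qed
    finally have step: "h m * X m \<le> h (Suc m) * ((real m + 2) powr p * c m - D1 * (real m + 1) powr q)" .
    have "(\<Sum>v\<in>B u (Suc m). ?f v) \<le> h (Suc m) * (real m + 2) powr p * (c (Suc m) - c m)
       + (D1 * (\<Sum>j\<le>m. h j * ((real j + 1) powr q - real j powr q)) + h m * X m)"
      unfolding eq using Suc by simp
    also have "\<dots> \<le> h (Suc m) * (real m + 2) powr p * (c (Suc m) - c m)
       + (D1 * (\<Sum>j\<le>m. h j * ((real j + 1) powr q - real j powr q))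
         + h (Suc m) * ((real m + 2) powr p * c m - D1 * (real m + 1) powr q))"
      using step by simp
    also have "\<dots> = D1 * (\<Sum>j\<le>Suc m. h j * ((real j + 1) powr q - real j powr q)) + h (Suc m) * X (Suc m)"
      by (simp add: X_def algebra_simps)
    finally show ?case .
  qed
  also have "D1 * (\<Sum>j\<le>m. h j * ((real j + 1) powr q - real j powr q)) + h m * X m
     \<le> D1 * (\<Sum>j\<le>m. h j * (q * (real j + 1) powr (q - 1)))"
  proof -
    have "h m * X m \<le> 0" using X[of m] h(2)[of m] by (simp add: mult_nonneg_nonpos)
    moreover have "D1 * (\<Sum>j\<le>m. h j * ((real j + 1) powr q - real j powr q))
     \<le> D1 * (\<Sum>j\<le>m. h j * (q * (real j + 1) powr (q - 1)))"
      using D1 by (intro mult_left_mono sum_mono powr_Suc_diff_le h q) auto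
    ultimately show ?thesis by linarith
  qed
  also have "\<dots> = D1 * (d + p) * (\<Sum>j\<le>m. h j * (real j + 1) powr (d + p - 1))"
    by (simp add: q_def sum_distrib_left mult_ac)
  finally show ?thesis .
qed

definition decay_const :: "real \<Rightarrow> real" where
  "decay_const g = D1 * d * (2 powr (g - d + 1) / (g - d))"

lemma decay_const_pos: "d < g \<Longrightarrow> 0 < decay_const g"
  using D1 d1 by (simp add: decay_const_def)

text \<open>In the radial sum the weight \<open>(j + 1) powr (d - 1)\<close> is at most
  \<open>(N + j) powr (d - 1)\<close>, which leaves the summable exponent
  \<open>- (g - d) - 1\<close>. \<open>decay_const\<close> collects the constants of
  \<open>sum_ball_le\<close> and \<open>sum_powr_tail\<close>.\<close>

lemma sum_decay:
  assumes u: "u \<in> V" and F: "finite F" "F \<subseteq> V" and N: "1 \<le> N" and g: "d < g"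
  shows "(\<Sum>v\<in>F. (real N + real (\<rho> u v)) powr - g) \<le> decay_const g * real N powr (d - g)"
proof -
  define h where "h = (\<lambda>j. (real N + real j) powr - g)"
  have h: "antimono h" "0 \<le> h j" for j
    unfolding h_def using N g d1 by (auto intro!: antimonoI powr_mono2')
  obtain m where m: "F \<subseteq> B u m" using finite_subset_B[OF F] by blast
  have "(\<Sum>v\<in>F. h (\<rho> u v)) \<le> (\<Sum>v\<in>B u m. h (\<rho> u v))"
    by (rule sum_mono2) (use m u h in auto)
  also have "\<dots> \<le> D1 * d * (\<Sum>j\<le>m. h j * (real j + 1) powr (d - 1))"
    using sum_ball_le[OF u h, of 0 m] by simp
  also have "\<dots> \<le> D1 * d * (\<Sum>j\<le>m. (real N + real j) powr (- (g - d) - 1))"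
  proof (intro mult_left_mono sum_mono)
    fix j
    have "h j * (real j + 1) powr (d - 1) \<le> h j * (real N + real j) powr (d - 1)"
      using N d1 h by (intro mult_left_mono powr_mono2) auto
    also have "\<dots> = (real N + real j) powr (- (g - d) - 1)"
    proof -
      have "- g + (d - 1) = - (g - d) - 1" by simp
      then show ?thesis by (simp only: h_def powr_add[symmetric])
    qed
    finally show "h j * (real j + 1) powr (d - 1) \<le> (real N + real j) powr (- (g - d) - 1)" .
  qed (use D1 d1 in auto)
  also have "\<dots> \<le> D1 * d * (2 powr (g - d + 1) / (g - d) * real N powr - (g - d))"
    unfolding lessThan_Suc_atMost[symmetric]
    by (intro mult_left_mono sum_powr_tail) (use D1 d1 g N in auto)
  finally show ?thesis by (simp add: h_def decay_const_def mult_ac)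
qed

text \<open>Every vertex lies in at least \<open>D2 (N + 1) powr d\<close> of the balls of radius \<open>N\<close>.\<close>

lemma sum_le_ball_average:
  assumes F: "finite F" "F \<subseteq> V" and F': "finite F'" "F' \<subseteq> V" "\<And>x. x \<in> F \<Longrightarrow> B x N \<subseteq> F'"
    and g: "\<And>x. x \<in> F \<Longrightarrow> 0 \<le> g x"
  shows "D2 * (real N + 1) powr d * (\<Sum>x\<in>F. g x) \<le> (\<Sum>v\<in>F'. \<Sum>x\<in>F \<inter> B v N. g x)"
proof -
  have "D2 * (real N + 1) powr d * (\<Sum>x\<in>F. g x) \<le> (\<Sum>x\<in>F. real (card (B x N)) * g x)"
    unfolding sum_distrib_left using F g by (intro sum_mono mult_right_mono card_B_ge) auto
  also have "\<dots> = (\<Sum>x\<in>F. \<Sum>v\<in>B x N. g x)"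
    by simp
  also have "\<dots> = (\<Sum>x\<in>F. \<Sum>v\<in>{v \<in> F'. x \<in> B v N}. g x)"
  proof (rule sum.cong[OF refl])
    fix x assume x: "x \<in> F"
    have "B x N = {v \<in> F'. x \<in> B v N}"
      using F'(3)[OF x] F'(2) F(2) x dist_sym by (auto simp: B_def)
    then show "(\<Sum>v\<in>B x N. g x) = (\<Sum>v\<in>{v \<in> F'. x \<in> B v N}. g x)" by simp
  qed
  also have "\<dots> = (\<Sum>v\<in>F'. \<Sum>x\<in>{x \<in> F. x \<in> B v N}. g x)"
    by (rule sum.swap_restrict) (use F F' in auto)
  also have "\<dots> = (\<Sum>v\<in>F'. \<Sum>x\<in>F \<inter> B v N. g x)"
    by (simp add: Int_def)
  finally show ?thesis .
qed

end

section \<open>Matrices on finite sets\<close>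

lemma L2_set_power2: "finite S \<Longrightarrow> (L2_set f S)\<^sup>2 = (\<Sum>x\<in>S. (f x)\<^sup>2)"
  by (simp add: L2_set_def sum_nonneg)

lemma L2_set_le_iff: "0 \<le> c \<Longrightarrow> L2_set f S \<le> c \<longleftrightarrow> (\<Sum>x\<in>S. (f x)\<^sup>2) \<le> c\<^sup>2"
  using real_sqrt_le_iff[of "\<Sum>x\<in>S. (f x)\<^sup>2" "c\<^sup>2"] by (simp add: L2_set_def)

text \<open>Cauchy-Schwarz with each \<open>k x y\<close> split into two square roots: the row sums
  give one factor \<open>c\<close>, and after an exchange of sums the column sums give the
  other.\<close>

lemma schur_test:
  fixes k :: "'a \<Rightarrow> 'b \<Rightarrow> real" and g :: "'b \<Rightarrow> real"
  assumes "finite S" "finite T" and k: "\<And>x y. x \<in> S \<Longrightarrow> y \<in> T \<Longrightarrow> 0 \<le> k x y"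
    and rows: "\<And>x. x \<in> S \<Longrightarrow> (\<Sum>y\<in>T. k x y) \<le> c" and cols: "\<And>y. y \<in> T \<Longrightarrow> (\<Sum>x\<in>S. k x y) \<le> c"
    and c: "0 \<le> c"
  shows "L2_set (\<lambda>x. \<Sum>y\<in>T. k x y * g y) S \<le> c * L2_set g T"
proof -
  have "(\<Sum>x\<in>S. (\<Sum>y\<in>T. k x y * g y)\<^sup>2) \<le> (\<Sum>x\<in>S. c * (\<Sum>y\<in>T. k x y * (g y)\<^sup>2))"
  proof (rule sum_mono)
    fix x assume x: "x \<in> S"
    have "(\<Sum>y\<in>T. k x y * g y)\<^sup>2 = (\<Sum>y\<in>T. sqrt (k x y) * (sqrt (k x y) * g y))\<^sup>2"
      using k x by (simp flip: mult.assoc)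
    also have "\<dots> \<le> (\<Sum>y\<in>T. (sqrt (k x y))\<^sup>2) * (\<Sum>y\<in>T. (sqrt (k x y) * g y)\<^sup>2)"
      by (rule Cauchy_Schwarz_ineq_sum)
    also have "\<dots> = (\<Sum>y\<in>T. k x y) * (\<Sum>y\<in>T. k x y * (g y)\<^sup>2)"
      using k x by (simp add: power_mult_distrib)
    also have "\<dots> \<le> c * (\<Sum>y\<in>T. k x y * (g y)\<^sup>2)"
      using k x by (intro mult_right_mono rows sum_nonneg) auto
    finally show "(\<Sum>y\<in>T. k x y * g y)\<^sup>2 \<le> c * (\<Sum>y\<in>T. k x y * (g y)\<^sup>2)" .
  qed
  also have "\<dots> = c * (\<Sum>y\<in>T. (\<Sum>x\<in>S. k x y) * (g y)\<^sup>2)"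
    unfolding sum_distrib_left[symmetric] sum_distrib_right by (subst sum.swap) (rule refl)
  also have "\<dots> \<le> c * (\<Sum>y\<in>T. c * (g y)\<^sup>2)"
    by (intro mult_left_mono sum_mono mult_right_mono cols c) auto
  also have "\<dots> = (c * L2_set g T)\<^sup>2"
    unfolding power_mult_distrib L2_set_power2[OF assms(2)]
    by (simp add: sum_distrib_left power2_eq_square mult.assoc)
  finally show ?thesis using c by (simp add: L2_set_le_iff)
qed

lemma abs_summable_bound:
  fixes g :: "'a \<Rightarrow> complex"
  assumes "\<And>F. finite F \<Longrightarrow> F \<subseteq> S \<Longrightarrow> (\<Sum>x\<in>F. cmod (g x)) \<le> c"
  shows "g summable_on S" "cmod (infsum g S) \<le> c"
proof -
  have sum: "(\<lambda>x. cmod (g x)) summable_on S"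
    by (rule nonneg_bdd_above_summable_on) (auto simp: bdd_above_def intro!: exI[of _ c] assms)
  then show "g summable_on S" by (rule abs_summable_summable)
  have "cmod (infsum g S) \<le> (\<Sum>\<^sub>\<infinity>x\<in>S. cmod (g x))"
    by (rule norm_infsum_bound[OF sum])
  also have "\<dots> \<le> c"
    by (rule infsum_le_finite_sums[OF sum]) (use assms in auto)
  finally show "cmod (infsum g S) \<le> c" .
qed

section \<open>Localised norms\<close>

text \<open>In the application \<open>f\<close> is the slow majorant of the off-diagonal suprema and
  \<open>\<eta>\<close> is \<open>\<nu> / n\<close>. Flattening at \<open>N\<close> lets
  \<open>f_sum\<close> cover both the tail of \<open>f\<close> and the plateau \<open>f N\<close> on
  the ball of radius \<open>N\<close>. \<open>K0\<close> is kept apart from \<open>\<eta>\<close> so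
  that the constants derived below depend neither on \<open>N\<close> nor on \<open>f\<close> nor on
  \<open>\<eta>\<close>.\<close>

locale localisation = normal_growth V \<rho> d D1 D2
  for V :: "'v set" and \<rho> and d D1 D2 +
  fixes b \<eta> K0 :: real and N :: nat and f :: "nat \<Rightarrow> real"
  assumes b: "d < b" and eta: "0 < \<eta>" and K0: "0 \<le> K0" and N: "1 \<le> N"
    and f_anti: "antimono f" and f_nonneg: "0 \<le> f j"
    and f_slow0: "i \<le> j \<Longrightarrow> f i * (real i + 1) powr b \<le> f j * (real j + 1) powr b"
    and f_sum: "u \<in> V \<Longrightarrow> finite F \<Longrightarrow> F \<subseteq> V \<Longrightarrow> (\<Sum>v\<in>F. f (max (\<rho> u v) N)) \<le> K0 * \<eta>"
begin

text \<open>The bump accommodates the starting column, a unit vector seen at scale \<open>N\<close>.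
  The second term is the kernel, scaled so that its total mass over \<open>V\<close> is of order
  \<open>N powr d\<close>, like that of the bump; this common mass is what makes the profile
  reproduce itself in \<open>conv_le\<close>.\<close>

definition q :: "nat \<Rightarrow> real" where
  "q j = (1 + real j / real N) powr - b + real N powr d / \<eta> * f (max j N)"

lemma b0: "0 < b" using b d1 by simp

lemma q_nonneg: "0 \<le> q j"
  unfolding q_def using eta f_nonneg by simp

lemma q_antimono: "antimono q"
proof (rule antimonoI)
  fix i j :: nat assume ij: "i \<le> j"
  have "(1 + real j / real N) powr - b \<le> (1 + real i / real N) powr - b"
    using ij b0 N by (intro powr_mono2') (auto simp: divide_right_mono add_pos_nonneg)
  moreover have "f (max j N) \<le> f (max i N)"
    using ij by (intro antimonoD[OF f_anti]) auto
  ultimately show "q j \<le> q i"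
    unfolding q_def using eta by (intro add_mono mult_left_mono) auto
qed

lemma f_le_q: "f (max j N) \<le> \<eta> / real N powr d * q j"
proof -
  have "\<eta> / real N powr d * (real N powr d / \<eta> * f (max j N)) \<le> \<eta> / real N powr d * q j"
    unfolding q_def using eta by (intro mult_left_mono) auto
  then show ?thesis using eta N by simp
qed

text \<open>\<open>max x N\<close> and \<open>x + N\<close> agree up to a factor 2, hence
  \<open>2 * L\<close>. The shifted distance \<open>x + N\<close> changes only by a bounded factor
  when a vertex moves by a multiple of \<open>N\<close>, and this is how the lemma is
  applied.\<close>

lemma f_slow:
  assumes L: "1 \<le> L" and xy: "real y + real N \<le> L * (real x + real N)"
  shows "f (max x N) \<le> (2 * L) powr b * f (max y N)"
proof (cases "max y N \<le> max x N")
  case True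
  then have "f (max x N) \<le> f (max y N)" by (rule antimonoD[OF f_anti])
  also have "\<dots> \<le> (2 * L) powr b * f (max y N)"
    using L b0 f_nonneg[of "max y N"] mult_right_mono[of 1 "(2 * L) powr b" "f (max y N)"]
    by (simp add: ge_one_powr_ge_zero)
  finally show ?thesis .
next
  case False
  define m M where "m = max x N" and "M = max y N"
  have mM: "m \<le> M" using False unfolding m_def M_def by linarith
  have "real M \<le> real y + real N" "real x + real N \<le> 2 * real m" by (simp_all add: m_def M_def)
  then have "real M + 1 \<le> L * (2 * real m) + 1"
    using xy L mult_left_mono[of "real x + real N" "2 * real m" L] by linarith
  also have "\<dots> \<le> 2 * L * (real m + 1)" using L by (simp add: algebra_simps)
  finally have "(real M + 1) powr b \<le> (2 * L * (real m + 1)) powr b"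
    using b0 by (intro powr_mono2) auto
  also have "\<dots> = (2 * L) powr b * (real m + 1) powr b" by (rule powr_mult)
  finally have "f M * (real M + 1) powr b \<le> f M * ((2 * L) powr b * (real m + 1) powr b)"
    using f_nonneg by (rule mult_left_mono)
  moreover have "f M * ((2 * L) powr b * (real m + 1) powr b) = ((2 * L) powr b * f M) * (real m + 1) powr b"
    by (simp only: mult_ac)
  ultimately have "f m * (real m + 1) powr b \<le> ((2 * L) powr b * f M) * (real m + 1) powr b"
    using f_slow0[OF mM] by linarith
  then have "f m \<le> (2 * L) powr b * f M"
    by (rule mult_right_le_imp_le) simp
  then show ?thesis by (simp add: m_def M_def)
qed

lemma q_slow:
  assumes L: "1 \<le> L" and xy: "real y + real N \<le> L * (real x + real N)"
  shows "q x \<le> (2 * L) powr b * q y"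
proof -
  have N0: "0 < real N" using N by simp
  have "1 + real y / real N \<le> (2 * L) * (1 + real x / real N)"
  proof -
    have "(real y + real N) / real N \<le> 2 * L * (real x + real N) / real N"
      using xy L N0 by (intro divide_right_mono) (auto intro: order_trans)
    then show ?thesis using N0 by (simp add: field_simps)
  qed
  then have "((2 * L) * (1 + real x / real N)) powr - b \<le> (1 + real y / real N) powr - b"
    using b0 by (intro powr_mono2') (auto simp: add_pos_nonneg)
  then have "(2 * L) powr b * ((2 * L) powr - b * (1 + real x / real N) powr - b)
      \<le> (2 * L) powr b * (1 + real y / real N) powr - b"
    unfolding powr_mult[symmetric] by (rule mult_left_mono) simp
  then have 1: "(1 + real x / real N) powr - b \<le> (2 * L) powr b * (1 + real y / real N) powr - b"
    using L by (simp flip: mult.assoc powr_add)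
  have "real N powr d / \<eta> * f (max x N) \<le> real N powr d / \<eta> * ((2 * L) powr b * f (max y N))"
    using eta by (intro mult_left_mono f_slow assms) auto
  with 1 show ?thesis unfolding q_def by (simp add: algebra_simps)
qed

lemma q_sum:
  assumes w: "w \<in> V" and F: "finite F" "F \<subseteq> V"
  shows "(\<Sum>v\<in>F. q (\<rho> v w)) \<le> (decay_const b + K0) * real N powr d"
proof -
  have N0: "0 < real N" using N by simp
  have eq: "(1 + real j / real N) powr - b = real N powr b * (real N + real j) powr - b" for j
  proof -
    have "1 + real j / real N = (real N + real j) / real N" using N0 by (simp add: field_simps)
    then show ?thesis using N0 by (simp add: powr_divide powr_minus field_simps)
  qed
  have sym: "\<rho> v w = \<rho> w v" if "v \<in> F" for v using that w F dist_sym by blast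
  have "(\<Sum>v\<in>F. (1 + real (\<rho> v w) / real N) powr - b)
      = real N powr b * (\<Sum>v\<in>F. (real N + real (\<rho> w v)) powr - b)"
    unfolding eq sum_distrib_left by (rule sum.cong) (auto simp: sym)
  also have "\<dots> \<le> real N powr b * (decay_const b * real N powr (d - b))"
    by (intro mult_left_mono sum_decay w F N b) auto
  also have "\<dots> = decay_const b * real N powr d"
    using N0 by (simp add: powr_diff)
  finally have 1: "(\<Sum>v\<in>F. (1 + real (\<rho> v w) / real N) powr - b) \<le> decay_const b * real N powr d" .
  have "(\<Sum>v\<in>F. real N powr d / \<eta> * f (max (\<rho> v w) N))
      = real N powr d / \<eta> * (\<Sum>v\<in>F. f (max (\<rho> w v) N))"
    unfolding sum_distrib_left by (rule sum.cong) (auto simp: sym)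
  also have "\<dots> \<le> real N powr d / \<eta> * (K0 * \<eta>)"
    using eta by (intro mult_left_mono f_sum w F) auto
  also have "\<dots> = K0 * real N powr d" using eta by simp
  finally show ?thesis using 1 unfolding q_def by (simp add: sum.distrib distrib_right)
qed

definition K1 :: real where
  "K1 = 4 powr b * (decay_const b + 2 * K0)"

lemma K1_nonneg: "0 \<le> K1"
  unfolding K1_def using decay_const_pos[OF b] K0 by simp

text \<open>One of the two legs \<open>u v\<close>, \<open>v w\<close> is at least half of
  \<open>\<rho> u w\<close>. If it is \<open>v w\<close>, then \<open>q (\<rho> v w)\<close> is
  comparable to \<open>q (\<rho> u w)\<close> and the kernel is summed by \<open>f_sum\<close>. If
  it is \<open>u v\<close>, the kernel is comparable to its value at \<open>\<rho> u w\<close>,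
  which \<open>f_le_q\<close> bounds by \<open>\<eta> / N powr d\<close> times the profile, and
  \<open>q_sum\<close> returns the factor \<open>N powr d\<close>. \<open>K1\<close> adds the two
  contributions; \<open>4 powr b\<close> is slowness with \<open>L = 2\<close>.\<close>

lemma conv_le:
  assumes u: "u \<in> V" and w: "w \<in> V" and F: "finite F" "F \<subseteq> V"
  shows "(\<Sum>v\<in>F. f (max (\<rho> u v) N) * q (\<rho> v w)) \<le> K1 * \<eta> * q (\<rho> u w)"
proof -
  let ?c = "\<lambda>v. f (max (\<rho> u v) N)" and ?Q = "q (\<rho> u w)"
  have "?c v * q (\<rho> v w) \<le> 4 powr b * (?c v * ?Q) + 4 powr b * (\<eta> / real N powr d * ?Q * q (\<rho> v w))"
    if v: "v \<in> F" for v
  proof -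
    have tri: "\<rho> u w \<le> \<rho> u v + \<rho> v w" using dist_tri u w v F by blast
    have nn: "0 \<le> ?c v" "0 \<le> q (\<rho> v w)" "0 \<le> ?Q" using f_nonneg q_nonneg by auto
    show ?thesis
    proof (cases "\<rho> u w \<le> 2 * \<rho> v w")
      case True
      then have "q (\<rho> v w) \<le> (2 * 2) powr b * ?Q" by (intro q_slow) auto
      then have "?c v * q (\<rho> v w) \<le> ?c v * (4 powr b * ?Q)" using nn by (intro mult_left_mono) auto
      moreover have "0 \<le> 4 powr b * (\<eta> / real N powr d * ?Q * q (\<rho> v w))" using nn eta by simp
      ultimately show ?thesis by (simp add: mult_ac)
    next
      case False
      then have "\<rho> u w \<le> 2 * \<rho> u v" using tri by linarith
      then have "?c v \<le> (2 * 2) powr b * f (max (\<rho> u w) N)" by (intro f_slow) auto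
      also have "\<dots> \<le> (2 * 2) powr b * (\<eta> / real N powr d * ?Q)"
        by (intro mult_left_mono f_le_q) auto
      finally have "?c v * q (\<rho> v w) \<le> (4 powr b * (\<eta> / real N powr d * ?Q)) * q (\<rho> v w)"
        using nn by (intro mult_right_mono) auto
      moreover have "0 \<le> 4 powr b * (?c v * ?Q)" using nn by simp
      ultimately show ?thesis by (simp add: mult.assoc)
    qed
  qed
  then have "(\<Sum>v\<in>F. ?c v * q (\<rho> v w))
     \<le> (\<Sum>v\<in>F. 4 powr b * (?c v * ?Q) + 4 powr b * (\<eta> / real N powr d * ?Q * q (\<rho> v w)))"
    by (rule sum_mono)
  also have "\<dots> = 4 powr b * ((\<Sum>v\<in>F. ?c v) * ?Q)
       + 4 powr b * (\<eta> / real N powr d * ?Q * (\<Sum>v\<in>F. q (\<rho> v w)))"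
    by (simp add: sum.distrib sum_distrib_left sum_distrib_right)
  also have "\<dots> \<le> 4 powr b * (K0 * \<eta> * ?Q)
       + 4 powr b * (\<eta> / real N powr d * ?Q * ((decay_const b + K0) * real N powr d))"
    using eta q_nonneg
    by (intro add_mono mult_left_mono mult_right_mono f_sum q_sum u w F mult_nonneg_nonneg) auto
  also have "\<dots> = K1 * \<eta> * ?Q"
  proof -
    have "real N powr d \<noteq> 0" using N by simp
    then show ?thesis unfolding K1_def by (simp add: field_simps)
  qed
  finally show ?thesis .
qed

section \<open>Cutoff functions and localised ell2 norms\<close>

definition chi :: "'v \<Rightarrow> 'v \<Rightarrow> real" where
  "chi u v = max 0 (min 1 (2 - real (\<rho> u v) / real N))"

lemma chi_bounds: "0 \<le> chi u v" "chi u v \<le> 1"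
  by (auto simp: chi_def)

lemma chi_one: "\<rho> u v \<le> N \<Longrightarrow> chi u v = 1"
  using N by (simp add: chi_def)

lemma chi_zero: "2 * N \<le> \<rho> u v \<Longrightarrow> chi u v = 0"
proof -
  assume "2 * N \<le> \<rho> u v"
  then have "real (2 * N) \<le> real (\<rho> u v)" by (simp only: of_nat_le_iff)
  then have "2 \<le> real (\<rho> u v) / real N" using N by (simp add: field_simps)
  then show ?thesis by (simp add: chi_def)
qed

text \<open>The slope \<open>1 / N\<close> supplies the small factor of the commutator at short
  range; at long range the trivial bound 1 is combined with small entries.\<close>

lemma chi_lipschitz:
  assumes "u \<in> V" "x \<in> V" "y \<in> V"
  shows "\<bar>chi u x - chi u y\<bar> \<le> min 1 (real (\<rho> x y) / real N)"
proof -
  have "real (\<rho> u x) \<le> real (\<rho> u y) + real (\<rho> x y)" "real (\<rho> u y) \<le> real (\<rho> u x) + real (\<rho> x y)"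
    using dist_tri[of u y x] dist_tri[of u x y] dist_sym[of x y] assms by linarith+
  then have "real (\<rho> u x) / real N \<le> real (\<rho> u y) / real N + real (\<rho> x y) / real N"
    "real (\<rho> u y) / real N \<le> real (\<rho> u x) / real N + real (\<rho> x y) / real N"
    using N unfolding add_divide_distrib[symmetric] by (auto intro!: divide_right_mono)
  moreover have "0 \<le> real (\<rho> x y) / real N" by simp
  ultimately show ?thesis unfolding chi_def by linarith
qed

text \<open>Since \<open>chi u\<close> vanishes from distance \<open>2 * N\<close> on, this is the
  ell2 norm of the cut-off vector over all of \<open>V\<close>, written as a finite sum so that no
  summability of \<open>y\<close> enters.\<close>

definition loc :: "('v \<Rightarrow> complex) \<Rightarrow> 'v \<Rightarrow> real" where
  "loc y u = L2_set (\<lambda>x. chi u x * cmod (y x)) (B u (2 * N))"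

lemma loc_nonneg: "0 \<le> loc y u" by (simp add: loc_def)

lemma sum_ball_le_loc:
  assumes u: "u \<in> V"
  shows "(\<Sum>x\<in>B u N. (cmod (y x))\<^sup>2) \<le> (loc y u)\<^sup>2"
proof -
  have "(\<Sum>x\<in>B u N. (cmod (y x))\<^sup>2) = (\<Sum>x\<in>B u N. (chi u x * cmod (y x))\<^sup>2)"
    by (rule sum.cong) (auto simp: chi_one B_def)
  also have "\<dots> \<le> (\<Sum>x\<in>B u (2 * N). (chi u x * cmod (y x))\<^sup>2)"
    by (rule sum_mono2) (use u in \<open>auto simp: B_def fin_ball\<close>)
  also have "\<dots> = (loc y u)\<^sup>2" using u by (simp add: loc_def L2_set_power2)
  finally show ?thesis .
qed

lemma entry_le_loc: "u \<in> V \<Longrightarrow> cmod (y u) \<le> loc y u"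
proof -
  assume u: "u \<in> V"
  have "chi u u * cmod (y u) \<le> loc y u"
    unfolding loc_def by (rule member_le_L2_set) (use u in \<open>auto simp: B_def dist_self fin_ball\<close>)
  then show ?thesis using u by (simp add: chi_one dist_self)
qed

text \<open>\<open>D1 / D2 * 9 powr d\<close> compares the size of a ball of radius
  \<open>9 * N\<close> with the least size of one of radius \<open>N\<close>;
  \<open>20 powr b\<close> is slowness of \<open>q\<close> with \<open>L = 10\<close>.\<close>

definition Knear :: real where
  "Knear = sqrt (D1 / D2 * 9 powr d) * 20 powr b"

lemma Knear_nonneg: "0 \<le> Knear"
  unfolding Knear_def using D1 D2 by simp

text \<open>The localised norms see only balls of radius \<open>N\<close>. Averaging over all such
  balls with centre in \<open>B u (9 * N)\<close> recovers the larger ball, and by normal growth the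
  cost is a ratio of ball sizes independent of \<open>N\<close>.\<close>

lemma near_le:
  assumes u: "u \<in> V" and w: "w \<in> V" and Q: "0 \<le> Q"
    and y: "\<And>v. v \<in> V \<Longrightarrow> loc y v \<le> Q * q (\<rho> v w)"
  shows "L2_set (\<lambda>x. cmod (y x)) (B u (8 * N)) \<le> Knear * Q * q (\<rho> u w)"
proof -
  let ?M = "20 powr b * (Q * q (\<rho> u w))"
  have M0: "0 \<le> ?M" using Q q_nonneg by simp
  have pos: "0 < D2 * (real N + 1) powr d" using D2 N by simp
  have "D2 * (real N + 1) powr d * (\<Sum>x\<in>B u (8 * N). (cmod (y x))\<^sup>2)
     \<le> (\<Sum>v\<in>B u (9 * N). \<Sum>x\<in>B u (8 * N) \<inter> B v N. (cmod (y x))\<^sup>2)"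
  proof (rule sum_le_ball_average)
    fix x assume x: "x \<in> B u (8 * N)"
    show "B x N \<subseteq> B u (9 * N)"
    proof
      fix z assume z: "z \<in> B x N"
      have "\<rho> u z \<le> \<rho> u x + \<rho> x z" using x z u by (intro dist_tri) (auto simp: B_def)
      then show "z \<in> B u (9 * N)" using x z by (auto simp: B_def)
    qed
  qed (use u B_subset in auto)
  also have "\<dots> \<le> (\<Sum>v\<in>B u (9 * N). ?M\<^sup>2)"
  proof (rule sum_mono)
    fix v assume v: "v \<in> B u (9 * N)"
    then have vV: "v \<in> V" by (auto simp: B_def)
    have "(\<Sum>x\<in>B u (8 * N) \<inter> B v N. (cmod (y x))\<^sup>2) \<le> (\<Sum>x\<in>B v N. (cmod (y x))\<^sup>2)"
      by (rule sum_mono2) (use vV in auto)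
    also have "\<dots> \<le> (loc y v)\<^sup>2" by (rule sum_ball_le_loc[OF vV])
    also have "\<dots> \<le> ?M\<^sup>2"
    proof (rule power_mono[OF _ loc_nonneg])
      have "\<rho> u w \<le> \<rho> u v + \<rho> v w" using dist_tri u w vV by blast
      then have "\<rho> u w + N \<le> 10 * (\<rho> v w + N)" using v by (auto simp: B_def)
      then have "real (\<rho> u w + N) \<le> real (10 * (\<rho> v w + N))" by (simp only: of_nat_le_iff)
      then have "q (\<rho> v w) \<le> (2 * 10) powr b * q (\<rho> u w)" by (intro q_slow) auto
      then have "Q * q (\<rho> v w) \<le> Q * (20 powr b * q (\<rho> u w))" using Q by (intro mult_left_mono) auto
      with y[OF vV] show "loc y v \<le> ?M" by (simp add: mult_ac)
    qed
    finally show "(\<Sum>x\<in>B u (8 * N) \<inter> B v N. (cmod (y x))\<^sup>2) \<le> ?M\<^sup>2" .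
  qed
  also have "\<dots> = real (card (B u (9 * N))) * ?M\<^sup>2" by simp
  also have "\<dots> \<le> (D1 * (9 powr d * (real N + 1) powr d)) * ?M\<^sup>2"
  proof (rule mult_right_mono)
    have "real (card (B u (9 * N))) \<le> D1 * (real (9 * N) + 1) powr d" by (rule card_B_le[OF u])
    also have "\<dots> \<le> D1 * (9 * (real N + 1)) powr d"
      using D1 d1 by (intro mult_left_mono powr_mono2) auto
    finally show "real (card (B u (9 * N))) \<le> D1 * (9 powr d * (real N + 1) powr d)"
      by (simp only: powr_mult)
  qed simp
  also have "\<dots> = D2 * (real N + 1) powr d * (D1 / D2 * 9 powr d * ?M\<^sup>2)"
    using D2 by simp
  finally have "(\<Sum>x\<in>B u (8 * N). (cmod (y x))\<^sup>2) \<le> D1 / D2 * 9 powr d * ?M\<^sup>2"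
    using pos by (simp only: mult_le_cancel_left_pos)
  also have "\<dots> = (Knear * Q * q (\<rho> u w))\<^sup>2"
    using D1 D2 by (simp add: Knear_def power_mult_distrib)
  finally show ?thesis
    using Knear_nonneg Q q_nonneg by (subst L2_set_le_iff) auto
qed

definition Kfar :: real where
  "Kfar = D1 / D2 * sqrt (2 powr d) * 8 powr b * K1"

lemma Kfar_nonneg: "0 \<le> Kfar"
  unfolding Kfar_def using D1 D2 K1_nonneg by simp

text \<open>The square root in front majorises \<open>sqrt (card (B u (2 * N)))\<close>, which
  \<open>loc_step\<close> needs to turn a bound uniform in \<open>x\<close> into an ell2 bound.
  Averaging over balls of radius \<open>N\<close> divides by \<open>D2 * P\<close>, and
  Cauchy-Schwarz on each ball gives \<open>sqrt (D1 * P)\<close>; with the square root in front all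
  powers of \<open>P\<close> cancel. What remains is the convolution of
  \<open>conv_le\<close>.\<close>

lemma far_le:
  assumes u: "u \<in> V" and w: "w \<in> V" and Q: "0 \<le> Q"
    and y: "\<And>v. v \<in> V \<Longrightarrow> loc y v \<le> Q * q (\<rho> v w)"
    and A: "\<And>x z. x \<in> V \<Longrightarrow> z \<in> V \<Longrightarrow> cmod (A x z) \<le> f (\<rho> x z)"
    and x: "x \<in> B u (2 * N)" and F: "finite F" "F \<subseteq> V - B u (8 * N)"
  shows "sqrt (D1 * (2 powr d * (real N + 1) powr d)) * (\<Sum>z\<in>F. cmod (A x z * y z)) \<le> Kfar * \<eta> * Q * q (\<rho> u w)"
proof -
  define P where "P = (real N + 1) powr d"
  have P: "0 < P" by (simp add: P_def)
  define F' where "F' = (\<Union>z\<in>F. B z N)"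
  have F': "finite F'" "F' \<subseteq> V" using F by (auto simp: F'_def B_def fin_ball)
  have xV: "x \<in> V" using x by (auto simp: B_def)
  have "D2 * P * (\<Sum>z\<in>F. cmod (A x z * y z)) \<le> (\<Sum>v\<in>F'. \<Sum>z\<in>F \<inter> B v N. cmod (A x z * y z))"
    unfolding P_def by (rule sum_le_ball_average) (use F F' in \<open>auto simp: F'_def\<close>)
  also have "\<dots> \<le> (\<Sum>v\<in>F'. 8 powr b * sqrt (D1 * P) * Q * (f (max (\<rho> u v) N) * q (\<rho> v w)))"
  proof (rule sum_mono)
    fix v assume v: "v \<in> F'"
    then have vV: "v \<in> V" using F' by auto
    have "(\<Sum>z\<in>F \<inter> B v N. cmod (A x z * y z)) \<le> (\<Sum>z\<in>F \<inter> B v N. 8 powr b * f (max (\<rho> u v) N) * cmod (y z))"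
    proof (rule sum_mono)
      fix z assume z: "z \<in> F \<inter> B v N"
      then have zV: "z \<in> V" "8 * N < \<rho> u z" "\<rho> v z \<le> N" using F by (auto simp: B_def)
      have "\<rho> u z \<le> \<rho> u x + \<rho> x z" "\<rho> u v \<le> \<rho> u z + \<rho> v z"
        using dist_tri[of u x z] dist_tri[of u z v] dist_sym[of v z] u xV zV vV by auto
      \<comment> \<open>As \<open>x\<close> is within \<open>2 * N\<close> of \<open>u\<close> and
        \<open>z\<close> beyond \<open>8 * N\<close>, the distance \<open>\<rho> x z\<close> exceeds
        \<open>6 * N\<close>, so flattening at \<open>N\<close> leaves it unchanged. Replacing it by
        \<open>\<rho> u v\<close> costs at most \<open>3 * N\<close>, hence slowness with
        \<open>L = 4\<close>.\<close>
      then have le: "\<rho> u v + N \<le> 4 * (\<rho> x z + N)" "N \<le> \<rho> x z"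
        using x zV by (auto simp: B_def)
      then have "real (\<rho> u v + N) \<le> real (4 * (\<rho> x z + N))" by (simp only: of_nat_le_iff)
      then have "f (max (\<rho> x z) N) \<le> (2 * 4) powr b * f (max (\<rho> u v) N)" by (intro f_slow) auto
      then have "cmod (A x z) \<le> 8 powr b * f (max (\<rho> u v) N)"
        using A[OF xV zV(1)] le(2) by (simp add: max_absorb1)
      then show "cmod (A x z * y z) \<le> 8 powr b * f (max (\<rho> u v) N) * cmod (y z)"
        by (simp add: norm_mult mult_right_mono)
    qed
    also have "\<dots> \<le> (\<Sum>z\<in>B v N. 8 powr b * f (max (\<rho> u v) N) * cmod (y z))"
      using vV f_nonneg by (intro sum_mono2) auto
    also have "\<dots> = 8 powr b * f (max (\<rho> u v) N) * (\<Sum>z\<in>B v N. 1 * cmod (y z))"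
      by (simp add: sum_distrib_left)
    also have "\<dots> \<le> 8 powr b * f (max (\<rho> u v) N) * (sqrt (D1 * P) * (Q * q (\<rho> v w)))"
    proof (rule mult_left_mono)
      have "(\<Sum>z\<in>B v N. 1 * cmod (y z)) \<le> L2_set (\<lambda>_. 1) (B v N) * L2_set (\<lambda>z. cmod (y z)) (B v N)"
        using L2_set_mult_ineq[of "\<lambda>_. 1" "\<lambda>z. cmod (y z)" "B v N"] by simp
      also have "\<dots> \<le> sqrt (D1 * P) * (Q * q (\<rho> v w))"
      proof (rule mult_mono)
        show "L2_set (\<lambda>_. 1) (B v N) \<le> sqrt (D1 * P)"
          using card_B_le[OF vV, of N] by (simp add: L2_set_constant P_def)
        show "L2_set (\<lambda>z. cmod (y z)) (B v N) \<le> Q * q (\<rho> v w)"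
        proof -
          have "L2_set (\<lambda>z. cmod (y z)) (B v N) \<le> loc y v"
            using sum_ball_le_loc[OF vV, of y] loc_nonneg by (subst L2_set_le_iff) auto
          then show ?thesis using y[OF vV] by simp
        qed
      qed (use D1 P in auto)
      finally show "(\<Sum>z\<in>B v N. 1 * cmod (y z)) \<le> sqrt (D1 * P) * (Q * q (\<rho> v w))" .
    qed (use f_nonneg in simp)
    finally show "(\<Sum>z\<in>F \<inter> B v N. cmod (A x z * y z))
       \<le> 8 powr b * sqrt (D1 * P) * Q * (f (max (\<rho> u v) N) * q (\<rho> v w))"
      by (simp add: mult_ac)
  qed
  also have "\<dots> = 8 powr b * sqrt (D1 * P) * Q * (\<Sum>v\<in>F'. f (max (\<rho> u v) N) * q (\<rho> v w))"
    by (simp add: sum_distrib_left)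
  also have "\<dots> \<le> 8 powr b * sqrt (D1 * P) * Q * (K1 * \<eta> * q (\<rho> u w))"
    using Q D1 P by (intro mult_left_mono conv_le u w F') auto
  finally have "sqrt (D1 * (2 powr d * P)) * (D2 * P * (\<Sum>z\<in>F. cmod (A x z * y z)))
     \<le> sqrt (D1 * (2 powr d * P)) * (8 powr b * sqrt (D1 * P) * Q * (K1 * \<eta> * q (\<rho> u w)))"
    using D1 P by (intro mult_left_mono) auto
  also have "\<dots> = (sqrt (D1 * P) * sqrt (D1 * P)) * sqrt (2 powr d) * (8 powr b * Q * (K1 * \<eta> * q (\<rho> u w)))"
    by (simp add: real_sqrt_mult mult_ac)
  also have "\<dots> = D2 * P * (Kfar * \<eta> * Q * q (\<rho> u w))"
    using D1 D2 P by (simp add: Kfar_def mult_ac)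
  finally have "D2 * P * (sqrt (D1 * (2 powr d * P)) * (\<Sum>z\<in>F. cmod (A x z * y z)))
      \<le> D2 * P * (Kfar * \<eta> * Q * q (\<rho> u w))" by (simp add: mult_ac)
  then show ?thesis using D2 P by (simp add: P_def)
qed

section \<open>One multiplication by the matrix, and the induction on the power\<close>

definition Kstep :: real where "Kstep = K0 * Knear + Kfar"

lemma Kstep_nonneg: "0 \<le> Kstep"
  unfolding Kstep_def using K0 Knear_nonneg Kfar_nonneg by simp

text \<open>Multiplication by \<open>A\<close> enlarges the localised norms by the factor \<open>\<nu>\<close>, up to the commutator of \<open>A\<close>
  with the cutoff. Near \<open>u\<close> the commutator is small since the cutoff is Lipschitz; far from \<open>u\<close> the
  entries of \<open>A\<close> are small.\<close>

lemma loc_step: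
  assumes u: "u \<in> V" and w: "w \<in> V" and Q: "0 \<le> Q" and nu: "0 \<le> \<nu>"
    and y: "\<And>v. v \<in> V \<Longrightarrow> loc y v \<le> Q * q (\<rho> v w)"
    and A: "\<And>x z. x \<in> V \<Longrightarrow> z \<in> V \<Longrightarrow> cmod (A x z) \<le> h (\<rho> x z)"
    and hf: "\<And>j. h j \<le> f j" and h: "\<And>j. 0 \<le> h j"
    and comm: "\<And>x F. x \<in> V \<Longrightarrow> finite F \<Longrightarrow> F \<subseteq> V \<Longrightarrow>
       (\<Sum>z\<in>F. min 1 (real (\<rho> x z) / real N) * h (\<rho> x z)) \<le> K0 * \<eta>"
    and op: "\<And>S T z. finite S \<Longrightarrow> finite T \<Longrightarrow> S \<subseteq> V \<Longrightarrow> T \<subseteq> V \<Longrightarrow>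
       L2_set (\<lambda>x. cmod (\<Sum>t\<in>T. A x t * z t)) S \<le> \<nu> * L2_set (\<lambda>t. cmod (z t)) T"
  shows "loc (mat_vec V A y) u \<le> (\<nu> + Kstep * \<eta>) * Q * q (\<rho> u w)"
proof -
  \<comment> \<open>Rows run over the support of the cutoff. Columns in \<open>T\<close> carry the
    commutator; for columns outside \<open>T\<close> the smallness of the entries alone is
    used.\<close>
  define S T where "S = B u (2 * N)" and "T = B u (8 * N)"
  have S: "finite S" "S \<subseteq> V" and T: "finite T" "T \<subseteq> V" and ST: "S \<subseteq> T"
    using u by (auto simp: S_def T_def B_def fin_ball)
  define s where "s = sqrt (D1 * (2 powr d * (real N + 1) powr d))"
  have s: "0 < s" using D1 by (simp add: s_def)
  define G where "G = Kfar * \<eta> * Q * q (\<rho> u w)"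
  have fA: "cmod (A x z) \<le> f (\<rho> x z)" if "x \<in> V" "z \<in> V" for x z
    using A[OF that] hf[of "\<rho> x z"] by simp
  have far: "(\<lambda>z. A x z * y z) summable_on V - T" "cmod (\<Sum>\<^sub>\<infinity>z\<in>V - T. A x z * y z) \<le> G / s"
    if x: "x \<in> S" for x
  proof -
    have "(\<Sum>z\<in>F. cmod (A x z * y z)) \<le> G / s" if F: "finite F" "F \<subseteq> V - T" for F
    proof -
      have "s * (\<Sum>z\<in>F. cmod (A x z * y z)) \<le> G"
        using far_le[OF u w Q y fA x[unfolded S_def] F[unfolded T_def]]
        by (simp only: s_def G_def)
      then show ?thesis using s by (simp add: pos_le_divide_eq mult.commute)
    qed
    from abs_summable_bound[of "V - T" "\<lambda>z. A x z * y z", OF this]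
    show "(\<lambda>z. A x z * y z) summable_on V - T" "cmod (\<Sum>\<^sub>\<infinity>z\<in>V - T. A x z * y z) \<le> G / s"
      by auto
  qed
  define R where "R = (\<lambda>x. \<Sum>\<^sub>\<infinity>z\<in>V - T. A x z * y z)"
  let ?g1 = "\<lambda>x. cmod (\<Sum>z\<in>T. A x z * (complex_of_real (chi u z) * y z))"
  let ?g2 = "\<lambda>x. \<Sum>z\<in>T. (min 1 (real (\<rho> x z) / real N) * h (\<rho> x z)) * cmod (y z)"
  have pw: "chi u x * cmod (mat_vec V A y x) \<le> ?g1 x + (?g2 x + G / s)" if x: "x \<in> S" for x
  proof -
    have xV: "x \<in> V" using x S by auto
    have "mat_vec V A y x = (\<Sum>\<^sub>\<infinity>z\<in>T \<union> (V - T). A x z * y z)"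
      using T by (simp add: mat_vec_def Un_absorb1)
    also have "\<dots> = (\<Sum>z\<in>T. A x z * y z) + R x"
      unfolding R_def by (subst infsum_Un_disjoint) (use T far(1)[OF x] in auto)
    finally have mv: "mat_vec V A y x = (\<Sum>z\<in>T. A x z * y z) + R x" .
    \<comment> \<open>The commutator appears by writing
      \<open>chi u x = chi u z + (chi u x - chi u z)\<close> inside the sum.\<close>
    have "(\<Sum>z\<in>T. complex_of_real (chi u x) * (A x z * y z))
       = (\<Sum>z\<in>T. A x z * (complex_of_real (chi u z) * y z)
          + complex_of_real (chi u x - chi u z) * (A x z * y z))"
      by (rule sum.cong) (auto simp: algebra_simps)
    then have "complex_of_real (chi u x) * mat_vec V A y x
       = (\<Sum>z\<in>T. A x z * (complex_of_real (chi u z) * y z))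
         + ((\<Sum>z\<in>T. complex_of_real (chi u x - chi u z) * (A x z * y z)) + complex_of_real (chi u x) * R x)"
      unfolding mv distrib_left sum_distrib_left sum.distrib by (simp only: add.assoc)
    then have "cmod (complex_of_real (chi u x) * mat_vec V A y x)
       \<le> ?g1 x + (cmod (\<Sum>z\<in>T. complex_of_real (chi u x - chi u z) * (A x z * y z))
          + cmod (complex_of_real (chi u x) * R x))"
      using order_trans[OF norm_triangle_ineq add_left_mono[OF norm_triangle_ineq]] by simp
    moreover have "cmod (\<Sum>z\<in>T. complex_of_real (chi u x - chi u z) * (A x z * y z)) \<le> ?g2 x"
    proof (rule sum_norm_le)
      fix z assume z: "z \<in> T"
      then have zV: "z \<in> V" using T by auto
      show "cmod (complex_of_real (chi u x - chi u z) * (A x z * y z))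
        \<le> (min 1 (real (\<rho> x z) / real N) * h (\<rho> x z)) * cmod (y z)"
        unfolding norm_mult norm_of_real mult.assoc[symmetric]
        by (intro mult_right_mono mult_mono chi_lipschitz A u xV zV) auto
    qed
    moreover have "cmod (complex_of_real (chi u x) * R x) \<le> 1 * (G / s)"
      unfolding norm_mult norm_of_real R_def
      by (rule mult_mono) (use chi_bounds far(2)[OF x] in auto)
    ultimately show ?thesis using chi_bounds by (simp add: norm_mult)
  qed
  have "loc (mat_vec V A y) u \<le> L2_set (\<lambda>x. ?g1 x + (?g2 x + G / s)) S"
    unfolding loc_def S_def[symmetric] by (rule L2_set_mono) (use pw chi_bounds in auto)
  also have "\<dots> \<le> L2_set ?g1 S + (L2_set ?g2 S + L2_set (\<lambda>x. G / s) S)"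
    by (rule order_trans[OF L2_set_triangle_ineq add_left_mono[OF L2_set_triangle_ineq]])
  \<comment> \<open>Three sources: the operator norm acting on the cut-off vector, Schur's test for
    the commutator followed by \<open>near_le\<close>, and the far columns, whose uniform bound
    \<open>G / s\<close> is multiplied by \<open>sqrt (card S) \<le> s\<close>.\<close>
  also have "\<dots> \<le> \<nu> * (Q * q (\<rho> u w)) + (K0 * \<eta> * (Knear * Q * q (\<rho> u w)) + G)"
  proof (intro add_mono)
    have "L2_set ?g1 S \<le> \<nu> * L2_set (\<lambda>z. cmod (complex_of_real (chi u z) * y z)) T"
      by (rule op[OF S(1) T(1) S(2) T(2)])
    also have "L2_set (\<lambda>z. cmod (complex_of_real (chi u z) * y z)) T = loc y u"
    proof -
      have "(\<Sum>z\<in>T. (chi u z * cmod (y z))\<^sup>2) = (\<Sum>z\<in>S. (chi u z * cmod (y z))\<^sup>2)"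
      proof (rule sum.mono_neutral_right[OF T(1) ST], rule ballI)
        fix z assume "z \<in> T - S"
        then have "chi u z = 0" by (intro chi_zero) (auto simp: S_def T_def B_def)
        then show "(chi u z * cmod (y z))\<^sup>2 = 0" by simp
      qed
      then show ?thesis using chi_bounds by (simp add: loc_def L2_set_def S_def norm_mult)
    qed
    also have "\<nu> * loc y u \<le> \<nu> * (Q * q (\<rho> u w))" by (intro mult_left_mono y u nu)
    finally show "L2_set ?g1 S \<le> \<nu> * (Q * q (\<rho> u w))" .
    have "L2_set ?g2 S \<le> K0 * \<eta> * L2_set (\<lambda>z. cmod (y z)) T"
    proof (rule schur_test)
      fix z assume z: "z \<in> T"
      have "(\<Sum>x\<in>S. min 1 (real (\<rho> x z) / real N) * h (\<rho> x z))
          = (\<Sum>x\<in>S. min 1 (real (\<rho> z x) / real N) * h (\<rho> z x))"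
      proof (rule sum.cong[OF refl])
        fix x assume "x \<in> S"
        then have "\<rho> x z = \<rho> z x" using z S T by (intro dist_sym) auto
        then show "min 1 (real (\<rho> x z) / real N) * h (\<rho> x z)
          = min 1 (real (\<rho> z x) / real N) * h (\<rho> z x)" by (simp only:)
      qed
      then show "(\<Sum>x\<in>S. min 1 (real (\<rho> x z) / real N) * h (\<rho> x z)) \<le> K0 * \<eta>"
        using comm[of z S] z S T by auto
    qed (use S T h comm K0 eta in auto)
    also have "\<dots> \<le> K0 * \<eta> * (Knear * Q * q (\<rho> u w))"
      unfolding T_def using K0 eta by (intro mult_left_mono near_le u w Q y) auto
    finally show "L2_set ?g2 S \<le> K0 * \<eta> * (Knear * Q * q (\<rho> u w))" .
    have G0: "0 \<le> G" using Kfar_nonneg eta Q q_nonneg by (simp add: G_def)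
    have "L2_set (\<lambda>x. G / s) S = sqrt (card S) * (G / s)"
      using G0 s by (simp add: L2_set_constant)
    also have "\<dots> \<le> s * (G / s)"
    proof (rule mult_right_mono)
      have "real (card S) \<le> D1 * (real (2 * N) + 1) powr d" unfolding S_def by (rule card_B_le[OF u])
      also have "\<dots> \<le> D1 * (2 * (real N + 1)) powr d"
        using D1 d1 by (intro mult_left_mono powr_mono2) auto
      finally show "sqrt (card S) \<le> s" unfolding s_def powr_mult by simp
    qed (use G0 s in simp)
    finally show "L2_set (\<lambda>x. G / s) S \<le> G" using s by simp
  qed
  also have "\<dots> = (\<nu> + Kstep * \<eta>) * Q * q (\<rho> u w)"
    by (simp add: G_def Kstep_def algebra_simps)
  finally show ?thesis .
qed

lemma mat_pow_Suc_column: "(\<lambda>x. mat_pow V A (Suc k) x w) = mat_vec V A (\<lambda>x. mat_pow V A k x w)"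
  by (rule ext) (simp add: mat_mult_def mat_vec_def)

text \<open>The induction runs over the localised norms of the column at \<open>w\<close>, at all
  centres \<open>v\<close> simultaneously, since a step uses neighbouring centres. At the start the
  column is a unit vector, visible only from \<open>\<rho> v w \<le> 2 * N\<close>, where the bump
  is at least \<open>3 powr - b\<close>; this is the constant in front.\<close>

lemma mat_pow_le:
  assumes u: "u \<in> V" and w: "w \<in> V" and nu: "0 \<le> \<nu>"
    and A: "\<And>x z. x \<in> V \<Longrightarrow> z \<in> V \<Longrightarrow> cmod (A x z) \<le> h (\<rho> x z)"
    and hf: "\<And>j. h j \<le> f j" and h: "\<And>j. 0 \<le> h j"
    and comm: "\<And>x F. x \<in> V \<Longrightarrow> finite F \<Longrightarrow> F \<subseteq> V \<Longrightarrow>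
       (\<Sum>z\<in>F. min 1 (real (\<rho> x z) / real N) * h (\<rho> x z)) \<le> K0 * \<eta>"
    and op: "\<And>S T z. finite S \<Longrightarrow> finite T \<Longrightarrow> S \<subseteq> V \<Longrightarrow> T \<subseteq> V \<Longrightarrow>
       L2_set (\<lambda>x. cmod (\<Sum>t\<in>T. A x t * z t)) S \<le> \<nu> * L2_set (\<lambda>t. cmod (z t)) T"
  shows "cmod (mat_pow V A n u w) \<le> 3 powr b * (\<nu> + Kstep * \<eta>) ^ n * q (\<rho> u w)"
proof -
  have "\<forall>v\<in>V. loc (\<lambda>x. mat_pow V A n x w) v \<le> 3 powr b * (\<nu> + Kstep * \<eta>) ^ n * q (\<rho> v w)"
  proof (induction n)
    case 0
    show ?case
    proof
      fix v assume v: "v \<in> V"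
      have le1: "loc (\<lambda>x. mat_pow V A 0 x w) v \<le> (if \<rho> v w \<le> 2 * N then 1 else 0)"
      proof -
        have "(\<Sum>x\<in>B v (2 * N). (chi v x * cmod (mat_pow V A 0 x w))\<^sup>2)
           = (\<Sum>x\<in>B v (2 * N). if x = w then (chi v x)\<^sup>2 else 0)"
          by (rule sum.cong) auto
        also have "\<dots> \<le> (if \<rho> v w \<le> 2 * N then 1 else 0)"
          using v w chi_bounds by (auto simp: B_def fin_ball power_le_one)
        finally show ?thesis unfolding loc_def by (subst L2_set_le_iff) auto
      qed
      show "loc (\<lambda>x. mat_pow V A 0 x w) v \<le> 3 powr b * (\<nu> + Kstep * \<eta>) ^ 0 * q (\<rho> v w)"
      proof (cases "\<rho> v w \<le> 2 * N")
        case True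
        then have "real (\<rho> v w) / real N \<le> 2" using N by (simp add: field_simps flip: of_nat_mult)
        then have "3 powr - b \<le> (1 + real (\<rho> v w) / real N) powr - b"
          using b0 by (intro powr_mono2') (auto simp: add_pos_nonneg)
        also have "\<dots> \<le> q (\<rho> v w)" unfolding q_def using eta f_nonneg by simp
        finally have "3 powr b * 3 powr - b \<le> 3 powr b * q (\<rho> v w)" by (rule mult_left_mono) simp
        then have "1 \<le> 3 powr b * q (\<rho> v w)" by (simp flip: powr_add)
        then show ?thesis using le1 True by simp
      next
        case False
        then show ?thesis using le1 q_nonneg by (simp add: order_trans)
      qed
    qed
  next
    case (Suc n)
    have fac: "0 \<le> \<nu> + Kstep * \<eta>" using nu Kstep_nonneg eta by simp
    show ?case
    proof
      fix v assume v: "v \<in> V"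
      have "loc (mat_vec V A (\<lambda>x. mat_pow V A n x w)) v
         \<le> (\<nu> + Kstep * \<eta>) * (3 powr b * (\<nu> + Kstep * \<eta>) ^ n) * q (\<rho> v w)"
        by (rule loc_step[OF v w _ nu _ A hf h comm op]) (use Suc fac in auto)
      then show "loc (\<lambda>x. mat_pow V A (Suc n) x w) v \<le> 3 powr b * (\<nu> + Kstep * \<eta>) ^ Suc n * q (\<rho> v w)"
        unfolding mat_pow_Suc_column by (simp add: mult_ac)
    qed
  qed
  then show ?thesis using entry_le_loc[OF u, of "\<lambda>x. mat_pow V A n x w"] u by (auto intro: order_trans)
qed

end

section \<open>Operators on $\ell^2$\<close>

lemma ell2_finite_sum:
  assumes "x \<in> ell2 V" "finite F" "F \<subseteq> V"
  shows "L2_set (\<lambda>v. cmod (x v)) F \<le> ell2_norm V x"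
  unfolding L2_set_def ell2_norm_def
  by (intro real_sqrt_le_mono finite_sum_le_infsum) (use assms in \<open>auto simp: ell2_def\<close>)

lemma ell2_entry: "x \<in> ell2 V \<Longrightarrow> v \<in> V \<Longrightarrow> cmod (x v) \<le> ell2_norm V x"
  using ell2_finite_sum[of x V "{v}"] by simp

lemma ell2_norm_nonneg: "0 \<le> ell2_norm V x"
  unfolding ell2_norm_def by (intro real_sqrt_ge_zero infsum_nonneg) auto

lemma ell2I:
  assumes "\<And>F. finite F \<Longrightarrow> F \<subseteq> V \<Longrightarrow> L2_set (\<lambda>v. cmod (x v)) F \<le> c"
  shows "x \<in> ell2 V" "ell2_norm V x \<le> c"
proof -
  have c: "0 \<le> c" using assms[of "{}"] by simp
  have bd: "(\<Sum>v\<in>F. (cmod (x v))\<^sup>2) \<le> c\<^sup>2" if "finite F" "F \<subseteq> V" for F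
    using assms[OF that] c by (simp add: L2_set_le_iff)
  have sum: "(\<lambda>v. (cmod (x v))\<^sup>2) summable_on V"
    by (rule nonneg_bdd_above_summable_on) (auto simp: bdd_above_def intro!: exI[of _ "c\<^sup>2"] bd)
  then show "x \<in> ell2 V" by (simp add: ell2_def)
  have "(\<Sum>\<^sub>\<infinity>v\<in>V. (cmod (x v))\<^sup>2) \<le> c\<^sup>2"
    by (rule infsum_le_finite_sums[OF sum]) (use bd in auto)
  then show "ell2_norm V x \<le> c"
    unfolding ell2_norm_def using c by (simp add: real_le_lsqrt)
qed

lemma ell2_scale:
  assumes "x \<in> ell2 V"
  shows "(\<lambda>v. a * x v) \<in> ell2 V" "ell2_norm V (\<lambda>v. a * x v) = cmod a * ell2_norm V x"
proof -
  have eq: "(cmod (a * x v))\<^sup>2 = (cmod a)\<^sup>2 * (cmod (x v))\<^sup>2" for v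
    by (simp add: norm_mult power_mult_distrib)
  show "(\<lambda>v. a * x v) \<in> ell2 V"
    using assms by (simp add: ell2_def eq summable_on_cmult_right)
  show "ell2_norm V (\<lambda>v. a * x v) = cmod a * ell2_norm V x"
    unfolding ell2_norm_def eq infsum_cmult_right' by (simp add: real_sqrt_mult)
qed

lemma mat_vec_scale: "mat_vec V A (\<lambda>v. a * x v) = (\<lambda>u. a * mat_vec V A x u)"
proof
  fix u
  show "mat_vec V A (\<lambda>v. a * x v) u = a * mat_vec V A x u"
    unfolding mat_vec_def infsum_cmult_right'[symmetric] by (simp only: mult.left_commute)
qed

lemma op_norm_bound:
  assumes A: "bounded_on_ell2 V A" and x: "x \<in> ell2 V"
  shows "ell2_norm V (mat_vec V A x) \<le> op_norm V A * ell2_norm V x"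
proof -
  obtain K where K: "\<And>x. x \<in> ell2 V \<Longrightarrow> ell2_norm V (mat_vec V A x) \<le> K * ell2_norm V x"
    using A unfolding bounded_on_ell2_def by blast
  have mem: "mat_vec V A x \<in> ell2 V" using A x unfolding bounded_on_ell2_def by blast
  show ?thesis
  proof (cases "ell2_norm V x = 0")
    case True
    then show ?thesis using K[OF x] by simp
  next
    case False
    then have pos: "0 < ell2_norm V x" using ell2_norm_nonneg[of V x] by linarith
    define a where "a = complex_of_real (1 / ell2_norm V x)"
    have bdd: "bdd_above ((\<lambda>x. ell2_norm V (mat_vec V A x)) ` {x \<in> ell2 V. ell2_norm V x \<le> 1})"
    proof (rule bdd_aboveI2)
      fix y assume y: "y \<in> {x \<in> ell2 V. ell2_norm V x \<le> 1}"
      have "ell2_norm V (mat_vec V A y) \<le> K * ell2_norm V y" using K y by blast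
      also have "\<dots> \<le> \<bar>K\<bar> * 1"
        using y ell2_norm_nonneg[of V y] by (intro mult_mono) auto
      finally show "ell2_norm V (mat_vec V A y) \<le> \<bar>K\<bar> * 1" .
    qed
    have "ell2_norm V (mat_vec V A (\<lambda>v. a * x v)) \<le> op_norm V A"
      unfolding op_norm_def
      by (rule cSUP_upper[OF _ bdd]) (use ell2_scale[OF x, of a] pos in \<open>simp add: a_def norm_divide\<close>)
    then have "cmod a * ell2_norm V (mat_vec V A x) \<le> op_norm V A"
      by (simp add: mat_vec_scale ell2_scale(2)[OF mem])
    then show ?thesis using pos by (simp add: a_def norm_divide field_simps)
  qed
qed

text \<open>Extending \<open>z\<close> by zero turns every unconditional sum into a finite one. In
  this form the operator norm can be applied to powers of the matrix without first placing their
  columns in ell2.\<close>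

lemma op_norm_finite:
  assumes A: "bounded_on_ell2 V A" and S: "finite S" "S \<subseteq> V" and T: "finite T" "T \<subseteq> V"
  shows "L2_set (\<lambda>x. cmod (\<Sum>t\<in>T. A x t * z t)) S \<le> op_norm V A * L2_set (\<lambda>t. cmod (z t)) T"
proof -
  define y where "y = (\<lambda>t. if t \<in> T then z t else 0)"
  have sum: "(\<Sum>\<^sub>\<infinity>t\<in>V. g t) = (\<Sum>t\<in>T. g t)" if "\<And>t. t \<notin> T \<Longrightarrow> g t = 0"
    for g :: "'a \<Rightarrow> 'b :: {topological_comm_monoid_add, t2_space}"
  proof -
    have "(\<Sum>\<^sub>\<infinity>t\<in>V. g t) = (\<Sum>\<^sub>\<infinity>t\<in>T. g t)"
      by (rule infsum_cong_neutral) (use that T in auto)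
    then show ?thesis using T by simp
  qed
  have "L2_set (\<lambda>v. cmod (y v)) F \<le> L2_set (\<lambda>t. cmod (z t)) T" if "finite F" for F
  proof -
    have "(\<Sum>v\<in>F. (cmod (y v))\<^sup>2) = (\<Sum>v\<in>F \<inter> T. (cmod (z v))\<^sup>2)"
      by (rule sum.mono_neutral_cong_right) (use that in \<open>auto simp: y_def\<close>)
    also have "\<dots> \<le> (\<Sum>v\<in>T. (cmod (z v))\<^sup>2)" by (rule sum_mono2) (use T in auto)
    finally show ?thesis unfolding L2_set_def by simp
  qed
  then have y: "y \<in> ell2 V" "ell2_norm V y \<le> L2_set (\<lambda>t. cmod (z t)) T"
    using ell2I[of V y "L2_set (\<lambda>t. cmod (z t)) T"] by blast+
  have mv: "mat_vec V A y x = (\<Sum>t\<in>T. A x t * z t)" for x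
  proof -
    have "mat_vec V A y x = (\<Sum>t\<in>T. A x t * y t)"
      unfolding mat_vec_def by (rule sum) (simp add: y_def)
    then show ?thesis by (simp add: y_def)
  qed
  have "L2_set (\<lambda>x. cmod (\<Sum>t\<in>T. A x t * z t)) S = L2_set (\<lambda>x. cmod (mat_vec V A y x)) S"
    by (simp add: mv)
  also have "\<dots> \<le> ell2_norm V (mat_vec V A y)"
    by (rule ell2_finite_sum) (use A y S in \<open>auto simp: bounded_on_ell2_def\<close>)
  also have "\<dots> \<le> op_norm V A * ell2_norm V y" by (rule op_norm_bound[OF A y(1)])
  also have "\<dots> \<le> op_norm V A * L2_set (\<lambda>t. cmod (z t)) T"
  proof (rule mult_left_mono[OF y(2)])
    show "0 \<le> op_norm V A"
    proof (rule ccontr)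
      \<comment> \<open>A real supremum has no sign by itself. A negative value would force every
        ell2 norm to vanish, and then the supremum is taken over zeros only.\<close>
      assume neg: "\<not> 0 \<le> op_norm V A"
      have "0 \<le> op_norm V A * ell2_norm V x" if "x \<in> ell2 V" for x
        using op_norm_bound[OF A that] ell2_norm_nonneg[of V "mat_vec V A x"] by linarith
      then have zero: "ell2_norm V x = 0" if "x \<in> ell2 V" for x
        using that neg ell2_norm_nonneg[of V x] by (metis linorder_not_le mult_neg_pos order_le_less)
      have "op_norm V A = (SUP x\<in>{x \<in> ell2 V. ell2_norm V x \<le> 1}. 0)"
        unfolding op_norm_def
        by (rule SUP_cong) (use A in \<open>auto simp: bounded_on_ell2_def intro!: zero\<close>)
      also have "\<dots> = 0" using y(1) zero[OF y(1)] by (intro cSUP_const) auto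
      finally show False using neg by simp
    qed
  qed
  finally show ?thesis .
qed

lemma entry_le_op_norm:
  assumes "bounded_on_ell2 V A" "u \<in> V" "v \<in> V"
  shows "cmod (A u v) \<le> op_norm V A"
  using op_norm_finite[OF assms(1), of "{u}" "{v}" "\<lambda>_. 1"] assms by simp

text \<open>With rows restricted to a finite \<open>S\<close> and columns to a finite
  \<open>F\<close> the finite Schur test applies; its bound is independent of both and survives the
  limit over \<open>F\<close>, after which \<open>ell2I\<close> removes \<open>S\<close>.\<close>

lemma schur_bounded:
  assumes A: "\<And>u v. u \<in> V \<Longrightarrow> v \<in> V \<Longrightarrow> cmod (A u v) \<le> k u v"
    and rows: "\<And>u F. u \<in> V \<Longrightarrow> finite F \<Longrightarrow> F \<subseteq> V \<Longrightarrow> (\<Sum>v\<in>F. k u v) \<le> c"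
    and cols: "\<And>v F. v \<in> V \<Longrightarrow> finite F \<Longrightarrow> F \<subseteq> V \<Longrightarrow> (\<Sum>u\<in>F. k u v) \<le> c"
    and c: "0 \<le> c"
  shows "bounded_on_ell2 V A" "op_norm V A \<le> c"
proof -
  have k: "0 \<le> k u v" if "u \<in> V" "v \<in> V" for u v
    using A[OF that] norm_ge_zero[of "A u v"] by linarith
  have summable: "(\<lambda>v. A u v * x v) summable_on V" if x: "x \<in> ell2 V" and u: "u \<in> V" for x u
  proof (rule abs_summable_bound(1))
    fix F assume F: "finite F" "F \<subseteq> V"
    have "(\<Sum>v\<in>F. cmod (A u v * x v)) \<le> (\<Sum>v\<in>F. k u v * ell2_norm V x)"
      unfolding norm_mult using F u x
      by (intro sum_mono mult_mono A ell2_entry k) (auto intro: ell2_norm_nonneg)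
    also have "\<dots> \<le> c * ell2_norm V x"
      unfolding sum_distrib_right[symmetric] by (intro mult_right_mono rows u F ell2_norm_nonneg)
    finally show "(\<Sum>v\<in>F. cmod (A u v * x v)) \<le> c * ell2_norm V x" .
  qed
  have bound: "L2_set (\<lambda>u. cmod (mat_vec V A x u)) S \<le> c * ell2_norm V x"
    if x: "x \<in> ell2 V" and S: "finite S" "S \<subseteq> V" for x S
  proof -
    have lim: "((\<lambda>F. \<Sum>v\<in>F. A u v * x v) \<longlongrightarrow> mat_vec V A x u) (finite_subsets_at_top V)" if "u \<in> S" for u
      unfolding mat_vec_def by (rule infsum_tendsto[OF summable]) (use that x S in auto)
    have "((\<lambda>F. L2_set (\<lambda>u. cmod (\<Sum>v\<in>F. A u v * x v)) S)
        \<longlongrightarrow> L2_set (\<lambda>u. cmod (mat_vec V A x u)) S) (finite_subsets_at_top V)"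
      unfolding L2_set_def by (intro tendsto_intros lim)
    moreover have "\<forall>\<^sub>F F in finite_subsets_at_top V.
        L2_set (\<lambda>u. cmod (\<Sum>v\<in>F. A u v * x v)) S \<le> c * ell2_norm V x"
    proof (rule eventually_finite_subsets_at_top_weakI)
      fix F assume F: "finite F" "F \<subseteq> V"
      have "L2_set (\<lambda>u. cmod (\<Sum>v\<in>F. A u v * x v)) S \<le> L2_set (\<lambda>u. \<Sum>v\<in>F. k u v * cmod (x v)) S"
      proof (rule L2_set_mono)
        fix u assume u: "u \<in> S"
        show "cmod (\<Sum>v\<in>F. A u v * x v) \<le> (\<Sum>v\<in>F. k u v * cmod (x v))"
        proof (rule sum_norm_le)
          fix v assume "v \<in> F"
          then show "cmod (A u v * x v) \<le> k u v * cmod (x v)"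
            unfolding norm_mult using u F S by (intro mult_right_mono A) auto
        qed
      qed simp
      also have "\<dots> \<le> c * L2_set (\<lambda>v. cmod (x v)) F"
        by (rule schur_test) (use F S k rows cols c in auto)
      also have "\<dots> \<le> c * ell2_norm V x"
        by (intro mult_left_mono ell2_finite_sum x F c)
      finally show "L2_set (\<lambda>u. cmod (\<Sum>v\<in>F. A u v * x v)) S \<le> c * ell2_norm V x" .
    qed
    ultimately show ?thesis
      by (rule tendsto_upperbound) simp
  qed
  from ell2I[OF bound] have mv: "mat_vec V A x \<in> ell2 V" "ell2_norm V (mat_vec V A x) \<le> c * ell2_norm V x"
    if "x \<in> ell2 V" for x using that by blast+
  then show "bounded_on_ell2 V A"
    unfolding bounded_on_ell2_def using summable by blast
  show "op_norm V A \<le> c"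
    unfolding op_norm_def
  proof (rule cSUP_least)
    have "(\<lambda>_. 0) \<in> {x \<in> ell2 V. ell2_norm V x \<le> 1}"
      by (simp add: ell2_def ell2_norm_def)
    then show "{x \<in> ell2 V. ell2_norm V x \<le> 1} \<noteq> {}" by blast
    fix x assume x: "x \<in> {x \<in> ell2 V. ell2_norm V x \<le> 1}"
    then have "ell2_norm V (mat_vec V A x) \<le> c * ell2_norm V x" using mv by blast
    also have "\<dots> \<le> c * 1" using x c by (intro mult_left_mono) auto
    finally show "ell2_norm V (mat_vec V A x) \<le> c" by simp
  qed
qed

section \<open>Graphs\<close>

lemma relpow_sym: "sym E \<Longrightarrow> (u, v) \<in> E ^^ n \<Longrightarrow> (v, u) \<in> E ^^ n"
proof (induction n arbitrary: u v)
  case (Suc n)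
  from Suc.prems(2) obtain w where "(u, w) \<in> E ^^ n" "(w, v) \<in> E" by auto
  then show ?case using Suc.IH[OF Suc.prems(1)] symD[OF Suc.prems(1)] by (meson relpow_Suc_I2)
qed simp

context
  fixes V :: "'v set" and E :: "('v \<times> 'v) set"
  assumes G: "connected_simple_graph V E"
begin

lemma walk_gdist: "u \<in> V \<Longrightarrow> v \<in> V \<Longrightarrow> (u, v) \<in> E ^^ gdist E u v"
proof -
  assume "u \<in> V" "v \<in> V"
  then have "(u, v) \<in> E\<^sup>*" using G by (simp add: connected_simple_graph_def)
  then show ?thesis unfolding gdist_def by (metis LeastI rtrancl_imp_relpow)
qed

lemma gdist_le: "(u, v) \<in> E ^^ n \<Longrightarrow> gdist E u v \<le> n"
  unfolding gdist_def by (rule Least_le)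

lemma gdist_self: "gdist E u u = 0"
  using gdist_le[of u u 0] by simp

lemma gdist_sym:
  assumes "u \<in> V" "v \<in> V"
  shows "gdist E u v = gdist E v u"
proof -
  have "sym E" using G by (simp add: connected_simple_graph_def)
  then show ?thesis
    using walk_gdist[OF assms] walk_gdist[OF assms(2,1)] by (meson antisym gdist_le relpow_sym)
qed

lemma gdist_triangle:
  assumes "u \<in> V" "v \<in> V" "w \<in> V"
  shows "gdist E u w \<le> gdist E u v + gdist E v w"
  by (rule gdist_le) (use walk_gdist assms in \<open>auto simp: relpow_add\<close>)

text \<open>The vertices of a shortest walk realise every intermediate distance; the induction walks
  back from its far end. The purpose is a linear lower bound for balls, and with it
  \<open>1 \<le> d\<close>.\<close>

lemma sphere_nonempty:
  assumes "u \<in> V" "v \<in> V" "i \<le> gdist E u v"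
  shows "\<exists>w\<in>V. gdist E u w = i"
proof -
  have "\<exists>w\<in>V. gdist E u w = n - j" if "v \<in> V" "gdist E u v = n" "j \<le> n" for n j
    using that(3)
  proof (induction j)
    case 0
    then show ?case using that by auto
  next
    case (Suc j)
    then obtain w where w: "w \<in> V" "gdist E u w = n - j" by auto
    then obtain m where m: "n - j = Suc m" using Suc.prems by (cases "n - j") auto
    have "(u, w) \<in> E ^^ Suc m" using walk_gdist[OF assms(1) w(1)] w(2) m by simp
    then obtain x where x: "(u, x) \<in> E ^^ m" "(x, w) \<in> E" by auto
    then have xV: "x \<in> V" using G by (auto simp: connected_simple_graph_def)
    have "(x, w) \<in> E ^^ 1" using x by simp
    then have "Suc m \<le> gdist E u x + 1"
      using gdist_triangle[OF assms(1) xV w(1)] gdist_le[of x w 1] w m by simp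
    with gdist_le[OF x(1)] have "gdist E u x = m" by simp
    then show ?case using xV m by (intro bexI[of _ x]) auto
  qed
  from this[of "gdist E u v" "gdist E u v - i"] assms show ?thesis by auto
qed

lemma gball_nat: "gball V E u (real R) = {v \<in> V. gdist E u v \<le> R}"
  by (simp add: gball_def)

lemma finite_gball:
  assumes "polynomial_growth V E" "u \<in> V" "0 \<le> R"
  shows "finite (gball V E u R)"
proof -
  obtain d D where "emeasure (count_space V) (gball V E u R) \<le> ennreal (D * (R + 1) powr d)"
    using assms unfolding polynomial_growth_def growth_exponents_def by auto
  then have "emeasure (count_space V) (gball V E u R) < top"
    by (auto intro: le_less_trans)
  then show ?thesis
    by (rule_tac ccontr) (auto simp: gball_def emeasure_count_space)
qed

text \<open>Polynomial growth makes balls finite, so an infinite graph has infinite diameter and the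
  normality bounds hold at all radii. Spheres are then nonempty, balls have at least
  \<open>R + 1\<close> vertices, and a dimension below 1 is impossible.\<close>

lemma infinite_normal_growth:
  assumes inf: "infinite V" and pg: "polynomial_growth V E" and nc: "normal_counting_measure V E"
  shows "\<exists>D1 D2. normal_growth V (gdist E) (beurling_dim V E) D1 D2"
proof -
  define d where "d = beurling_dim V E"
  obtain u0 where u0: "u0 \<in> V" using infinite_imp_nonempty[OF inf] by blast
  have far: "\<exists>v\<in>V. n < gdist E u v" if "u \<in> V" for u n
  proof (rule ccontr)
    assume "\<not> ?thesis"
    then have "V = gball V E u (real n)" by (auto simp: gball_def not_less)
    then show False using finite_gball[OF pg that, of "real n"] inf by simp
  qed
  have diam: "ereal R \<le> gdiam V E" for R
  proof -
    obtain v where v: "v \<in> V" "nat \<lceil>R\<rceil> < gdist E u0 v" using far[OF u0] by blast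
    then have "R \<le> real (gdist E u0 v)" by linarith
    then have "ereal R \<le> ereal (real (gdist E u0 v))" by simp
    also have "\<dots> \<le> gdiam V E"
      unfolding gdiam_def using u0 v by (intro SUP_upper2[of u0] SUP_upper) auto
    finally show ?thesis .
  qed
  obtain D1 D2 where D: "0 < D1" "0 < D2"
    and le: "\<And>u R. u \<in> V \<Longrightarrow> 0 \<le> R \<Longrightarrow> emeasure (count_space V) (gball V E u R) \<le> ennreal (D1 * (R + 1) powr d)"
    and ge: "\<And>u R. u \<in> V \<Longrightarrow> 0 \<le> R \<Longrightarrow> ennreal (D2 * (R + 1) powr d) \<le> emeasure (count_space V) (gball V E u R)"
    using nc diam unfolding normal_counting_measure_def d_def by blast
  have em: "emeasure (count_space V) (gball V E u (real R)) = ennreal (real (card {v \<in> V. gdist E u v \<le> R}))"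
    if "u \<in> V" for u R
    using finite_gball[OF pg that, of "real R"] unfolding gball_nat
    by (subst emeasure_count_space_finite) (auto simp: ennreal_of_nat_eq_real_of_nat)
  have le': "real (card {v \<in> V. gdist E u v \<le> R}) \<le> D1 * (real R + 1) powr d" if "u \<in> V" for u R
    using le[OF that, of "real R"] D unfolding em[OF that] by simp
  have ge': "D2 * (real R + 1) powr d \<le> real (card {v \<in> V. gdist E u v \<le> R})" if "u \<in> V" for u R
    using ge[OF that, of "real R"] D unfolding em[OF that] by simp
  have "1 \<le> d"
  proof (rule ccontr)
    assume "\<not> 1 \<le> d"
    then have d: "0 < 1 - d" by simp
    have "real R + 1 \<le> D1 * (real R + 1) powr d" for R
    proof -
      have fin: "finite {v \<in> V. gdist E u0 v \<le> R}"
        using finite_gball[OF pg u0, of "real R"] by (simp add: gball_nat)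
      obtain v where v: "v \<in> V" "R < gdist E u0 v" using far[OF u0] by blast
      have "{..R} \<subseteq> gdist E u0 ` {v \<in> V. gdist E u0 v \<le> R}"
      proof
        fix i assume i: "i \<in> {..R}"
        then obtain w where "w \<in> V" "gdist E u0 w = i"
          using sphere_nonempty[OF u0 v(1), of i] v(2) by auto
        then show "i \<in> gdist E u0 ` {v \<in> V. gdist E u0 v \<le> R}" using i by force
      qed
      then have "card {..R} \<le> card {v \<in> V. gdist E u0 v \<le> R}"
        by (rule surj_card_le[OF fin])
      then have "real (Suc R) \<le> real (card {v \<in> V. gdist E u0 v \<le> R})"
        by (simp only: of_nat_le_iff card_atMost)
      then show ?thesis using le'[OF u0, of R] by simp
    qed
    then have bound: "(real R + 1) powr (1 - d) \<le> D1" for R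
    proof -
      have "(real R + 1) powr d * (real R + 1) powr (1 - d) \<le> (real R + 1) powr d * D1"
        using \<open>\<And>R. real R + 1 \<le> D1 * (real R + 1) powr d\<close>[of R]
        by (simp add: mult.commute flip: powr_add)
      then show ?thesis by simp
    qed
    \<comment> \<open>Chosen so that \<open>(R + 1) powr (1 - d)\<close> exceeds
      \<open>D1\<close>.\<close>
    obtain R :: nat where R: "(D1 + 1) powr (1 / (1 - d)) \<le> real R" using real_arch_simple by blast
    have "((D1 + 1) powr (1 / (1 - d))) powr (1 - d) \<le> (real R + 1) powr (1 - d)"
      using R d by (intro powr_mono2) auto
    then have "D1 + 1 \<le> (real R + 1) powr (1 - d)" using d D by (simp add: powr_powr)
    with bound[of R] show False by simp
  qed
  then have "normal_growth V (gdist E) d D1 D2"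
    using D le' ge' finite_gball[OF pg, of _ "real _"] unfolding gball_nat
    by unfold_locales (auto simp: gdist_self gdist_sym gdist_triangle)
  then show ?thesis unfolding d_def by blast
qed

text \<open>The number of vertices serves as growth constant for every positive exponent, so the
  infimum runs over all positive reals.\<close>

lemma finite_beurling_dim:
  assumes fin: "finite V"
  shows "beurling_dim V E = 0"
proof -
  have "V \<noteq> {}" using G by (simp add: connected_simple_graph_def)
  then have c: "0 < real (card V)" using fin by (simp add: card_gt_0_iff)
  have "growth_exponents V E = {0<..}"
  proof (intro equalityI subsetI)
    fix d :: real assume "d \<in> {0<..}"
    then have d: "0 < d" by simp
    have "emeasure (count_space V) (gball V E u R) \<le> ennreal (real (card V) * (R + 1) powr d)"
      if "0 \<le> R" for u R
    proof -
      have "gball V E u R \<subseteq> V" by (auto simp: gball_def)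
      then have "emeasure (count_space V) (gball V E u R) = ennreal (real (card (gball V E u R)))"
        using finite_subset[OF _ fin]
        by (subst emeasure_count_space_finite) (auto simp: ennreal_of_nat_eq_real_of_nat)
      also have "\<dots> \<le> ennreal (real (card V) * (R + 1) powr d)"
      proof (rule ennreal_leI)
        have "real (card (gball V E u R)) \<le> real (card V)"
          using fin \<open>gball V E u R \<subseteq> V\<close> by (simp add: card_mono)
        also have "\<dots> \<le> real (card V) * (R + 1) powr d"
          using that d c mult_left_mono[of 1 "(R + 1) powr d" "real (card V)"]
          by (simp add: ge_one_powr_ge_zero)
        finally show "real (card (gball V E u R)) \<le> real (card V) * (R + 1) powr d" .
      qed
      finally show ?thesis .
    qed
    then show "d \<in> growth_exponents V E"
      unfolding growth_exponents_def using d c by blast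
  qed (auto simp: growth_exponents_def)
  then show ?thesis by (simp add: beurling_dim_def)
qed

end

section \<open>The cutoff radius\<close>

text \<open>\<open>k\<close> is \<open>1 / r'\<close> and \<open>1 - k\<close> is
  \<open>1 / r\<close>. Stated linearly, this spares later arguments the separate endpoints
  \<open>r = 1\<close> and \<open>r = \<infinity>\<close>.\<close>

lemma over_conj_exponent:
  assumes "1 \<le> r"
  obtains k where "0 \<le> k" "k \<le> 1" "\<And>t. over t (conj_exponent r) = t * k" "\<And>t. over t r = t * (1 - k)"
  using assms
proof (cases rule: exponent_cases)
  case 1
  have "over t (conj_exponent r) = t * 1" "over t r = t * (1 - 1)" for t
    using 1 by (simp_all add: conj_exponent_def over_def one_ereal_def)
  then show ?thesis by (intro that[of 1]) auto
next
  case (2 p)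
  have "over t r = t * (1 - (1 - 1 / p))" for t using 2 by (simp add: over_ereal)
  moreover have "over t (conj_exponent r) = t * (1 - 1 / p)" for t
  proof (cases "p = 1")
    case True
    then show ?thesis using 2 by (simp add: conj_exponent_one over_infinity flip: one_ereal_def)
  next
    case False
    then show ?thesis using 2 by (simp add: conj_exponent_ereal over_ereal field_simps)
  qed
  ultimately show ?thesis using 2 by (intro that[of "1 - 1 / p"]) auto
qed

text \<open>The lower bound \<open>a\<close> turns the additive loss of rounding into a constant
  factor.\<close>

lemma nat_ceiling_bounds:
  assumes "0 < a" "a \<le> x"
  shows "1 \<le> nat \<lceil>x\<rceil>" "x \<le> real (nat \<lceil>x\<rceil>)" "real (nat \<lceil>x\<rceil>) \<le> (1 + 1 / a) * x"
proof -
  have x: "0 < x" using assms by simp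
  show "1 \<le> nat \<lceil>x\<rceil>" using x by linarith
  show "x \<le> real (nat \<lceil>x\<rceil>)" by linarith
  have "real (nat \<lceil>x\<rceil>) \<le> x + 1" using x by linarith
  also have "1 \<le> 1 / a * x" using assms by (simp add: field_simps)
  finally show "real (nat \<lceil>x\<rceil>) \<le> (1 + 1 / a) * x" by (simp add: algebra_simps)
qed

text \<open>The radius is \<open>M powr (1 / m)\<close> with \<open>m = min s 1\<close>. The
  summands decay like \<open>(j + 1) powr - s\<close>, so their sum is of order
  \<open>N powr (1 - m)\<close>: growing for \<open>s < 1\<close>, bounded for \<open>s > 1\<close>.
  Since \<open>M \<le> N powr m\<close>, the product is at most of order \<open>N\<close>.\<close>

lemma choose_radius_noncritical:
  fixes g s d m0 K :: real
  assumes s: "0 < s" "s \<noteq> 1" and g: "g = d + s" "0 \<le> g" and m0: "0 < m0" and K: "0 < K"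
  shows "\<exists>B0>0. \<exists>C>0. \<forall>h H M. (\<forall>j. 0 \<le> h j) \<longrightarrow> 0 \<le> H \<longrightarrow>
    (\<forall>j. h j \<le> K * H * (real j + 1) powr - g) \<longrightarrow> m0 \<le> M \<longrightarrow>
    (\<exists>N\<ge>1. M * (\<Sum>j\<le>N. h j * (real j + 1) powr d) \<le> B0 * H * real N \<and>
      M \<le> B0 * real N powr s \<and> real N powr g \<le> C * M powr (g / min s 1))"
proof -
  define m where "m = min s 1"
  have m: "0 < m" "m \<le> s" "m \<le> 1" using s by (auto simp: m_def)
  obtain P where P: "0 < P" "\<And>N. 1 \<le> N \<Longrightarrow> (\<Sum>j\<le>N. (real j + 1) powr - s) \<le> P * real N powr (1 - m)"
  proof (cases "s < 1")
    case True
    have "(\<Sum>j\<le>N. (real j + 1) powr - s) \<le> 2 powr (1 - s) / (1 - s) * real N powr (1 - m)" if "1 \<le> N" for N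
    proof -
      have "(\<Sum>j\<le>N. (real j + 1) powr - s) \<le> (real N + 1) powr (1 - s) / (1 - s)"
        by (rule sum_powr_le) (use s True in auto)
      also have "\<dots> \<le> (2 * real N) powr (1 - s) / (1 - s)"
        using True that by (intro divide_right_mono powr_mono2) auto
      finally show ?thesis using True by (simp add: m_def powr_mult)
    qed
    then show ?thesis using True by (intro that[of "2 powr (1 - s) / (1 - s)"]) auto
  next
    case False
    then have s1: "0 < s - 1" using s by simp
    have "(\<Sum>j\<le>N. (real j + 1) powr - s) \<le> 2 powr s / (s - 1) * real N powr (1 - m)" if "1 \<le> N" for N
    proof -
      have "(\<Sum>j<Suc N. (1 + real j) powr (- (s - 1) - 1)) \<le> 2 powr (s - 1 + 1) / (s - 1) * 1 powr - (s - 1)"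
        by (rule sum_powr_tail[OF s1]) simp
      then show ?thesis using False that
        by (simp add: m_def lessThan_Suc_atMost add.commute del: sum.lessThan_Suc)
    qed
    then show ?thesis using s1 by (intro that[of "2 powr s / (s - 1)"]) auto
  qed
  define a where "a = m0 powr (1 / m)"
  have a: "0 < a" using m0 by (simp add: a_def)
  have "\<exists>N\<ge>1. M * (\<Sum>j\<le>N. h j * (real j + 1) powr d) \<le> (K * P + 1) * H * real N \<and>
      M \<le> (K * P + 1) * real N powr s \<and> real N powr g \<le> (1 + 1 / a) powr g * M powr (g / m)"
    if h: "\<forall>j. 0 \<le> h j" "\<forall>j. h j \<le> K * H * (real j + 1) powr - g" and H: "0 \<le> H" and M: "m0 \<le> M" for h H M
  proof -
    define N where "N = nat \<lceil>M powr (1 / m)\<rceil>"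
    have "a \<le> M powr (1 / m)" unfolding a_def using m m0 M by (intro powr_mono2) auto
    note N = nat_ceiling_bounds[OF a this, folded N_def]
    have "(M powr (1 / m)) powr m \<le> real N powr m" using N m by (intro powr_mono2) auto
    then have MN: "M \<le> real N powr m" using m m0 M by (simp add: powr_powr)
    have "real N powr m \<le> real N powr s" using N(1) m by (intro powr_mono) auto
    then have "M \<le> 1 * real N powr s" using MN by simp
    also have "\<dots> \<le> (K * P + 1) * real N powr s" using K P by (intro mult_right_mono) auto
    finally have 2: "M \<le> (K * P + 1) * real N powr s" .
    have "(\<Sum>j\<le>N. h j * (real j + 1) powr d) \<le> (\<Sum>j\<le>N. K * H * (real j + 1) powr - s)"
    proof (rule sum_mono)
      fix j
      have "h j * (real j + 1) powr d \<le> K * H * (real j + 1) powr - g * (real j + 1) powr d"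
        using h by (intro mult_right_mono) auto
      also have "\<dots> = K * H * (real j + 1) powr - s"
        by (simp add: g mult.assoc flip: powr_add)
      finally show "h j * (real j + 1) powr d \<le> K * H * (real j + 1) powr - s" .
    qed
    also have "\<dots> \<le> K * H * (P * real N powr (1 - m))"
      unfolding sum_distrib_left[symmetric] using K H N(1) by (intro mult_left_mono P) auto
    finally have "M * (\<Sum>j\<le>N. h j * (real j + 1) powr d) \<le> real N powr m * (K * H * (P * real N powr (1 - m)))"
      using MN m0 M h by (intro mult_mono sum_nonneg) auto
    also have "\<dots> = K * P * H * (real N powr m * real N powr (1 - m))" by (simp add: mult_ac)
    also have "real N powr m * real N powr (1 - m) = real N" using N(1) by (simp flip: powr_add)
    also have "K * P * H * real N \<le> (K * P + 1) * H * real N"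
      using H by (intro mult_right_mono) auto
    finally have 1: "M * (\<Sum>j\<le>N. h j * (real j + 1) powr d) \<le> (K * P + 1) * H * real N" .
    have "real N powr g \<le> ((1 + 1 / a) * M powr (1 / m)) powr g"
      using N g by (intro powr_mono2) auto
    also have "\<dots> = (1 + 1 / a) powr g * M powr (g / m)"
      by (simp add: powr_mult powr_powr)
    finally show ?thesis using 1 2 N(1) by blast
  qed
  moreover have "0 < K * P + 1" using K P(1) by (simp add: add_pos_pos)
  moreover have "0 < (1 + 1 / a) powr g"
  proof -
    have "0 < 1 + 1 / a" using a by (simp add: add_pos_pos)
    then show ?thesis by simp
  qed
  ultimately show ?thesis unfolding m_def by blast
qed

text \<open>Now the sum grows like the k-th power of \<open>ln N\<close>, and the radius is
  \<open>M * ln (M + 1) powr k\<close>. This radius is still polynomially bounded in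
  \<open>M\<close>, so \<open>ln N\<close> is of order \<open>ln (M + 1)\<close> and the choice is
  consistent.\<close>

lemma choose_radius_critical:
  fixes g k d m0 :: real
  assumes k: "0 \<le> k" "k \<le> 1" and g: "0 \<le> g" and m0: "0 < m0"
  shows "\<exists>B0>0. \<exists>C>0. \<forall>h H M. (\<forall>j. 0 \<le> h j) \<longrightarrow> 0 \<le> H \<longrightarrow>
    (\<forall>N. (\<Sum>j\<le>N. h j * (real j + 1) powr d) \<le> H * (\<Sum>j\<le>N. 1 / (real j + 1)) powr k) \<longrightarrow> m0 \<le> M \<longrightarrow>
    (\<exists>N\<ge>1. M * (\<Sum>j\<le>N. h j * (real j + 1) powr d) \<le> B0 * H * real N \<and>
      M \<le> B0 * real N \<and> real N powr g \<le> C * (M powr g * ln (M + 1) powr (g * k)))"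
proof -
  define l0 where "l0 = ln (m0 + 1)"
  have l0: "0 < l0" using m0 by (simp add: l0_def)
  \<comment> \<open>The radius below satisfies \<open>1 + ln (N + 1) \<le> 2 + 2 * l\<close> with
    \<open>l = ln (M + 1) \<ge> l0\<close>; the constant 2 is absorbed as
    \<open>2 / l0 * l\<close>.\<close>
  define c where "c = 2 / l0 + 2"
  have c: "1 \<le> c" using l0 by (simp add: c_def)
  define a where "a = m0 * l0 powr k"
  have a: "0 < a" using m0 l0 by (simp add: a_def)
  define B0 where "B0 = c + l0 powr - k"
  have B0: "0 < B0" "c \<le> B0" "l0 powr - k \<le> B0" using c l0 by (auto simp: B0_def add_pos_nonneg)
  have "\<exists>N\<ge>1. M * (\<Sum>j\<le>N. h j * (real j + 1) powr d) \<le> B0 * H * real N \<and>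
      M \<le> B0 * real N \<and> real N powr g \<le> (1 + 1 / a) powr g * (M powr g * ln (M + 1) powr (g * k))"
    if h: "\<forall>j. 0 \<le> h j" and H: "0 \<le> H" and M: "m0 \<le> M"
      and hsum: "\<forall>N. (\<Sum>j\<le>N. h j * (real j + 1) powr d) \<le> H * (\<Sum>j\<le>N. 1 / (real j + 1)) powr k" for h H M
  proof -
    define l where "l = ln (M + 1)"
    have l: "l0 \<le> l" unfolding l0_def l_def using m0 M by simp
    have lpos: "0 < l" using l l0 by simp
    have M0: "0 < M" using m0 M by simp
    define N where "N = nat \<lceil>M * l powr k\<rceil>"
    have lk: "l0 powr k \<le> l powr k" using k l l0 by (intro powr_mono2) auto
    then have "a \<le> M * l powr k" unfolding a_def using m0 M by (intro mult_mono) auto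
    note N = nat_ceiling_bounds[OF a this, folded N_def]
    have "M = l0 powr - k * (M * l0 powr k)"
      using l0 by (simp add: powr_minus)
    also have "\<dots> \<le> B0 * (M * l powr k)"
      using B0 lk M0 by (intro mult_mono mult_left_mono) auto
    also have "\<dots> \<le> B0 * real N" using N B0 by (intro mult_left_mono) auto
    finally have 2: "M \<le> B0 * real N" .
    have lnN: "1 + ln (real N + 1) \<le> c * l"
    proof -
      have "l powr k \<le> 1 + M"
      proof (cases "l \<le> 1")
        case True
        then have "l powr k \<le> 1 powr k" using k lpos by (intro powr_mono2) auto
        then show ?thesis using M0 by simp
      next
        case False
        then have "l powr k \<le> l powr 1" using k by (intro powr_mono) auto
        also have "\<dots> \<le> M" unfolding l_def using M0 ln_add_one_self_le_self[of M] lpos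
          by (simp add: add.commute l_def)
        finally show ?thesis by simp
      qed
      then have "M * l powr k \<le> M * (1 + M)" using M0 by (intro mult_left_mono) auto
      moreover have "real N \<le> M * l powr k + 1"
      proof -
        have "0 \<le> M * l powr k" using M0 by simp
        then show ?thesis unfolding N_def by linarith
      qed
      moreover have "2 * (M + 1)\<^sup>2 = 2 * (M * M) + 4 * M + 2" "M * (1 + M) = M + M * M"
        by (simp_all add: power2_eq_square algebra_simps)
      ultimately have "real N + 1 \<le> 2 * (M + 1)\<^sup>2"
        using M0 mult_pos_pos[OF M0 M0] by linarith
      then have "ln (real N + 1) \<le> ln (2 * (M + 1)\<^sup>2)" using M0 by (subst ln_le_cancel_iff) auto
      also have "\<dots> = ln 2 + 2 * l" using M0 by (simp add: ln_mult ln_realpow l_def)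
      also have "ln 2 \<le> (1::real)" using ln_2_less_1 by simp
      finally have "1 + ln (real N + 1) \<le> 2 + 2 * l" by simp
      moreover have "2 \<le> 2 / l0 * l" using l l0 by (simp add: field_simps)
      ultimately show ?thesis by (simp add: c_def distrib_right)
    qed
    have "(\<Sum>j\<le>N. h j * (real j + 1) powr d) \<le> H * (\<Sum>j\<le>N. 1 / (real j + 1)) powr k" using hsum by blast
    also have "\<dots> \<le> H * (c * l powr k)"
    proof (rule mult_left_mono[OF _ H])
      have "(\<Sum>j\<le>N. 1 / (real j + 1)) \<le> c * l" using sum_inverse_le_ln[of N] lnN by linarith
      then have "(\<Sum>j\<le>N. 1 / (real j + 1)) powr k \<le> (c * l) powr k"
        using k by (intro powr_mono2 sum_nonneg) auto
      also have "\<dots> = c powr k * l powr k" by (rule powr_mult)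
      also have "\<dots> \<le> c powr 1 * l powr k"
        using k c by (intro mult_right_mono powr_mono) auto
      finally show "(\<Sum>j\<le>N. 1 / (real j + 1)) powr k \<le> c * l powr k" using c by simp
    qed
    finally have "M * (\<Sum>j\<le>N. h j * (real j + 1) powr d) \<le> M * (H * (c * l powr k))"
      using M0 by (intro mult_left_mono) auto
    also have "\<dots> = c * H * (M * l powr k)" by (simp add: mult_ac)
    also have "\<dots> \<le> B0 * H * real N"
      using B0 N(2) c H M0 by (intro mult_mono) auto
    finally have 1: "M * (\<Sum>j\<le>N. h j * (real j + 1) powr d) \<le> B0 * H * real N" .
    have "real N powr g \<le> ((1 + 1 / a) * (M * l powr k)) powr g"
      using N g by (intro powr_mono2) auto
    also have "\<dots> = (1 + 1 / a) powr g * (M powr g * l powr (g * k))"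
      unfolding powr_mult powr_powr by (simp add: mult.commute)
    finally show ?thesis using 1 2 N(1) unfolding l_def by blast
  qed
  moreover have "0 < (1 + 1 / a) powr g"
  proof -
    have "0 < 1 + 1 / a" using a by (simp add: add_pos_pos)
    then show ?thesis by simp
  qed
  ultimately show ?thesis using B0(1) by blast
qed

lemma choose_radius:
  assumes r: "1 \<le> r" and d: "1 \<le> d" and \<alpha>: "over d (conj_exponent r) < \<alpha>" and m0: "0 < m0"
  shows "\<exists>B0>0. \<exists>C>0. \<forall>h H M. antimono h \<longrightarrow> (\<forall>j. 0 \<le> h j) \<longrightarrow> 0 \<le> H \<longrightarrow> seq_bd r \<alpha> d h H \<longrightarrow> m0 \<le> M \<longrightarrow>
    (\<exists>N\<ge>1. M * (\<Sum>j\<le>N. h j * (real j + 1) powr d) \<le> B0 * H * real N \<and>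
      M \<le> B0 * real N powr (\<alpha> - over d (conj_exponent r)) \<and>
      real N powr (\<alpha> + over d r)
        \<le> C * (M powr ((\<alpha> + over d r) / min (\<alpha> - over d (conj_exponent r)) 1)
          * (if \<alpha> = over d (conj_exponent r) + 1 then ln (M + 1) powr over (d + 1) (conj_exponent r) else 1)))"
proof -
  obtain k where k: "0 \<le> k" "k \<le> 1" "\<And>t. over t (conj_exponent r) = t * k" "\<And>t. over t r = t * (1 - k)"
    using over_conj_exponent[OF r] by blast
  have dk: "0 \<le> d * k" "0 \<le> d * (1 - k)" using d k by auto
  have a0: "0 \<le> \<alpha>" using \<alpha> dk by (simp add: k)
  define s where "s = \<alpha> - over d (conj_exponent r)"
  define g where "g = \<alpha> + over d r"
  have s: "0 < s" using \<alpha> by (simp add: s_def)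
  have g: "g = d + s" "0 \<le> g" using s d by (simp_all add: s_def g_def k algebra_simps)
  show ?thesis
  proof (cases "s = 1")
    case False
    obtain K where K: "0 < K" "\<And>h H. antimono h \<Longrightarrow> \<forall>j. 0 \<le> h j \<Longrightarrow> 0 \<le> H \<Longrightarrow> seq_bd r \<alpha> d h H \<Longrightarrow>
        \<forall>j. h j \<le> K * H * (real j + 1) powr - g"
      using seq_bd_decay[OF r a0 d] unfolding g_def by blast
    have ne: "\<alpha> \<noteq> over d (conj_exponent r) + 1" using False by (auto simp: s_def)
    obtain B0 C where BC: "0 < B0" "0 < C" "\<And>h H M. \<forall>j. 0 \<le> h j \<Longrightarrow> 0 \<le> H \<Longrightarrow>
        \<forall>j. h j \<le> K * H * (real j + 1) powr - g \<Longrightarrow> m0 \<le> M \<Longrightarrow>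
        \<exists>N\<ge>1. M * (\<Sum>j\<le>N. h j * (real j + 1) powr d) \<le> B0 * H * real N \<and>
        M \<le> B0 * real N powr s \<and> real N powr g \<le> C * M powr (g / min s 1)"
      using choose_radius_noncritical[OF s False g m0 K(1)] by blast
    show ?thesis
      unfolding s_def[symmetric] g_def[symmetric]
    proof (rule exI[of _ B0], rule conjI[OF BC(1)], rule exI[of _ C], intro conjI[OF BC(2)] allI impI)
      fix h H M assume "antimono h" "\<forall>j. 0 \<le> h j" "0 \<le> H" "seq_bd r \<alpha> d h H" "m0 \<le> M"
      with BC(3)[OF _ _ K(2)] ne
      show "\<exists>N\<ge>1. M * (\<Sum>j\<le>N. h j * (real j + 1) powr d) \<le> B0 * H * real N \<and>
        M \<le> B0 * real N powr s \<and> real N powr g \<le> C * (M powr (g / min s 1)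
          * (if \<alpha> = over d (conj_exponent r) + 1 then ln (M + 1) powr over (d + 1) (conj_exponent r) else 1))"
        by simp
    qed
  next
    case True
    then have crit: "\<alpha> = over d (conj_exponent r) + 1" by (simp add: s_def)
    obtain B0 C where BC: "0 < B0" "0 < C" "\<And>h H M. \<forall>j. 0 \<le> h j \<Longrightarrow> 0 \<le> H \<Longrightarrow>
        \<forall>N. (\<Sum>j\<le>N. h j * (real j + 1) powr d) \<le> H * (\<Sum>j\<le>N. 1 / (real j + 1)) powr k \<Longrightarrow> m0 \<le> M \<Longrightarrow>
        \<exists>N\<ge>1. M * (\<Sum>j\<le>N. h j * (real j + 1) powr d) \<le> B0 * H * real N \<and>
        M \<le> B0 * real N \<and> real N powr g \<le> C * (M powr g * ln (M + 1) powr (g * k))"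
      using choose_radius_critical[OF k(1,2) g(2) m0, of d] by blast
    \<comment> \<open>At \<open>s = 1\<close> the exponent \<open>g = d + s\<close> is
      \<open>d + 1\<close>; so the power \<open>k\<close> of the logarithm in the radius, raised to
      \<open>g\<close>, becomes \<open>(d + 1) / r'\<close>.\<close>
    have gk: "over (d + 1) (conj_exponent r) = g * k" using g True by (simp add: k)
    show ?thesis
      unfolding s_def[symmetric] g_def[symmetric]
    proof (rule exI[of _ B0], rule conjI[OF BC(1)], rule exI[of _ C], intro conjI[OF BC(2)] allI impI)
      fix h H M assume *: "antimono h" "\<forall>j. 0 \<le> h j" "0 \<le> H" "seq_bd r \<alpha> d h H" "m0 \<le> M"
      have "(\<Sum>j\<le>N. h j * (real j + 1) powr d) \<le> H * (\<Sum>j\<le>N. 1 / (real j + 1)) powr k" for N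
        using seq_bd_critical[OF r crit _ *(3,4), of N] *(2) by (simp add: k)
      with BC(3)[of h H M] * obtain N where N: "1 \<le> N"
        "M * (\<Sum>j\<le>N. h j * (real j + 1) powr d) \<le> B0 * H * real N" "M \<le> B0 * real N"
        "real N powr g \<le> C * (M powr g * ln (M + 1) powr (g * k))" by blast
      show "\<exists>N\<ge>1. M * (\<Sum>j\<le>N. h j * (real j + 1) powr d) \<le> B0 * H * real N \<and>
        M \<le> B0 * real N powr s \<and> real N powr g \<le> C * (M powr (g / min s 1)
          * (if \<alpha> = over d (conj_exponent r) + 1 then ln (M + 1) powr over (d + 1) (conj_exponent r) else 1))"
      proof (intro exI[of _ N] conjI N(1,2))
        show "M \<le> B0 * real N powr s" using N(1,3) True by simp
        show "real N powr g \<le> C * (M powr (g / min s 1)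
          * (if \<alpha> = over d (conj_exponent r) + 1 then ln (M + 1) powr over (d + 1) (conj_exponent r) else 1))"
          unfolding gk using N(4) crit True by simp
      qed
    qed
  qed
qed

section \<open>Powers on infinite graphs\<close>

context normal_growth
begin

text \<open>All three rest on \<open>d / r + d / r' = d\<close>.\<close>

lemma decay_sums:
  assumes r: "1 \<le> r" and \<alpha>: "over d (conj_exponent r) < \<alpha>"
  shows "0 \<le> \<alpha>" "d < \<alpha> + over d r" "\<alpha> + over d r = d + (\<alpha> - over d (conj_exponent r))"
proof -
  obtain k where k: "0 \<le> k" "k \<le> 1" "\<And>t. over t (conj_exponent r) = t * k" "\<And>t. over t r = t * (1 - k)"
    using over_conj_exponent[OF r] by blast
  have "0 \<le> d * k" using d1 k by simp
  then show "0 \<le> \<alpha>" "d < \<alpha> + over d r" "\<alpha> + over d r = d + (\<alpha> - over d (conj_exponent r))"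
    using \<alpha> by (simp_all add: k algebra_simps)
qed

text \<open>The entries decay at a rate \<open>g > d\<close>, so rows and columns are summable and
  Schur's test applies. The constant \<open>S\<close> later bounds \<open>n * H / \<nu>\<close> from
  below.\<close>

lemma B_alg_bounded:
  assumes r: "1 \<le> r" and \<alpha>: "over d (conj_exponent r) < \<alpha>" and rho: "\<rho> = gdist E" and dd: "d = beurling_dim V E"
  shows "\<exists>S>0. \<forall>A\<in>B_alg V E r \<alpha>. bounded_on_ell2 V A \<and> op_norm V A \<le> S * B_norm V E r \<alpha> A"
proof -
  define g where "g = \<alpha> + over d r"
  note ds = decay_sums[OF r \<alpha>]
  have dg: "d < g" using ds by (simp add: g_def)
  obtain K where K: "0 < K" "\<And>h H. antimono h \<Longrightarrow> \<forall>j. 0 \<le> h j \<Longrightarrow> 0 \<le> H \<Longrightarrow> seq_bd r \<alpha> d h H \<Longrightarrow>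
        \<forall>j. h j \<le> K * H * (real j + 1) powr - g"
    using seq_bd_decay[OF r ds(1) d1] unfolding g_def by blast
  have "bounded_on_ell2 V A \<and> op_norm V A \<le> (K * decay_const g) * B_norm V E r \<alpha> A"
    if A: "A \<in> B_alg V E r \<alpha>" for A
  proof -
    define H where "H = B_norm V E r \<alpha> A"
    define h where "h = (\<lambda>j. enn2real (offdiag_sup V E A j))"
    note hp = B_norm_seq[OF r A, folded h_def H_def dd rho]
    have h0: "0 \<le> h j" for j by (simp add: h_def)
    have hA: "cmod (A u v) \<le> h (\<rho> u v)" if "u \<in> V" "v \<in> V" for u v
      using hp(3)[OF that] by (simp add: h_def)
    have hK: "\<forall>j. h j \<le> K * H * (real j + 1) powr - g" using K(2)[OF hp(1) _ hp(5,4)] h0 by simp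
    have row: "(\<Sum>v\<in>F. h (\<rho> u v)) \<le> K * decay_const g * H" if u: "u \<in> V" and F: "finite F" "F \<subseteq> V" for u F
    proof -
      have "(\<Sum>v\<in>F. h (\<rho> u v)) \<le> (\<Sum>v\<in>F. K * H * (real 1 + real (\<rho> u v)) powr - g)"
        using hK by (intro sum_mono) (simp add: add.commute)
      also have "\<dots> \<le> K * H * (decay_const g * real 1 powr (d - g))"
        unfolding sum_distrib_left[symmetric]
        using K(1) hp(5) by (intro mult_left_mono sum_decay u F dg) auto
      finally show ?thesis by (simp add: mult_ac)
    qed
    have col: "(\<Sum>u\<in>F. h (\<rho> u v)) \<le> K * decay_const g * H" if v: "v \<in> V" and F: "finite F" "F \<subseteq> V" for v F
    proof -
      have "(\<Sum>u\<in>F. h (\<rho> u v)) = (\<Sum>u\<in>F. h (\<rho> v u))"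
      proof (rule sum.cong[OF refl])
        fix u assume "u \<in> F"
        then have "\<rho> u v = \<rho> v u" using v F by (intro dist_sym) auto
        then show "h (\<rho> u v) = h (\<rho> v u)" by simp
      qed
      then show ?thesis using row[OF v F] by simp
    qed
    have nn: "0 \<le> K * decay_const g * H" using K(1) decay_const_pos[OF dg] hp(5) by simp
    show ?thesis
      using schur_bounded[of V A "\<lambda>u v. h (\<rho> u v)" "K * decay_const g * H", OF hA row col nn]
      by (simp add: H_def)
  qed
  moreover have "0 < K * decay_const g" using K(1) decay_const_pos[OF dg] by simp
  ultimately show ?thesis by blast
qed

text \<open>The two conditions on \<open>N\<close> say that the commutator is small: the first
  bounds its part within distance \<open>N\<close>, where the Lipschitz factor helps, the second the
  tail of the kernel. Both are measured against \<open>\<nu> / n\<close>.\<close>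

lemma mat_pow_B_norm_le:
  assumes r: "1 \<le> r" and \<alpha>: "over d (conj_exponent r) < \<alpha>" and rho: "\<rho> = gdist E" and dd: "d = beurling_dim V E"
    and B0: "0 < B0"
  shows "\<exists>C>0. \<forall>A\<in>B_alg V E r \<alpha>. \<forall>n N. bounded_on_ell2 V A \<longrightarrow> 0 < op_norm V A \<longrightarrow> 1 \<le> n \<longrightarrow> 1 \<le> N \<longrightarrow>
    real n * (\<Sum>j\<le>N. enn2real (offdiag_sup V E A j) * (real j + 1) powr d) \<le> B0 * op_norm V A * real N \<longrightarrow>
    real n * B_norm V E r \<alpha> A \<le> B0 * op_norm V A * real N powr (\<alpha> - over d (conj_exponent r)) \<longrightarrow>
    mat_pow V A n \<in> B_alg V E r \<alpha> \<and>
    B_norm V E r \<alpha> (mat_pow V A n) \<le> C * op_norm V A ^ n * real N powr (\<alpha> + over d r)"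
proof -
  define g where "g = \<alpha> + over d r"
  define s where "s = \<alpha> - over d (conj_exponent r)"
  define b where "b = g + 1"
  note ds = decay_sums[OF r \<alpha>]
  have dg: "d < g" and db: "d < b" and gds: "g = d + s" using ds by (simp_all add: g_def b_def s_def)
  obtain Kd where Kd: "0 < Kd" "\<And>h H. antimono h \<Longrightarrow> \<forall>j. 0 \<le> h j \<Longrightarrow> 0 \<le> H \<Longrightarrow> seq_bd r \<alpha> d h H \<Longrightarrow>
        \<forall>j. h j \<le> Kd * H * (real j + 1) powr - g"
    using seq_bd_decay[OF r ds(1) d1] unfolding g_def by blast
  obtain Km where Km: "0 < Km" "\<And>h H. antimono h \<Longrightarrow> \<forall>j. 0 \<le> h j \<Longrightarrow> 0 \<le> H \<Longrightarrow> seq_bd r \<alpha> d h H \<Longrightarrow>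
        seq_bd r \<alpha> d (slow_maj b h) (Km * H)"
    using seq_bd_slow_maj[OF r ds(1) d1] unfolding g_def b_def by blast
  obtain Kb where Kb: "0 < Kb" "\<And>N. 1 \<le> N \<Longrightarrow>
        seq_bd r \<alpha> d (\<lambda>j. (1 + real j / real N) powr - b) (Kb * real N powr g)"
    using seq_bd_bump[OF r ds(1) d1] unfolding g_def b_def by blast
  define F0 where "F0 = Kd * Km * (2 powr g * decay_const g)"
  have F0: "0 \<le> F0" unfolding F0_def using Kd Km decay_const_pos[OF dg] by simp
  \<comment> \<open>\<open>D1 * (d + 1)\<close> comes from \<open>sum_ball_le\<close> with
    \<open>p = 1\<close> for the part of the commutator within distance \<open>N\<close>,
    \<open>F0\<close> from the flattened tail of the majorant.\<close>
  define K0 where "K0 = (D1 * (d + 1) + F0) * B0"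
  have K0: "0 \<le> K0" "F0 * B0 \<le> K0" unfolding K0_def using D1 d1 F0 B0 by simp_all
  \<comment> \<open>Outside the locale the constant takes only these parameters, so it is fixed
    before \<open>A\<close>, \<open>n\<close> and \<open>N\<close>; uniformity of \<open>C\<close>
    depends on this.\<close>
  define Ks where "Ks = localisation.Kstep d D1 D2 b K0"
  define C where "C = 3 powr b * exp Ks * (4 * (Kb + Km * B0))"
  have C: "0 < C" unfolding C_def using Kb Km B0 by (simp add: add_pos_pos)
  have "mat_pow V A n \<in> B_alg V E r \<alpha> \<and> B_norm V E r \<alpha> (mat_pow V A n) \<le> C * op_norm V A ^ n * real N powr g"
    if A: "A \<in> B_alg V E r \<alpha>" and bdd: "bounded_on_ell2 V A" and nu: "0 < op_norm V A" and n: "1 \<le> n" and N: "1 \<le> N"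
      and cond1: "real n * (\<Sum>j\<le>N. enn2real (offdiag_sup V E A j) * (real j + 1) powr d) \<le> B0 * op_norm V A * real N"
      and cond2: "real n * B_norm V E r \<alpha> A \<le> B0 * op_norm V A * real N powr s" for A n N
  proof -
    define \<nu> where "\<nu> = op_norm V A"
    define \<eta> where "\<eta> = \<nu> / real n"
    have eta: "0 < \<eta>" and nu: "0 < \<nu>" using nu n by (simp_all add: \<eta>_def \<nu>_def)
    define H where "H = B_norm V E r \<alpha> A"
    define h where "h = (\<lambda>j. enn2real (offdiag_sup V E A j))"
    note hp = B_norm_seq[OF r A, folded h_def H_def dd rho]
    have h0: "0 \<le> h j" for j by (simp add: h_def)
    have hA: "cmod (A u v) \<le> h (\<rho> u v)" if "u \<in> V" "v \<in> V" for u v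
      using hp(3)[OF that] by (simp add: h_def)
    have c1: "(\<Sum>j\<le>N. h j * (real j + 1) powr d) \<le> B0 * \<eta> * real N"
      using cond1 n by (simp add: h_def \<eta>_def \<nu>_def field_simps)
    have c2: "H \<le> B0 * \<eta> * real N powr s"
      using cond2 n by (simp add: H_def \<eta>_def \<nu>_def field_simps)
    define f where "f = slow_maj b h"
    have b0: "0 \<le> b" using db d1 by simp
    have f_anti: "antimono f" unfolding f_def by (rule slow_maj_antimono) (use hp(1) h0 b0 in auto)
    have hf: "h j \<le> f j" for j unfolding f_def by (rule le_slow_maj)
    have f0: "0 \<le> f j" for j using h0[of j] hf[of j] by simp
    have fbd: "seq_bd r \<alpha> d f (Km * H)" unfolding f_def using Km(2)[OF hp(1) _ hp(5,4)] h0 by simp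
    have KmH: "0 \<le> Km * H" using Km(1) hp(5) by simp
    have fdec: "f j \<le> Kd * (Km * H) * (real j + 1) powr - g" for j
      using Kd(2)[OF f_anti _ KmH fbd] f0 by blast
    \<comment> \<open>Pointwise decay of the majorant gives a mass of order
      \<open>H * N powr - s\<close>, which the second condition on \<open>N\<close> makes a multiple
      of \<open>\<eta>\<close>.\<close>
    have f_sum: "(\<Sum>v\<in>F. f (max (\<rho> u v) N)) \<le> F0 * B0 * \<eta>"
      if u: "u \<in> V" and F: "finite F" "F \<subseteq> V" for u F
    proof -
      have "(\<Sum>v\<in>F. f (max (\<rho> u v) N)) \<le> (\<Sum>v\<in>F. Kd * (Km * H) * 2 powr g * (real N + real (\<rho> u v)) powr - g)"
      proof (rule sum_mono)
        fix v
        have "(real (max (\<rho> u v) N) + 1) powr - g \<le> ((real N + real (\<rho> u v)) / 2) powr - g"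
          by (rule powr_mono2') (use dg d1 N in \<open>auto simp: max_def\<close>)
        also have "\<dots> = 2 powr g * (real N + real (\<rho> u v)) powr - g"
          by (simp add: powr_divide powr_minus field_simps)
        finally have "Kd * (Km * H) * (real (max (\<rho> u v) N) + 1) powr - g
            \<le> Kd * (Km * H) * (2 powr g * (real N + real (\<rho> u v)) powr - g)"
          using Kd(1) KmH by (intro mult_left_mono) auto
        with fdec[of "max (\<rho> u v) N"] show "f (max (\<rho> u v) N) \<le> Kd * (Km * H) * 2 powr g * (real N + real (\<rho> u v)) powr - g"
          by (simp only: mult.assoc)
      qed
      also have "\<dots> \<le> Kd * (Km * H) * 2 powr g * (decay_const g * real N powr (d - g))"
        unfolding sum_distrib_left[symmetric]
        using Kd(1) KmH by (intro mult_left_mono sum_decay u F N dg) auto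
      also have "\<dots> = F0 * (H * real N powr - s)" by (simp add: F0_def gds mult_ac)
      also have "\<dots> \<le> F0 * (B0 * \<eta> * real N powr s * real N powr - s)"
        using c2 F0 by (intro mult_left_mono mult_right_mono) auto
      also have "\<dots> = F0 * B0 * \<eta>" using N by (simp add: mult.assoc flip: powr_add)
      finally show ?thesis .
    qed
    interpret L: localisation V \<rho> d D1 D2 b \<eta> K0 N f
    proof unfold_locales
      show "f i * (real i + 1) powr b \<le> f j * (real j + 1) powr b" if "i \<le> j" for i j
        unfolding f_def using that by (rule slow_maj_slow)
      show "(\<Sum>v\<in>F. f (max (\<rho> u v) N)) \<le> K0 * \<eta>" if "u \<in> V" "finite F" "F \<subseteq> V" for u F
        using f_sum[OF that] K0(2) eta mult_right_mono[OF K0(2), of \<eta>] by linarith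
    qed (use db eta K0 N f_anti f0 in auto)
    have comm: "(\<Sum>z\<in>F. min 1 (real (\<rho> x z) / real N) * h (\<rho> x z)) \<le> K0 * \<eta>"
      if x: "x \<in> V" and F: "finite F" "F \<subseteq> V" for x F
    proof -
      have N0: "0 < real N" using N by simp
      have "(\<Sum>z\<in>F. min 1 (real (\<rho> x z) / real N) * h (\<rho> x z))
        \<le> (\<Sum>z\<in>F. (if z \<in> B x N then 1 / real N * (h (\<rho> x z) * (real (\<rho> x z) + 1) powr 1) else 0) + f (max (\<rho> x z) N))"
      proof (rule sum_mono)
        fix z assume z: "z \<in> F"
        show "min 1 (real (\<rho> x z) / real N) * h (\<rho> x z)
          \<le> (if z \<in> B x N then 1 / real N * (h (\<rho> x z) * (real (\<rho> x z) + 1) powr 1) else 0) + f (max (\<rho> x z) N)"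
        proof (cases "z \<in> B x N")
          case True
          have "min 1 (real (\<rho> x z) / real N) * h (\<rho> x z) \<le> (real (\<rho> x z) + 1) / real N * h (\<rho> x z)"
            using h0 N0 by (intro mult_right_mono min.coboundedI2 divide_right_mono) auto
          then show ?thesis using True f0[of "max (\<rho> x z) N"] by (simp add: mult_ac)
        next
          case False
          then have "N < \<rho> x z" using z F by (auto simp: B_def)
          then have "f (max (\<rho> x z) N) = f (\<rho> x z)" by (simp add: max_absorb1)
          moreover have "min 1 (real (\<rho> x z) / real N) * h (\<rho> x z) \<le> 1 * h (\<rho> x z)"
            using h0 by (intro mult_right_mono) auto
          ultimately show ?thesis using False hf[of "\<rho> x z"] by simp
        qed
      qed
      also have "\<dots> = (\<Sum>z\<in>F. if z \<in> B x N then 1 / real N * (h (\<rho> x z) * (real (\<rho> x z) + 1) powr 1) else 0)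
          + (\<Sum>z\<in>F. f (max (\<rho> x z) N))" by (rule sum.distrib)
      also have "\<dots> \<le> 1 / real N * (D1 * (d + 1) * (B0 * \<eta> * real N)) + F0 * B0 * \<eta>"
      proof (rule add_mono[OF _ f_sum[OF x F]])
        have "(\<Sum>z\<in>F. if z \<in> B x N then 1 / real N * (h (\<rho> x z) * (real (\<rho> x z) + 1) powr 1) else 0)
          = (\<Sum>z\<in>F \<inter> B x N. 1 / real N * (h (\<rho> x z) * (real (\<rho> x z) + 1) powr 1))"
          by (rule sum.inter_restrict[OF F(1), symmetric])
        also have "\<dots> \<le> (\<Sum>z\<in>B x N. 1 / real N * (h (\<rho> x z) * (real (\<rho> x z) + 1) powr 1))"
          by (rule sum_mono2) (use x h0 in auto)
        also have "\<dots> \<le> 1 / real N * (D1 * (d + 1) * (\<Sum>j\<le>N. h j * (real j + 1) powr (d + 1 - 1)))"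
          unfolding sum_distrib_left[symmetric]
          by (intro mult_left_mono sum_ball_le x hp(1) h0) auto
        also have "\<dots> \<le> 1 / real N * (D1 * (d + 1) * (B0 * \<eta> * real N))"
          using c1 D1 d1 by (intro mult_left_mono) auto
        finally show "(\<Sum>z\<in>F. if z \<in> B x N then 1 / real N * (h (\<rho> x z) * (real (\<rho> x z) + 1) powr 1) else 0)
          \<le> 1 / real N * (D1 * (d + 1) * (B0 * \<eta> * real N))" .
      qed
      also have "\<dots> = K0 * \<eta>" using N0 by (simp add: K0_def algebra_simps)
      finally show ?thesis .
    qed
    have Ks0: "0 \<le> Ks" unfolding Ks_def by (rule L.Kstep_nonneg)
    define G where "G = (\<lambda>j. 3 powr b * exp Ks * \<nu> ^ n * L.q j)"
    have G: "antimono G" "\<And>j. 0 \<le> G j"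
      unfolding G_def using nu L.q_nonneg antimonoD[OF L.q_antimono]
      by (auto intro!: antimonoI mult_left_mono)
    have entry: "cmod (mat_pow V A n u w) \<le> G (gdist E u w)" if u: "u \<in> V" and w: "w \<in> V" for u w
    proof -
      have "cmod (mat_pow V A n u w) \<le> 3 powr b * (\<nu> + Ks * \<eta>) ^ n * L.q (\<rho> u w)"
        unfolding Ks_def
        by (rule L.mat_pow_le[OF u w _ hA hf h0 comm]) (use nu op_norm_finite[OF bdd] in \<open>auto simp: \<nu>_def\<close>)
      also have "\<dots> \<le> 3 powr b * (\<nu> ^ n * exp Ks) * L.q (\<rho> u w)"
      proof (intro mult_right_mono mult_left_mono L.q_nonneg)
        have "\<nu> + Ks * \<eta> = \<nu> * (1 + Ks / real n)" by (simp add: \<eta>_def algebra_simps)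
        then have "(\<nu> + Ks * \<eta>) ^ n = \<nu> ^ n * (1 + Ks / real n) ^ n" by (simp add: power_mult_distrib)
        also have "\<dots> \<le> \<nu> ^ n * exp Ks"
          using nu n Ks0 by (intro mult_left_mono exp_ge_one_plus_x_over_n_power_n) auto
        finally show "(\<nu> + Ks * \<eta>) ^ n \<le> \<nu> ^ n * exp Ks" .
      qed auto
      finally show ?thesis by (simp add: G_def rho mult_ac)
    qed
    \<comment> \<open>Both terms of the profile have norm of order \<open>N powr g\<close>: the bump
      by \<open>seq_bd_bump\<close>, the kernel because \<open>N powr d / \<eta> * H\<close> is at
      most of order \<open>N powr (d + s)\<close>.\<close>
    have q_bd: "seq_bd r \<alpha> d L.q (4 * (Kb * real N powr g + Km * B0 * real N powr g))"
    proof -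
      have c0: "0 \<le> real N powr d / \<eta>" using eta by simp
      have "seq_bd r \<alpha> d (\<lambda>j. real N powr d / \<eta> * f j) (real N powr d / \<eta> * (Km * H))"
        by (rule seq_bd_scale[OF r fbd f0 c0 KmH])
      then have "seq_bd r \<alpha> d (\<lambda>j. real N powr d / \<eta> * f (max j N)) (Km * B0 * real N powr g)"
      proof (rule seq_bd_mono[OF r])
        show "real N powr d / \<eta> * f (max j N) \<le> real N powr d / \<eta> * f j" for j
          using c0 antimonoD[OF f_anti, of j "max j N"] by (intro mult_left_mono) auto
        show "0 \<le> real N powr d / \<eta> * f (max j N)" for j by (intro mult_nonneg_nonneg c0 f0)
        have "real N powr d / \<eta> * (Km * H) \<le> real N powr d / \<eta> * (Km * (B0 * \<eta> * real N powr s))"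
          using c0 c2 Km(1) by (intro mult_left_mono) auto
        also have "\<dots> = Km * B0 * (real N powr d * real N powr s)" using eta by simp
        also have "\<dots> = Km * B0 * real N powr g" by (simp add: gds powr_add)
        finally show "real N powr d / \<eta> * (Km * H) \<le> Km * B0 * real N powr g" .
        show "0 \<le> real N powr d / \<eta> * (Km * H)" by (intro mult_nonneg_nonneg c0 KmH)
      qed
      then show ?thesis
        unfolding L.q_def[abs_def]
        by (intro seq_bd_add r Kb(2) N mult_nonneg_nonneg c0 f0) (use Kb(1) Km(1) B0 in auto)
    qed
    have "seq_bd r \<alpha> d G (3 powr b * exp Ks * \<nu> ^ n * (4 * (Kb * real N powr g + Km * B0 * real N powr g)))"
      unfolding G_def
      by (rule seq_bd_scale[OF r q_bd]) (use L.q_nonneg nu Kb(1) Km(1) B0 in auto)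
    also have "3 powr b * exp Ks * \<nu> ^ n * (4 * (Kb * real N powr g + Km * B0 * real N powr g))
       = C * \<nu> ^ n * real N powr g" by (simp add: C_def algebra_simps)
    finally have Gbd: "seq_bd r \<alpha> (beurling_dim V E) G (C * \<nu> ^ n * real N powr g)" by (simp add: dd)
    have "0 \<le> C * \<nu> ^ n * real N powr g" using C nu by simp
    from B_norm_le[OF r entry G this Gbd] show ?thesis by (simp add: \<nu>_def)
  qed
  then show ?thesis using C unfolding g_def s_def by blast
qed

lemma power_growth_infinite:
  assumes r: "1 \<le> r" and \<alpha>: "over d (conj_exponent r) < \<alpha>" and rho: "\<rho> = gdist E" and dd: "d = beurling_dim V E"
  shows "\<exists>C>0. \<forall>A \<in> B_alg V E r \<alpha>. (\<exists>u\<in>V. \<exists>v\<in>V. A u v \<noteq> 0) \<longrightarrow>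
    bounded_on_ell2 V A \<and>
    (\<forall>n\<ge>1.
      mat_pow V A n \<in> B_alg V E r \<alpha> \<and>
      B_norm V E r \<alpha> (mat_pow V A n) / op_norm V A ^ n
        \<le> C * ((real n * B_norm V E r \<alpha> A / op_norm V A)
              powr ((\<alpha> + over d r) / min (\<alpha> - over d (conj_exponent r)) 1)
          * (if \<alpha> = over d (conj_exponent r) + 1
             then ln (real n * B_norm V E r \<alpha> A / op_norm V A + 1)
                    powr over (d + 1) (conj_exponent r)
             else 1)))"
proof -
  obtain S where S: "0 < S" "\<And>A. A \<in> B_alg V E r \<alpha> \<Longrightarrow> bounded_on_ell2 V A"
    "\<And>A. A \<in> B_alg V E r \<alpha> \<Longrightarrow> op_norm V A \<le> S * B_norm V E r \<alpha> A"
    using B_alg_bounded[OF assms] by blast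
  define s where "s = \<alpha> - over d (conj_exponent r)"
  define g where "g = \<alpha> + over d r"
  define X where "X = (\<lambda>M. M powr (g / min s 1)
    * (if \<alpha> = over d (conj_exponent r) + 1 then ln (M + 1) powr over (d + 1) (conj_exponent r) else 1))"
  \<comment> \<open>The lower bound for \<open>M = n * H / \<nu>\<close>: it follows from
    \<open>\<nu> \<le> S * H\<close> and \<open>n \<ge> 1\<close>, and it makes the rounding of the
    radius harmless.\<close>
  have "0 < 1 / S" using S(1) by simp
  from choose_radius[OF r d1 \<alpha> this] obtain B0 C1 where BC: "0 < B0" "0 < C1"
    "\<And>h H M. antimono h \<Longrightarrow> \<forall>j. 0 \<le> h j \<Longrightarrow> 0 \<le> H \<Longrightarrow> seq_bd r \<alpha> d h H \<Longrightarrow> 1 / S \<le> M \<Longrightarrow>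
    \<exists>N\<ge>1. M * (\<Sum>j\<le>N. h j * (real j + 1) powr d) \<le> B0 * H * real N \<and>
      M \<le> B0 * real N powr s \<and> real N powr g \<le> C1 * X M"
    unfolding s_def g_def X_def by blast
  from mat_pow_B_norm_le[OF assms BC(1)] obtain C where C: "0 < C"
    "\<And>A n N. A \<in> B_alg V E r \<alpha> \<Longrightarrow> bounded_on_ell2 V A \<Longrightarrow> 0 < op_norm V A \<Longrightarrow> 1 \<le> n \<Longrightarrow> 1 \<le> N \<Longrightarrow>
    real n * (\<Sum>j\<le>N. enn2real (offdiag_sup V E A j) * (real j + 1) powr d) \<le> B0 * op_norm V A * real N \<Longrightarrow>
    real n * B_norm V E r \<alpha> A \<le> B0 * op_norm V A * real N powr s \<Longrightarrow>
    mat_pow V A n \<in> B_alg V E r \<alpha> \<and>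
    B_norm V E r \<alpha> (mat_pow V A n) \<le> C * op_norm V A ^ n * real N powr g"
    unfolding s_def g_def by blast
  have "mat_pow V A n \<in> B_alg V E r \<alpha> \<and> B_norm V E r \<alpha> (mat_pow V A n) / op_norm V A ^ n
        \<le> C * C1 * X (real n * B_norm V E r \<alpha> A / op_norm V A)"
    if A: "A \<in> B_alg V E r \<alpha>" and nz: "\<exists>u\<in>V. \<exists>v\<in>V. A u v \<noteq> 0" and n: "1 \<le> n" for A n
  proof -
    define \<nu> H where "\<nu> = op_norm V A" and "H = B_norm V E r \<alpha> A"
    define M where "M = real n * H / \<nu>"
    define h where "h = (\<lambda>j. enn2real (offdiag_sup V E A j))"
    note hp = B_norm_seq[OF r A, folded h_def H_def dd]
    have h0: "0 \<le> h j" for j by (simp add: h_def)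
    note bdd = S(2)[OF A]
    obtain u v where "u \<in> V" "v \<in> V" "A u v \<noteq> 0" using nz by blast
    then have "0 < cmod (A u v)" "cmod (A u v) \<le> \<nu>"
      unfolding \<nu>_def using entry_le_op_norm[OF bdd, of u v] by auto
    then have nu: "0 < \<nu>" by linarith
    have nuH: "\<nu> \<le> S * H" unfolding \<nu>_def H_def by (rule S(3)[OF A])
    then have H: "0 < H" using nu S(1) by (metis less_le_trans zero_less_mult_pos)
    have "1 / S \<le> H / \<nu>" using nuH nu S(1) by (simp add: field_simps)
    also have "\<dots> \<le> M"
      unfolding M_def using n H nu by (intro divide_right_mono) auto
    finally have M: "1 / S \<le> M" .
    obtain N where N: "1 \<le> N" "M * (\<Sum>j\<le>N. h j * (real j + 1) powr d) \<le> B0 * H * real N"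
      "M \<le> B0 * real N powr s" "real N powr g \<le> C1 * X M"
      using BC(3)[OF hp(1) _ hp(5,4) M] h0 by blast
    have c1: "real n * (\<Sum>j\<le>N. h j * (real j + 1) powr d) \<le> B0 * \<nu> * real N"
    proof -
      have "H * (real n * (\<Sum>j\<le>N. h j * (real j + 1) powr d)) \<le> H * (B0 * \<nu> * real N)"
        using N(2) nu by (simp add: M_def field_simps)
      then show ?thesis using H by simp
    qed
    have c2: "real n * H \<le> B0 * \<nu> * real N powr s" using N(3) nu by (simp add: M_def field_simps)
    have *: "mat_pow V A n \<in> B_alg V E r \<alpha> \<and> B_norm V E r \<alpha> (mat_pow V A n) \<le> C * \<nu> ^ n * real N powr g"
      unfolding \<nu>_def by (rule C(2)[OF A bdd _ n N(1)]) (use nu c1 c2 in \<open>simp_all add: \<nu>_def h_def H_def\<close>)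
    have "B_norm V E r \<alpha> (mat_pow V A n) / \<nu> ^ n \<le> C * real N powr g"
      using * nu by (simp add: field_simps)
    also have "\<dots> \<le> C * (C1 * X M)" using N(4) C(1) by (intro mult_left_mono) auto
    finally show ?thesis using * by (simp add: \<nu>_def H_def M_def mult.assoc)
  qed
  then show ?thesis
    unfolding s_def[symmetric] g_def[symmetric] using S(2) BC(2) C(1)
    by (intro exI[of _ "C * C1"]) (auto simp: X_def)
qed

end

section \<open>Powers on finite graphs\<close>

lemma seq_bd_finite:
  assumes r: "1 \<le> r" and a: "0 \<le> \<alpha>"
  shows "\<exists>K>0. seq_bd r \<alpha> d (\<lambda>j. if j \<le> L then 1 else 0) K"
  using r
proof (cases rule: exponent_cases)
  case 1
  have "(if j \<le> L then 1 else 0) * (real j + 1) powr \<alpha> \<le> (real L + 1) powr \<alpha>" for j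
    using a by (auto intro!: powr_mono2)
  moreover have "0 < (real L + 1) powr \<alpha>" by simp
  ultimately show ?thesis unfolding 1 seq_bd_infty by blast
next
  case (2 p)
  define W where "W = (\<Sum>j\<le>L. (real j + 1) powr (\<alpha> * p + d - 1))"
  have W: "0 < W" unfolding W_def by (rule sum_pos) auto
  have "(\<Sum>j<m. (if j \<le> L then 1 else 0) powr p * (real j + 1) powr (\<alpha> * p + d - 1)) \<le> W" for m
  proof -
    have "(\<Sum>j<m. (if j \<le> L then 1 else 0) powr p * (real j + 1) powr (\<alpha> * p + d - 1))
       = (\<Sum>j\<in>{..<m} \<inter> {..L}. (real j + 1) powr (\<alpha> * p + d - 1))"
      by (rule sum.mono_neutral_cong_right) auto
    also have "\<dots> \<le> W" unfolding W_def by (rule sum_mono2) auto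
    finally show ?thesis .
  qed
  then have "seq_bd r \<alpha> d (\<lambda>j. if j \<le> L then 1 else 0) (W powr (1 / p))"
    using 2 W unfolding 2(1) seq_bd_ereal by (simp add: powr_powr)
  then show ?thesis using W by (intro exI[of _ "W powr (1 / p)"]) simp
qed

lemma seq_bd_zero:
  assumes r: "1 \<le> r" and h: "0 \<le> h 0" and H: "0 \<le> H" and bd: "seq_bd r \<alpha> d h H"
  shows "h 0 \<le> H"
  using r
proof (cases rule: exponent_cases)
  case 1
  have "\<forall>j. h j * (real j + 1) powr \<alpha> \<le> H" using bd 1 by (simp add: seq_bd_infty)
  from spec[OF this, of 0] show ?thesis by simp
next
  case (2 p)
  have "\<forall>m. (\<Sum>j<m. h j powr p * (real j + 1) powr (\<alpha> * p + d - 1)) \<le> H powr p"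
    using bd 2 by (simp add: seq_bd_ereal)
  from spec[OF this, of 1] have "h 0 powr p \<le> H powr p" by simp
  then have "(h 0 powr p) powr (1 / p) \<le> (H powr p) powr (1 / p)"
    by (rule powr_mono2[rotated 2]) (use 2 in auto)
  then show ?thesis using h H 2 by (simp add: powr_powr)
qed

text \<open>A column starts as a unit vector, and each multiplication enlarges its ell2 norm by at
  most the operator norm.\<close>

lemma mat_pow_entry_le:
  assumes fin: "finite V" and A: "bounded_on_ell2 V A" and u: "u \<in> V" and w: "w \<in> V" and nu: "0 \<le> op_norm V A"
  shows "cmod (mat_pow V A n u w) \<le> op_norm V A ^ n"
proof -
  have "L2_set (\<lambda>x. cmod (mat_pow V A n x w)) V \<le> op_norm V A ^ n"
  proof (induction n)
    case 0
    have "(\<Sum>x\<in>V. (cmod (mat_pow V A 0 x w))\<^sup>2) = (\<Sum>x\<in>V. if x = w then 1 else 0)"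
      by (rule sum.cong) auto
    then show ?case using fin w by (simp add: L2_set_le_iff)
  next
    case (Suc n)
    have "L2_set (\<lambda>x. cmod (mat_pow V A (Suc n) x w)) V
        = L2_set (\<lambda>x. cmod (\<Sum>t\<in>V. A x t * mat_pow V A n t w)) V"
      using fin by (simp add: mat_mult_def)
    also have "\<dots> \<le> op_norm V A * L2_set (\<lambda>t. cmod (mat_pow V A n t w)) V"
      by (rule op_norm_finite[OF A]) (use fin in auto)
    also have "\<dots> \<le> op_norm V A * op_norm V A ^ n"
      by (intro mult_left_mono Suc nu)
    finally show ?case by simp
  qed
  with member_le_L2_set[OF fin u, of "\<lambda>x. cmod (mat_pow V A n x w)"] show ?thesis by linarith
qed

text \<open>Distances are bounded, so the norm of the power is at most a constant times
  \<open>\<nu> ^ n\<close>. The right-hand side stays away from 0, being increasing in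
  \<open>M = n * H / \<nu>\<close>, and \<open>M\<close> is at least \<open>1 / card V\<close> by
  Schur's test with constant entries.\<close>

lemma power_growth_finite:
  assumes r: "1 \<le> r" and G: "connected_simple_graph V E" and fin: "finite V"
    and \<alpha>: "over (beurling_dim V E) (conj_exponent r) < \<alpha>" and d: "d = beurling_dim V E"
  shows "\<exists>C>0. \<forall>A \<in> B_alg V E r \<alpha>. (\<exists>u\<in>V. \<exists>v\<in>V. A u v \<noteq> 0) \<longrightarrow>
    bounded_on_ell2 V A \<and>
    (\<forall>n\<ge>1.
      mat_pow V A n \<in> B_alg V E r \<alpha> \<and>
      B_norm V E r \<alpha> (mat_pow V A n) / op_norm V A ^ n
        \<le> C * ((real n * B_norm V E r \<alpha> A / op_norm V A)
              powr ((\<alpha> + over d r) / min (\<alpha> - over d (conj_exponent r)) 1)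
          * (if \<alpha> = over d (conj_exponent r) + 1
             then ln (real n * B_norm V E r \<alpha> A / op_norm V A + 1)
                    powr over (d + 1) (conj_exponent r)
             else 1)))"
proof -
  obtain k where k: "0 \<le> k" "k \<le> 1" "\<And>t. over t (conj_exponent r) = t * k" "\<And>t. over t r = t * (1 - k)"
    using over_conj_exponent[OF r] by blast
  have d0: "d = 0" using finite_beurling_dim[OF G fin] d by simp
  have a: "0 < \<alpha>" using \<alpha> d0 d by (simp add: k)
  have cV: "0 < real (card V)"
    using G fin by (simp add: connected_simple_graph_def card_gt_0_iff)
  define e where "e = \<alpha> / min \<alpha> 1"
  have e: "0 \<le> e" using a by (simp add: e_def)
  \<comment> \<open>The general expression at \<open>d = 0\<close>: both \<open>over d r\<close> and
    \<open>over d (conj_exponent r)\<close> vanish, and \<open>(d + 1) / r'\<close> is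
    \<open>k\<close>.\<close>
  define X where "X = (\<lambda>M::real. M powr e * (if \<alpha> = 1 then ln (M + 1) powr k else 1))"
  define m0 where "m0 = 1 / real (card V)"
  have m0: "0 < m0" using cV by (simp add: m0_def)
  have X0: "0 < X m0" using m0 by (simp add: X_def)
  have X: "X m0 \<le> X M" if "m0 \<le> M" for M
    unfolding X_def using that m0 e k by (intro mult_mono) (auto intro!: powr_mono2)
  define L where "L = Max ((\<lambda>(u, v). gdist E u v) ` (V \<times> V))"
  have L: "gdist E u v \<le> L" if "u \<in> V" "v \<in> V" for u v
    unfolding L_def using that fin by (intro Max_ge) auto
  obtain K where K: "0 < K" "seq_bd r \<alpha> d (\<lambda>j. if j \<le> L then 1 else 0) K"
    using seq_bd_finite[OF r, of \<alpha> d L] a by auto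
  have "bounded_on_ell2 V A \<and> (\<forall>n\<ge>1. mat_pow V A n \<in> B_alg V E r \<alpha> \<and>
      B_norm V E r \<alpha> (mat_pow V A n) / op_norm V A ^ n
        \<le> K / X m0 * X (real n * B_norm V E r \<alpha> A / op_norm V A))"
    if A: "A \<in> B_alg V E r \<alpha>" and nz: "\<exists>u\<in>V. \<exists>v\<in>V. A u v \<noteq> 0" for A
  proof -
    define \<nu> H where "\<nu> = op_norm V A" and "H = B_norm V E r \<alpha> A"
    note hp = B_norm_seq[OF r A, folded H_def]
    define h0 where "h0 = enn2real (offdiag_sup V E A 0)"
    have h0: "0 \<le> h0" by (simp add: h0_def)
    have h0H: "h0 \<le> H" unfolding h0_def by (rule seq_bd_zero[OF r _ hp(5,4)]) simp
    have Ah: "cmod (A u v) \<le> h0" if "u \<in> V" "v \<in> V" for u v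
      unfolding h0_def using hp(3)[OF that] antimonoD[OF hp(1), of 0 "gdist E u v"] by simp
    have sum: "(\<Sum>v\<in>F. h0) \<le> real (card V) * h0" if "finite F" "F \<subseteq> V" for F
      using card_mono[OF fin that(2)] h0 by (simp add: mult_right_mono)
    have nn: "0 \<le> real (card V) * h0" using h0 by simp
    note bdd = schur_bounded[of V A "\<lambda>_ _. h0" "real (card V) * h0", OF Ah sum sum nn]
    obtain u v where "u \<in> V" "v \<in> V" "A u v \<noteq> 0" using nz by blast
    then have "0 < cmod (A u v)" "cmod (A u v) \<le> \<nu>"
      unfolding \<nu>_def using entry_le_op_norm[OF bdd(1), of u v] by auto
    then have nu: "0 < \<nu>" by linarith
    have nuH: "\<nu> \<le> real (card V) * H"
      using bdd(2) h0H mult_left_mono[OF h0H, of "real (card V)"] by (simp add: \<nu>_def)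
    have "mat_pow V A n \<in> B_alg V E r \<alpha> \<and> B_norm V E r \<alpha> (mat_pow V A n) / \<nu> ^ n
        \<le> K / X m0 * X (real n * H / \<nu>)" if n: "1 \<le> n" for n
    proof -
      define g where "g = (\<lambda>j. \<nu> ^ n * (if j \<le> L then 1 else 0))"
      have nun: "0 \<le> \<nu> ^ n" using nu by simp
      have g: "antimono g" "\<And>j. 0 \<le> g j" unfolding g_def using nun by (auto intro!: antimonoI)
      have entry: "cmod (mat_pow V A n u v) \<le> g (gdist E u v)" if "u \<in> V" "v \<in> V" for u v
        using mat_pow_entry_le[OF fin bdd(1) that, of n] L[OF that] nu by (simp add: g_def \<nu>_def)
      have "seq_bd r \<alpha> d g (\<nu> ^ n * K)"
        unfolding g_def by (rule seq_bd_scale[OF r K(2)]) (use nun K(1) in auto)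
      then have gbd: "seq_bd r \<alpha> (beurling_dim V E) g (\<nu> ^ n * K)" by (simp add: d)
      have "0 \<le> \<nu> ^ n * K" using nun K(1) by simp
      note * = B_norm_le[OF r entry g this gbd]
      have "m0 \<le> H / \<nu>" using nuH nu cV by (simp add: m0_def field_simps)
      also have "\<dots> \<le> real n * H / \<nu>"
        using n h0 h0H nu by (intro divide_right_mono mult_le_cancel_right1[THEN iffD2]) auto
      finally have "X m0 \<le> X (real n * H / \<nu>)" by (rule X)
      then have "K \<le> K / X m0 * X (real n * H / \<nu>)"
        using X0 K(1) by (simp add: field_simps)
      moreover have "B_norm V E r \<alpha> (mat_pow V A n) / \<nu> ^ n \<le> K"
        using *(2) nu by (simp add: field_simps)
      ultimately show ?thesis using *(1) by linarith
    qed
    then show ?thesis using bdd(1) by (simp add: \<nu>_def H_def)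
  qed
  moreover have "0 < K / X m0" using K(1) X0 by simp
  ultimately have "\<exists>C>0. \<forall>A\<in>B_alg V E r \<alpha>. (\<exists>u\<in>V. \<exists>v\<in>V. A u v \<noteq> 0) \<longrightarrow>
    bounded_on_ell2 V A \<and> (\<forall>n\<ge>1. mat_pow V A n \<in> B_alg V E r \<alpha> \<and>
      B_norm V E r \<alpha> (mat_pow V A n) / op_norm V A ^ n
        \<le> C * X (real n * B_norm V E r \<alpha> A / op_norm V A))"
    by blast
  moreover have "X M = M powr ((\<alpha> + over d r) / min (\<alpha> - over d (conj_exponent r)) 1)
      * (if \<alpha> = over d (conj_exponent r) + 1 then ln (M + 1) powr over (d + 1) (conj_exponent r) else 1)" for M
    using d0 by (simp add: X_def e_def k)
  ultimately show ?thesis by (simp only:)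
qed

theorem theorem6p1:
  fixes V :: "'v set" and E :: "('v \<times> 'v) set" and r :: ereal and \<alpha> d :: real
  assumes "1 \<le> r"
    and "connected_simple_graph V E"
    and "polynomial_growth V E"
    and "d = beurling_dim V E"
    and "normal_counting_measure V E"
    and "\<alpha> > over d (conj_exponent r)"
  shows "\<exists>C>0. \<forall>A \<in> B_alg V E r \<alpha>. (\<exists>u\<in>V. \<exists>v\<in>V. A u v \<noteq> 0) \<longrightarrow>
    bounded_on_ell2 V A \<and>
    (\<forall>n\<ge>1.
      mat_pow V A n \<in> B_alg V E r \<alpha> \<and>
      B_norm V E r \<alpha> (mat_pow V A n) / op_norm V A ^ n
        \<le> C * real n
          * (real n * B_norm V E r \<alpha> A / op_norm V A)
              powr ((\<alpha> + over d r) / min (\<alpha> - over d (conj_exponent r)) 1)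
          * (if \<alpha> = over d (conj_exponent r) + 1
             then ln (real n * B_norm V E r \<alpha> A / op_norm V A + 1)
                    powr over (d + 1) (conj_exponent r)
             else 1))"
proof -
  define X where "X = (\<lambda>M. M powr ((\<alpha> + over d r) / min (\<alpha> - over d (conj_exponent r)) 1)
    * (if \<alpha> = over d (conj_exponent r) + 1 then ln (M + 1) powr over (d + 1) (conj_exponent r) else 1))"
  have "\<exists>C>0. \<forall>A \<in> B_alg V E r \<alpha>. (\<exists>u\<in>V. \<exists>v\<in>V. A u v \<noteq> 0) \<longrightarrow>
    bounded_on_ell2 V A \<and> (\<forall>n\<ge>1. mat_pow V A n \<in> B_alg V E r \<alpha> \<and>
      B_norm V E r \<alpha> (mat_pow V A n) / op_norm V A ^ n
        \<le> C * X (real n * B_norm V E r \<alpha> A / op_norm V A))"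
  proof (cases "finite V")
    case True
    show ?thesis
      unfolding X_def
      using power_growth_finite[OF assms(1,2) True _ assms(4)] assms(4,6) by simp
  next
    case False
    obtain D1 D2 where "normal_growth V (gdist E) (beurling_dim V E) D1 D2"
      using infinite_normal_growth[OF assms(2) False assms(3,5)] by blast
    then interpret normal_growth V "gdist E" d D1 D2 using assms(4) by simp
    show ?thesis
      unfolding X_def by (rule power_growth_infinite[OF assms(1,6) refl assms(4)])
  qed
  then obtain C where C: "0 < C" and bound: "\<And>A. A \<in> B_alg V E r \<alpha> \<Longrightarrow> \<exists>u\<in>V. \<exists>v\<in>V. A u v \<noteq> 0 \<Longrightarrow>
    bounded_on_ell2 V A \<and> (\<forall>n\<ge>1. mat_pow V A n \<in> B_alg V E r \<alpha> \<and>
      B_norm V E r \<alpha> (mat_pow V A n) / op_norm V A ^ n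
        \<le> C * X (real n * B_norm V E r \<alpha> A / op_norm V A))"
    by blast
  \<comment> \<open>The bound obtained in both cases is weakened to the stated form; this uses
    \<open>X M \<ge> 0\<close>.\<close>
  have "C * X M \<le> C * real n * X M" if "1 \<le> n" for n M
  proof -
    have "0 \<le> C * X M" using C by (simp add: X_def)
    then have "1 * (C * X M) \<le> real n * (C * X M)" using that by (intro mult_right_mono) auto
    then show ?thesis by (simp add: mult_ac)
  qed
  then have "B_norm V E r \<alpha> (mat_pow V A n) / op_norm V A ^ n
      \<le> C * real n * X (real n * B_norm V E r \<alpha> A / op_norm V A)"
    if "A \<in> B_alg V E r \<alpha>" "\<exists>u\<in>V. \<exists>v\<in>V. A u v \<noteq> 0" "1 \<le> n" for A n
    using bound[OF that(1,2)] that(3) by (meson order_trans)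
  then show ?thesis
    using C bound unfolding X_def mult.assoc[symmetric] by blast
qed

end
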